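(* There exists a constant $\kappa_2 < 140$ such that for every integer $n \ge 1$ and every symmetric log-concave probability density $K$ on $\mathbb{R}^n$, one has $$\| \mathrm{M}_K f \|_{L^2(\mathbb{R}^n)} \le \kappa_2 \, \| f \|_{L^2(\mathbb{R}^n)} \quad \text{for every } f \in L^2(\mathbb{R}^n).$$
   Context: A function $K \ge 0$ on $\mathbb{R}^n$ is log-concave if $K((1-\alpha)x_0+\alpha x_1) \ge K(x_0)^{1-\alpha}K(x_1)^{\alpha}$ for all $x_0,x_1 \in \mathbb{R}^n$ and $\alpha \in [0,1]$. It is symmetric if $K(-x)=K(x)$ for all $x$. For $t>0$ put $K_{(t)}(x) = t^{-n}K(t^{-1}x)$. The maximal operator associated to $K$ is $\mathrm{M}_K f = \sup_{t>0} K_{(t)} * |f|$. *)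

theory Defs
  imports "HOL-Analysis.Analysis"
begin

text \<open>
  The dimension \<open>n\<close> is quantified inside the theorem, below a constant that must not depend on it,
  so it cannot be a type. Vectors of \<open>\<real>\<^sup>n\<close> are represented by the functions in
  \<open>{..<n} \<rightarrow>\<^sub>E UNIV\<close>, which is the space of the library's finite product measure. Results of
  vector operations are restricted to \<open>{..<n}\<close> to stay in this carrier.
\<close>

definition Rn :: "nat \<Rightarrow> (nat \<Rightarrow> real) set" where
  "Rn n = {..<n} \<rightarrow>\<^sub>E (UNIV :: real set)"

text \<open>The completion makes measurability Lebesgue rather than Borel measurability,
  as in the library's \<open>lebesgue = completion lborel\<close>.\<close>

definition lebesgue_Rn :: "nat \<Rightarrow> (nat \<Rightarrow> real) measure" where
  "lebesgue_Rn n = completion (\<Pi>\<^sub>M i\<in>{..<n}. (lborel :: real measure))"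

text \<open>Here \<open>0 powr 0 = 0\<close>, whereas usually \<open>0\<^sup>0 = 1\<close>. This only concerns
  \<open>\<alpha> = 0\<close> and \<open>\<alpha> = 1\<close>, where the inequality is trivial under either convention.\<close>

definition log_concave :: "nat \<Rightarrow> ((nat \<Rightarrow> real) \<Rightarrow> real) \<Rightarrow> bool" where
  "log_concave n K \<longleftrightarrow>
     (\<forall>x\<in>Rn n. 0 \<le> K x) \<and>
     (\<forall>x0\<in>Rn n. \<forall>x1\<in>Rn n. \<forall>\<alpha>\<in>{0..1}.
        K (\<lambda>i\<in>{..<n}. (1 - \<alpha>) * x0 i + \<alpha> * x1 i) \<ge> K x0 powr (1 - \<alpha>) * K x1 powr \<alpha>)"

definition symmetric_fun :: "nat \<Rightarrow> ((nat \<Rightarrow> real) \<Rightarrow> real) \<Rightarrow> bool" where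
  "symmetric_fun n K \<longleftrightarrow> (\<forall>x\<in>Rn n. K (\<lambda>i\<in>{..<n}. - x i) = K x)"

definition prob_density :: "nat \<Rightarrow> ((nat \<Rightarrow> real) \<Rightarrow> real) \<Rightarrow> bool" where
  "prob_density n K \<longleftrightarrow>
     K \<in> borel_measurable (lebesgue_Rn n) \<and>
     (\<forall>x\<in>Rn n. 0 \<le> K x) \<and>
     (\<integral>\<^sup>+x. ennreal (K x) \<partial>lebesgue_Rn n) = 1"

definition dilate :: "nat \<Rightarrow> real \<Rightarrow> ((nat \<Rightarrow> real) \<Rightarrow> real) \<Rightarrow> (nat \<Rightarrow> real) \<Rightarrow> real" where
  "dilate n t K x = t powi (- int n) * K (\<lambda>i\<in>{..<n}. inverse t * x i)"

text \<open>Convolution of nonnegative functions, with values in \<open>[0,\<infinity>]\<close>.\<close>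

definition convolution ::
  "nat \<Rightarrow> ((nat \<Rightarrow> real) \<Rightarrow> real) \<Rightarrow> ((nat \<Rightarrow> real) \<Rightarrow> real) \<Rightarrow> (nat \<Rightarrow> real) \<Rightarrow> ennreal" where
  "convolution n g h x = (\<integral>\<^sup>+y. ennreal (g (\<lambda>i\<in>{..<n}. x i - y i) * h y) \<partial>lebesgue_Rn n)"

definition maximal_op ::
  "nat \<Rightarrow> ((nat \<Rightarrow> real) \<Rightarrow> real) \<Rightarrow> ((nat \<Rightarrow> real) \<Rightarrow> complex) \<Rightarrow> (nat \<Rightarrow> real) \<Rightarrow> ennreal" where
  "maximal_op n K f x = (SUP t\<in>{0<..}. convolution n (dilate n t K) (\<lambda>y. cmod (f y)) x)"

text \<open>The case distinction is the square root extended by \<open>\<infinity>\<close>; the library has no square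
  root on \<^typ>\<open>ennreal\<close>.\<close>

definition L2_norm :: "'a measure \<Rightarrow> ('a \<Rightarrow> ennreal) \<Rightarrow> ennreal" where
  "L2_norm M g =
     (let I = (\<integral>\<^sup>+x. (g x)\<^sup>2 \<partial>M) in if I = \<infinity> then \<infinity> else ennreal (sqrt (enn2real I)))"

definition L2_space :: "'a measure \<Rightarrow> ('a \<Rightarrow> complex) set" where
  "L2_space M = {f \<in> borel_measurable M. L2_norm M (\<lambda>x. ennreal (cmod (f x))) < \<infinity>}"

end

theory Submission
  imports "HOL-Probability.Probability" Defs
begin

text \<open>
  The averages \<open>f \<mapsto> K\<^sub>(\<^sub>t\<^sub>) * f\<close> are Fourier multipliers. On the ray through a frequency \<open>\<xi>\<close> their symbol is the
  cosine transform \<open>m t\<close> of a one-dimensional law, the law of \<open>\<xi> \<bullet> z\<close> for \<open>z\<close> distributed with density \<open>K\<close>. By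
  the Prekopa-Leindler inequality this law is log-concave, and it is symmetric. If \<open>l\<close> denotes its first
  absolute moment, then, with absolute constants, \<open>m t\<close> differs from 1 by at most \<open>t l\<close>, decays like
  \<open>1 / (t l)\<close>, and changes by at most \<open>min (2 (1 - s / t)) ((t - s) l)\<close> between two times \<open>s \<le> t\<close>
  (\<open>symmetric_averages_law\<close>). The dimension does not appear in these estimates, and they are all that
  is used about \<open>K\<close> in frequency space.

  Frequency estimates are turned into \<open>L\<^sup>2\<close> estimates by \<open>square_function_bound\<close>: if the squared Fourier
  transforms of finitely many functions add up to at most \<open>C\<close> times that of \<open>f\<close>, so do their squared norms.
  Averaging over frequencies with a Gaussian weight and letting the weight spread out proves this from
  the continuity of translations in \<open>L\<^sup>1\<close>.

  The supremum over times \<open>2\<^sup>k\<close> is bounded by duality (\<open>lacunary_maximal\<close>). Consecutive averages almost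
  satisfy \<open>A\<^sub>k A\<^sub>l = A\<^sub>l\<close> for \<open>k < l\<close>, with an error that is geometrically small in \<open>l - k\<close>; for operators that
  satisfy this exactly, positivity bounds the dual of the linearized maximal operator by itself, as for
  martingales.

  The times between \<open>2\<^sup>k\<close> and \<open>2\<^sup>k\<^sup>+\<^sup>1\<close> are reached by chaining through dyadic subdivisions
  (\<open>grid_maximal\<close>). The increments of one level form a square function. Its multiplier is estimated by
  interpolating between the Lipschitz bound, which makes the increments of a fine level small, and the
  bounds at high and low frequencies, which make the sum over octaves finite; what remains is a
  geometric series in the level.

  Finally, \<open>K\<close> decreases on rays, so that an average is at most \<open>(t' / t)\<^sup>n\<close> times the average at a later
  time \<open>t'\<close>. Hence fine grids suffice, and Fatou's lemma yields all times and all square integrable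
  functions (\<open>maximal_function_bound\<close>). The constant obtained is 92.
\<close>

section \<open>The Prekopa-Leindler inequality\<close>

text \<open>Take \<open>a \<in> A\<close> almost at the supremum of \<open>A\<close> and \<open>b \<in> B\<close> almost at the infimum of \<open>B\<close>. The
  translates \<open>A + b\<close> and \<open>a + B\<close> lie in \<open>C\<close>, and up to small pieces they lie on the two sides of
  the point \<open>a + b\<close>.\<close>
lemma brunn_minkowski_line:
  fixes A B C :: "real set"
  assumes [measurable]: "A \<in> sets borel" "B \<in> sets borel" "C \<in> sets borel"
    and A: "A \<noteq> {}" "bdd_above A" and B: "B \<noteq> {}" "bdd_below B"
    and C: "\<And>a b. a \<in> A \<Longrightarrow> b \<in> B \<Longrightarrow> a + b \<in> C"
  shows "emeasure lborel A + emeasure lborel B \<le> emeasure lborel C"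
proof (rule ennreal_le_epsilon)
  fix e :: real assume e: "0 < e"
  obtain a where a: "a \<in> A" "Sup A - e / 2 < a"
    using less_cSup_iff[OF A, of "Sup A - e / 2"] e by auto
  obtain b where b: "b \<in> B" "b < Inf B + e / 2"
    using cInf_less_iff[OF B, of "Inf B + e / 2"] e by auto
  define A1 where "A1 = A \<inter> {..a}"
  define B1 where "B1 = B \<inter> {b<..}"
  have [measurable]: "A1 \<in> sets borel" "B1 \<in> sets borel"
    by (auto simp: A1_def B1_def)
  have transl: "emeasure lborel ((+) c -` X) = emeasure lborel X" if "X \<in> sets borel" for c :: real and X
  proof -
    have "emeasure lborel X = emeasure (distr lborel borel ((+) c)) X"
      by (simp add: lborel_distr_plus)
    also have "\<dots> = emeasure lborel ((+) c -` X)"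
      using that by (subst emeasure_distr) auto
    finally show ?thesis by simp
  qed
  have "A \<subseteq> A1 \<union> {a..Sup A}"
    using A(2) by (auto simp: A1_def intro: cSup_upper)
  then have "emeasure lborel A \<le> emeasure lborel (A1 \<union> {a..Sup A})"
    by (intro emeasure_mono) auto
  also have "\<dots> \<le> emeasure lborel A1 + emeasure lborel {a..Sup A}"
    by (intro emeasure_subadditive) auto
  also have "emeasure lborel {a..Sup A} \<le> ennreal (e / 2)"
    using a A by (subst emeasure_lborel_Icc) (auto intro: cSup_upper ennreal_leI)
  finally have 1: "emeasure lborel A \<le> emeasure lborel A1 + ennreal (e / 2)" by auto
  have "B \<subseteq> B1 \<union> {Inf B..b}"
    using B(2) by (auto simp: B1_def intro: cInf_lower)
  then have "emeasure lborel B \<le> emeasure lborel (B1 \<union> {Inf B..b})"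
    by (intro emeasure_mono) auto
  also have "\<dots> \<le> emeasure lborel B1 + emeasure lborel {Inf B..b}"
    by (intro emeasure_subadditive) auto
  also have "emeasure lborel {Inf B..b} \<le> ennreal (e / 2)"
    using b B by (subst emeasure_lborel_Icc) (auto intro: cInf_lower ennreal_leI)
  finally have 2: "emeasure lborel B \<le> emeasure lborel B1 + ennreal (e / 2)" by auto
  have "emeasure lborel A1 + emeasure lborel B1
      = emeasure lborel ((+) (-b) -` A1) + emeasure lborel ((+) (-a) -` B1)"
    by (simp add: transl)
  also have "\<dots> = emeasure lborel ((+) (-b) -` A1 \<union> (+) (-a) -` B1)"
  proof (intro plus_emeasure)
    show "(+) (-b) -` A1 \<inter> (+) (-a) -` B1 = {}" by (auto simp: A1_def B1_def)
    show "(+) (-b) -` A1 \<in> sets lborel" "(+) (-a) -` B1 \<in> sets lborel"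
      using measurable_sets[of "(+) (-b)" borel borel A1] measurable_sets[of "(+) (-a)" borel borel B1]
      by auto
  qed
  also have "\<dots> \<le> emeasure lborel C"
  proof (intro emeasure_mono)
    show "(+) (-b) -` A1 \<union> (+) (-a) -` B1 \<subseteq> C"
      using C[OF _ b(1)] C[OF a(1)] by (force simp: A1_def B1_def)
  qed auto
  finally have 3: "emeasure lborel A1 + emeasure lborel B1 \<le> emeasure lborel C" .
  have "emeasure lborel A + emeasure lborel B
      \<le> (emeasure lborel A1 + ennreal (e / 2)) + (emeasure lborel B1 + ennreal (e / 2))"
    by (rule add_mono[OF 1 2])
  also have "\<dots> = (emeasure lborel A1 + emeasure lborel B1) + ennreal e"
    using e by (simp add: add_ac flip: ennreal_plus)
  also have "\<dots> \<le> emeasure lborel C + ennreal e"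
    by (intro add_right_mono 3)
  finally show "emeasure lborel A + emeasure lborel B \<le> emeasure lborel C + ennreal e" .
qed

lemma nn_integral_layer_cake:
  fixes f :: "real \<Rightarrow> real"
  assumes [measurable]: "f \<in> borel_measurable borel" and f: "\<And>x. 0 \<le> f x" "\<And>x. f x \<le> 1"
  shows "(\<integral>\<^sup>+x. ennreal (f x) \<partial>lborel)
    = (\<integral>\<^sup>+t. emeasure lborel {x. t < f x} * indicator {0<..<1} t \<partial>lborel)"
proof -
  have "(\<integral>\<^sup>+x. ennreal (f x) \<partial>lborel) = (\<integral>\<^sup>+x. (\<integral>\<^sup>+t. indicator {0<..<f x} t \<partial>lborel) \<partial>lborel)"
    using f by (intro nn_integral_cong) simp
  also have "\<dots> = (\<integral>\<^sup>+x. (\<integral>\<^sup>+t. indicator {t. 0 < t \<and> t < f x} t \<partial>lborel) \<partial>lborel)"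
    by (intro nn_integral_cong arg_cong2[where f=nn_integral]) (auto simp: indicator_def fun_eq_iff)
  also have "\<dots> = (\<integral>\<^sup>+t. (\<integral>\<^sup>+x. indicator {t. 0 < t \<and> t < f x} t \<partial>lborel) \<partial>lborel)"
    by (rule lborel_pair.Fubini') measurable
  also have "\<dots> = (\<integral>\<^sup>+t. (\<integral>\<^sup>+x. indicator {x. t < f x} x * indicator {0<..<1} t \<partial>lborel) \<partial>lborel)"
    using f by (intro nn_integral_cong) (auto simp: indicator_def not_le intro: less_le_trans)
  also have "\<dots> = (\<integral>\<^sup>+t. emeasure lborel {x. t < f x} * indicator {0<..<1} t \<partial>lborel)"
    by (intro nn_integral_cong) (subst nn_integral_multc, auto)
  finally show ?thesis .
qed

lemma emeasure_lborel_vimage_divide: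
  fixes c :: real assumes c: "0 < c" and X: "X \<in> sets borel"
  shows "emeasure lborel {x. x / c \<in> X} = ennreal c * emeasure lborel X"
proof -
  have "{x. x / c \<in> X} \<in> sets lborel"
    using measurable_sets[of "\<lambda>x. x / c" borel borel X] X by (auto simp: vimage_def)
  then have "emeasure lborel {x. x / c \<in> X} = (\<integral>\<^sup>+x. indicator {x. x / c \<in> X} x \<partial>lborel)"
    by simp
  also have "\<dots> = (\<integral>\<^sup>+x. indicator X (0 + x / c) \<partial>lborel)"
    by (intro nn_integral_cong) (auto simp: indicator_def)
  also have "\<dots> = ennreal c * (\<integral>\<^sup>+x. indicator X (0 + (0 + c * x) / c) \<partial>lborel)"
    using X c by (subst nn_integral_real_affine[where c=c and t=0]) auto
  also have "\<dots> = ennreal c * emeasure lborel X" using X c by simp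
  finally show ?thesis .
qed

text \<open>If both functions have supremum 1, superlevel sets at a common height below 1 are nonempty and
  Brunn-Minkowski applies level by level.\<close>
lemma prekopa_leindler_line_normalized:
  fixes f g h :: "real \<Rightarrow> real"
  assumes [measurable]: "f \<in> borel_measurable borel" "g \<in> borel_measurable borel" "h \<in> borel_measurable borel"
    and f: "\<And>x. 0 \<le> f x" "\<And>x. f x \<le> 1" "\<And>t. t < 1 \<Longrightarrow> \<exists>x. t < f x" "\<And>x. R < \<bar>x\<bar> \<Longrightarrow> f x = 0"
    and g: "\<And>x. 0 \<le> g x" "\<And>x. g x \<le> 1" "\<And>t. t < 1 \<Longrightarrow> \<exists>x. t < g x" "\<And>x. R < \<bar>x\<bar> \<Longrightarrow> g x = 0"
    and h: "\<And>x. 0 \<le> h x"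
    and a: "0 < a" "a < 1"
    and le: "\<And>x y t. 0 < t \<Longrightarrow> t < f x \<Longrightarrow> t < g y \<Longrightarrow> t < h ((1 - a) * x + a * y)"
  shows "ennreal (1 - a) * (\<integral>\<^sup>+x. f x \<partial>lborel) + ennreal a * (\<integral>\<^sup>+x. g x \<partial>lborel) \<le> (\<integral>\<^sup>+x. h x \<partial>lborel)"
proof -
  define h' where "h' = (\<lambda>x. min 1 (h x))"
  have [measurable]: "h' \<in> borel_measurable borel" by (simp add: h'_def)
  have level: "ennreal (1 - a) * emeasure lborel {x. t < f x} + ennreal a * emeasure lborel {x. t < g x}
      \<le> emeasure lborel {x. t < h' x}" if t: "0 < t" "t < 1" for t
  proof -
    have "ennreal (1 - a) * emeasure lborel {x. t < f x} + ennreal a * emeasure lborel {x. t < g x}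
       = emeasure lborel {x. x / (1 - a) \<in> {x. t < f x}} + emeasure lborel {x. x / a \<in> {x. t < g x}}"
      using a by (subst (1 2) emeasure_lborel_vimage_divide) auto
    also have "\<dots> \<le> emeasure lborel {x. t < h' x}"
    proof (rule brunn_minkowski_line)
      obtain x where "t < f x" using f(3)[OF t(2)] by auto
      then show "{x. x / (1 - a) \<in> {x. t < f x}} \<noteq> {}"
        using a by (auto intro!: exI[of _ "(1-a)*x"])
      obtain x where "t < g x" using g(3)[OF t(2)] by auto
      then show "{x. x / a \<in> {x. t < g x}} \<noteq> {}"
        using a by (auto intro!: exI[of _ "a*x"])
      have fR: "\<bar>x\<bar> \<le> R" if "t < f x" for x using f(4)[of x] that t by (cases "R < \<bar>x\<bar>") auto
      have gR: "\<bar>x\<bar> \<le> R" if "t < g x" for x using g(4)[of x] that t by (cases "R < \<bar>x\<bar>") auto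
      show "bdd_above {x. x / (1 - a) \<in> {x. t < f x}}"
        by (rule bdd_aboveI[of _ "(1-a)*R"]) (use fR a in \<open>force simp: field_simps\<close>)
      show "bdd_below {x. x / a \<in> {x. t < g x}}"
        by (rule bdd_belowI[of _ "-(a*R)"]) (use gR a in \<open>force simp: field_simps\<close>)
      show "x + y \<in> {x. t < h' x}" if "x \<in> {x. x / (1 - a) \<in> {x. t < f x}}" "y \<in> {x. x / a \<in> {x. t < g x}}" for x y
        using le[OF t(1), of "x/(1-a)" "y/a"] that a t by (auto simp: h'_def)
    qed measurable
    finally show ?thesis .
  qed
  have "ennreal (1 - a) * (\<integral>\<^sup>+x. f x \<partial>lborel) + ennreal a * (\<integral>\<^sup>+x. g x \<partial>lborel)
     = (\<integral>\<^sup>+t. (ennreal (1 - a) * emeasure lborel {x. t < f x} + ennreal a * emeasure lborel {x. t < g x})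
          * indicator {0<..<1} t \<partial>lborel)"
    using f g
    by (subst (1 2) nn_integral_layer_cake, simp_all)
       (subst (1 2) nn_integral_cmult[symmetric], simp_all add: nn_integral_add[symmetric] field_simps distrib_left)
  also have "\<dots> \<le> (\<integral>\<^sup>+t. emeasure lborel {x. t < h' x} * indicator {0<..<1} t \<partial>lborel)"
    using level by (intro nn_integral_mono) (auto simp: indicator_def)
  also have "\<dots> = (\<integral>\<^sup>+x. h' x \<partial>lborel)"
    using h by (subst nn_integral_layer_cake) (auto simp: h'_def)
  also have "\<dots> \<le> (\<integral>\<^sup>+x. h x \<partial>lborel)"
    by (intro nn_integral_mono) (auto simp: h'_def intro!: ennreal_leI)
  finally show ?thesis .
qed

lemma weighted_geometric_le_arithmetic:
  fixes x y a :: real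
  assumes "0 \<le> x" "0 \<le> y" "0 < a" "a < 1"
  shows "x powr (1 - a) * y powr a \<le> (1 - a) * x + a * y"
proof (cases "x = 0 \<or> y = 0")
  case True then show ?thesis using assms by auto
next
  case False then show ?thesis using assms Youngs_inequality_0[of "1 - a" a x y] by auto
qed

lemma integrable_lborel_bounded_support:
  fixes f :: "real \<Rightarrow> real"
  assumes [measurable]: "f \<in> borel_measurable borel"
    and "\<And>x. \<bar>f x\<bar> \<le> B" "\<And>x. R < \<bar>x\<bar> \<Longrightarrow> f x = 0"
  shows "integrable lborel f"
proof (rule integrableI_bounded_set[where A="{-R..R}" and B=B])
  show "AE x in lborel. x \<notin> {-R..R} \<longrightarrow> f x = 0" using assms(3) by (intro AE_I2) (auto simp: abs_if not_le split: if_splits)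
qed (use assms in \<open>auto simp: emeasure_lborel_Icc_eq\<close>)

text \<open>Dividing \<open>f\<close> and \<open>g\<close> by their suprema gives an arithmetic mean of the normalized integrals, which
  the weighted arithmetic-geometric mean inequality turns into the multiplicative form.\<close>
lemma prekopa_leindler_line:
  fixes f g h :: "real \<Rightarrow> real"
  assumes [measurable]: "f \<in> borel_measurable borel" "g \<in> borel_measurable borel" "h \<in> borel_measurable borel"
    and f: "\<And>x. 0 \<le> f x" "\<And>x. f x \<le> B" "\<And>x. R < \<bar>x\<bar> \<Longrightarrow> f x = 0"
    and g: "\<And>x. 0 \<le> g x" "\<And>x. g x \<le> B" "\<And>x. R < \<bar>x\<bar> \<Longrightarrow> g x = 0"
    and h: "\<And>x. 0 \<le> h x" "\<And>x. h x \<le> B" "\<And>x. R < \<bar>x\<bar> \<Longrightarrow> h x = 0"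
    and a: "0 < a" "a < 1"
    and le: "\<And>x y. f x powr (1 - a) * g y powr a \<le> h ((1 - a) * x + a * y)"
  shows "(\<integral>x. f x \<partial>lborel) powr (1 - a) * (\<integral>x. g x \<partial>lborel) powr a \<le> (\<integral>x. h x \<partial>lborel)"
proof (cases "(\<forall>x. f x = 0) \<or> (\<forall>x. g x = 0)")
  case True
  have "0 \<le> (\<integral>x. h x \<partial>lborel)" using h by simp
  moreover have "(\<integral>x. f x \<partial>lborel) = 0 \<or> (\<integral>x. g x \<partial>lborel) = 0" using True by auto
  ultimately show ?thesis by auto
next
  case False
  define F where "F = Sup (range f)"
  define G where "G = Sup (range g)"
  have bF: "bdd_above (range f)" and bG: "bdd_above (range g)" using f g by (auto intro!: bdd_aboveI)
  have fF: "f x \<le> F" for x unfolding F_def by (rule cSup_upper[OF _ bF]) auto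
  have gG: "g x \<le> G" for x unfolding G_def by (rule cSup_upper[OF _ bG]) auto
  obtain x0 y0 where "f x0 \<noteq> 0" "g y0 \<noteq> 0" using False by auto
  then have F: "0 < F" and G: "0 < G" using f(1)[of x0] fF[of x0] g(1)[of y0] gG[of y0] by linarith+
  define H where "H = F powr (1 - a) * G powr a"
  have H: "0 < H" using F G by (simp add: H_def)
  have int: "integrable lborel f" "integrable lborel g" "integrable lborel h"
    using f g h by (auto intro!: integrable_lborel_bounded_support[where B=B and R=R])
  have "ennreal (1 - a) * (\<integral>\<^sup>+x. f x / F \<partial>lborel) + ennreal a * (\<integral>\<^sup>+x. g x / G \<partial>lborel) \<le> (\<integral>\<^sup>+x. h x / H \<partial>lborel)"
  proof (rule prekopa_leindler_line_normalized[where R=R])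
    show "\<exists>x. t < f x / F" if "t < 1" for t
      using less_cSup_iff[OF _ bF, of "t * F"] that F by (auto simp: F_def[symmetric] field_simps)
    show "\<exists>x. t < g x / G" if "t < 1" for t
      using less_cSup_iff[OF _ bG, of "t * G"] that G by (auto simp: G_def[symmetric] field_simps)
    show "t < h ((1 - a) * x + a * y) / H" if t: "0 < t" "t < f x / F" "t < g y / G" for t x y
    proof -
      have "t = t powr (1 - a) * t powr a" using t by (simp flip: powr_add)
      also have "\<dots> < (f x / F) powr (1 - a) * (g y / G) powr a"
        using t a by (intro mult_strict_mono powr_less_mono2) auto
      also have "\<dots> = f x powr (1 - a) * g y powr a / H"
        using f g F G by (simp add: H_def powr_divide)
      also have "\<dots> \<le> h ((1 - a) * x + a * y) / H" using le[of x y] H by (simp add: divide_right_mono)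
      finally show ?thesis .
    qed
  qed (use f g h F G H a fF gG in auto)
  then have "ennreal ((1 - a) * (\<integral>x. f x / F \<partial>lborel) + a * (\<integral>x. g x / G \<partial>lborel)) \<le> ennreal (\<integral>x. h x / H \<partial>lborel)"
    using int f g h F G H a
    by (subst (asm) (1 2 3) nn_integral_eq_integral)
       (auto simp: ennreal_mult ennreal_plus simp del: times_divide_eq_right integral_divide_zero)
  then have *: "(1 - a) * ((\<integral>x. f x \<partial>lborel) / F) + a * ((\<integral>x. g x \<partial>lborel) / G) \<le> (\<integral>x. h x \<partial>lborel) / H"
    using h H by (subst (asm) ennreal_le_iff) auto
  have "((\<integral>x. f x \<partial>lborel) / F) powr (1 - a) * ((\<integral>x. g x \<partial>lborel) / G) powr a
     \<le> (1 - a) * ((\<integral>x. f x \<partial>lborel) / F) + a * ((\<integral>x. g x \<partial>lborel) / G)"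
    using f g F G a by (intro weighted_geometric_le_arithmetic) auto
  also note *
  finally have "((\<integral>x. f x \<partial>lborel) powr (1 - a) * (\<integral>x. g x \<partial>lborel) powr a) / H \<le> (\<integral>x. h x \<partial>lborel) / H"
    using f g F G by (simp add: H_def powr_divide)
  then show ?thesis using H by (simp add: divide_le_cancel)
qed

abbreviation Leb :: "nat set \<Rightarrow> (nat \<Rightarrow> real) measure" where
  "Leb I \<equiv> Pi\<^sub>M I (\<lambda>_. lborel :: real measure)"

interpretation Leb: product_sigma_finite "\<lambda>_::nat. lborel :: real measure" ..

lemma sigma_finite_Leb: "finite I \<Longrightarrow> sigma_finite_measure (Leb I)"
  by (rule Leb.sigma_finite)

text \<open>The class in which the Prekopa-Leindler inequality is proved by induction on the dimension:
  integrating out one coordinate stays in it, and all integrals are finite.\<close>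
definition box_bounded :: "nat set \<Rightarrow> real \<Rightarrow> real \<Rightarrow> ((nat \<Rightarrow> real) \<Rightarrow> real) \<Rightarrow> bool" where
  "box_bounded I B R F \<longleftrightarrow> F \<in> borel_measurable (Leb I) \<and>
    (\<forall>x\<in>space (Leb I). 0 \<le> F x \<and> F x \<le> B \<and> ((\<exists>i\<in>I. R < \<bar>x i\<bar>) \<longrightarrow> F x = 0))"

lemma integrable_box_bounded:
  assumes "finite I" "box_bounded I B R F"
  shows "integrable (Leb I) F"
proof (rule integrableI_bounded_set[where A="I \<rightarrow>\<^sub>E {-R..R}" and B=B])
  show "(I \<rightarrow>\<^sub>E {-R..R}) \<in> sets (Leb I)" using assms(1) by (intro sets_PiM_I_finite) auto
  show "emeasure (Leb I) (I \<rightarrow>\<^sub>E {-R..R}) < \<infinity>"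
    using assms(1) by (subst Leb.emeasure_PiM)
      (auto simp: emeasure_lborel_Icc_eq less_top[symmetric] ennreal_prod_eq_top simp del: prod_constant)
  show "AE x in Leb I. x \<notin> (I \<rightarrow>\<^sub>E {-R..R}) \<longrightarrow> F x = 0"
  proof (intro AE_I2 impI)
    fix x assume x: "x \<in> space (Leb I)" "x \<notin> (I \<rightarrow>\<^sub>E {-R..R})"
    then have "\<not> (\<forall>i\<in>I. x i \<in> {-R..R})" by (auto simp: space_PiM PiE_iff)
    then obtain i where "i \<in> I" "x i \<notin> {-R..R}" by blast
    then have "\<exists>i\<in>I. R < \<bar>x i\<bar>" by force
    then show "F x = 0" using assms x by (auto simp: box_bounded_def)
  qed
qed (use assms in \<open>auto simp: box_bounded_def\<close>)

lemma fun_upd_in_Leb: "x \<in> space (Leb I) \<Longrightarrow> x(i := s) \<in> space (Leb (insert i I))"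
  by (auto simp: space_PiM PiE_def extensional_def)

lemma box_bounded_integral_slice:
  assumes i: "i \<notin> I" and R: "0 < R" and F: "box_bounded (insert i I) B R F"
  shows "box_bounded I (B * (2 * R)) R (\<lambda>x. \<integral>s. F (x(i := s)) \<partial>lborel)"
    and "\<And>x. x \<in> space (Leb I) \<Longrightarrow> (\<lambda>s. F (x(i := s))) \<in> borel_measurable borel"
proof -
  have [measurable]: "F \<in> borel_measurable (Leb (insert i I))" using F by (simp add: box_bounded_def)
  have *: "(\<lambda>p. F ((fst p)(i := snd p))) \<in> borel_measurable (Leb I \<Otimes>\<^sub>M lborel)"
    using measurable_compose[OF measurable_add_dim, of F i I "\<lambda>_. lborel" borel] by (simp add: split_beta')
  have m: "(\<lambda>x. \<integral>s. F (x(i := s)) \<partial>lborel) \<in> borel_measurable (Leb I)"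
    using lborel.borel_measurable_lebesgue_integral[of "\<lambda>x s. F (x(i := s))" "Leb I"] *
    by (simp add: split_beta')
  show ms: "(\<lambda>s. F (x(i := s))) \<in> borel_measurable borel" if x: "x \<in> space (Leb I)" for x
    using measurable_compose[OF measurable_component_update, of x I "\<lambda>_. lborel" i F borel] x i by simp
  have b: "0 \<le> F (x(i := s)) \<and> F (x(i := s)) \<le> B \<and> (R < \<bar>s\<bar> \<longrightarrow> F (x(i := s)) = 0)
     \<and> ((\<exists>j\<in>I. R < \<bar>x j\<bar>) \<longrightarrow> F (x(i := s)) = 0)" if x: "x \<in> space (Leb I)" for x s
    using F fun_upd_in_Leb[OF x, of i s] i unfolding box_bounded_def by (auto 0 3)
  show "box_bounded I (B * (2 * R)) R (\<lambda>x. \<integral>s. F (x(i := s)) \<partial>lborel)"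
    unfolding box_bounded_def
  proof (intro conjI ballI impI m)
    fix x assume x: "x \<in> space (Leb I)"
    show "0 \<le> (\<integral>s. F (x(i := s)) \<partial>lborel)" using b[OF x] by (intro integral_nonneg_AE) auto
    have B: "0 \<le> B" using b[OF x] by (meson order_trans)
    have "(\<integral>s. F (x(i := s)) \<partial>lborel) \<le> (\<integral>s. B * indicator {-R..R} s \<partial>lborel)"
    proof (intro integral_mono)
      show "integrable lborel (\<lambda>s. F (x(i := s)))"
        by (rule integrable_lborel_bounded_support[where B=B and R=R]) (use b[OF x] ms[OF x] in auto)
      show "F (x(i := s)) \<le> B * indicator {-R..R} s" for s
        using b[OF x, of s] by (auto simp: indicator_def)
    qed (auto intro!: integrable_real_mult_indicator simp: emeasure_lborel_Icc_eq)
    also have "\<dots> = B * (2 * R)" using R by simp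
    finally show "(\<integral>s. F (x(i := s)) \<partial>lborel) \<le> B * (2 * R)" .
    assume "\<exists>j\<in>I. R < \<bar>x j\<bar>"
    then have "F (x(i := s)) = 0" for s using b[OF x, of s] by auto
    then show "(\<integral>s. F (x(i := s)) \<partial>lborel) = 0" by simp
  qed
qed

text \<open>One coordinate is integrated out with the inequality on the line; the resulting functions of the
  remaining coordinates satisfy the hypothesis again.\<close>
theorem prekopa_leindler:
  assumes "finite I" and a: "0 < a" "a < 1" and R: "0 < R"
    and "box_bounded I B R F" "box_bounded I B R G" "box_bounded I B R H"
    and "\<And>x y. x \<in> space (Leb I) \<Longrightarrow> y \<in> space (Leb I) \<Longrightarrow>
      F x powr (1 - a) * G y powr a \<le> H (\<lambda>i\<in>I. (1 - a) * x i + a * y i)"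
  shows "(\<integral>x. F x \<partial>Leb I) powr (1 - a) * (\<integral>x. G x \<partial>Leb I) powr a \<le> (\<integral>x. H x \<partial>Leb I)"
  using assms(1,5-)
proof (induction I arbitrary: F G H B)
  case empty
  have "(\<integral>x. f x \<partial>Leb {}) = f (\<lambda>_. undefined)" for f :: "_ \<Rightarrow> real"
    by (simp add: PiM_empty lebesgue_integral_count_space_finite)
  then show ?case using empty(4)[of "\<lambda>_. undefined" "\<lambda>_. undefined"]
    by (simp add: space_PiM restrict_def)
next
  case (insert i I)
  let ?F = "\<lambda>F x. \<integral>s. F (x(i := s)) \<partial>lborel"
  note sl = box_bounded_integral_slice[OF insert(2) R]
  have split: "(\<integral>x. F x \<partial>Leb (insert i I)) = (\<integral>x. ?F F x \<partial>Leb I)" if "box_bounded (insert i I) B R F" for F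
    using insert(1,2) that by (intro Leb.product_integral_insert integrable_box_bounded) auto
  have b: "0 \<le> F (x(i := s)) \<and> F (x(i := s)) \<le> B \<and> (R < \<bar>s\<bar> \<longrightarrow> F (x(i := s)) = 0)"
    if "box_bounded (insert i I) B R F" "x \<in> space (Leb I)" for x s F
    using that(1) fun_upd_in_Leb[OF that(2), of i s] unfolding box_bounded_def by (auto 0 3)
  have "(\<integral>x. ?F F x \<partial>Leb I) powr (1 - a) * (\<integral>x. ?F G x \<partial>Leb I) powr a \<le> (\<integral>x. ?F H x \<partial>Leb I)"
  proof (rule insert.IH)
    show "box_bounded I (B * (2 * R)) R (?F F)" "box_bounded I (B * (2 * R)) R (?F G)"
         "box_bounded I (B * (2 * R)) R (?F H)"
      using insert.prems(1-3) by (auto intro: sl)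
    fix x y assume x: "x \<in> space (Leb I)" and y: "y \<in> space (Leb I)"
    let ?z = "\<lambda>j\<in>I. (1 - a) * x j + a * y j"
    have z: "?z \<in> space (Leb I)" by (simp add: space_PiM)
    show "?F F x powr (1 - a) * ?F G y powr a \<le> ?F H ?z"
    proof (rule prekopa_leindler_line[where B=B and R=R, OF _ _ _ _ _ _ _ _ _ _ _ _ a])
      fix s t
      have "F (x(i := s)) powr (1 - a) * G (y(i := t)) powr a
        \<le> H (\<lambda>j\<in>insert i I. (1 - a) * (x(i := s)) j + a * (y(i := t)) j)"
        by (intro insert.prems fun_upd_in_Leb x y)
      also have "(\<lambda>j\<in>insert i I. (1 - a) * (x(i := s)) j + a * (y(i := t)) j) = ?z(i := (1 - a) * s + a * t)"
        using insert(2) by (auto simp: fun_eq_iff restrict_def)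
      finally show "F (x(i := s)) powr (1 - a) * G (y(i := t)) powr a \<le> H (?z(i := (1 - a) * s + a * t))" .
    qed (use insert.prems(1-3) x y z sl(2) b in auto)
  qed
  then show ?case using insert.prems(1-3) by (simp add: split)
qed

section \<open>Affine changes of variables\<close>

text \<open>Reflection, translation and dilation are the cases that occur. In a convolution at scale \<open>t\<close> the point
  \<open>x - t z\<close> is \<open>affine_map n (- t) x z\<close>.\<close>
definition affine_map :: "nat \<Rightarrow> real \<Rightarrow> (nat \<Rightarrow> real) \<Rightarrow> (nat \<Rightarrow> real) \<Rightarrow> nat \<Rightarrow> real" where
  "affine_map n c a x = (\<lambda>i\<in>{..<n}. c * x i + a i)"

lemma affine_map_in_space [simp, intro]: "affine_map n c a x \<in> space (Leb {..<n})"
  by (simp add: affine_map_def space_PiM)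

lemma measurable_affine_map [measurable]:
  "affine_map n c a \<in> measurable (Leb {..<n}) (Leb {..<n})"
  unfolding affine_map_def by measurable

lemma measurable_affine_map_pair:
  "(\<lambda>p. affine_map n c (fst p) (snd p)) \<in> measurable (Leb {..<n} \<Otimes>\<^sub>M Leb {..<n}) (Leb {..<n})"
  unfolding affine_map_def by measurable

lemma nn_integral_affine_map:
  assumes c: "c \<noteq> 0" and [measurable]: "F \<in> borel_measurable (Leb {..<n})"
  shows "(\<integral>\<^sup>+x. F x \<partial>Leb {..<n}) = ennreal (\<bar>c\<bar> ^ n) * (\<integral>\<^sup>+x. F (affine_map n c a x) \<partial>Leb {..<n})"
proof -
  let ?L = "Leb {..<n}"
  let ?D = "scale_measure (ennreal (\<bar>c\<bar> ^ n)) (distr ?L ?L (affine_map n c a))"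
  have "?D = ?L"
  proof (rule Leb.PiM_eqI)
    fix A :: "nat \<Rightarrow> real set" assume A: "\<And>i. i \<in> {..<n} \<Longrightarrow> A i \<in> sets lborel"
    have *: "emeasure lborel {s. c * s + t \<in> X} = ennreal (1 / \<bar>c\<bar>) * emeasure lborel X"
      "{s. c * s + t \<in> X} \<in> sets lborel"
      if X: "X \<in> sets lborel" for X t
    proof -
      show m: "{s. c * s + t \<in> X} \<in> sets lborel"
        using measurable_sets[of "\<lambda>s. c * s + t" borel borel X] X by (auto simp: vimage_def)
      have "emeasure lborel X = (\<integral>\<^sup>+s. indicator X s \<partial>lborel)" using X by simp
      also have "\<dots> = ennreal \<bar>c\<bar> * (\<integral>\<^sup>+s. indicator X (t + c * s) \<partial>lborel)"
        using X c by (subst nn_integral_real_affine[where c=c and t=t]) auto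
      also have "(\<integral>\<^sup>+s. indicator X (t + c * s) \<partial>lborel) = (\<integral>\<^sup>+s. indicator {s. c * s + t \<in> X} s \<partial>lborel)"
        by (intro nn_integral_cong) (auto simp: indicator_def add.commute)
      finally have "emeasure lborel X = ennreal \<bar>c\<bar> * emeasure lborel {s. c * s + t \<in> X}" using m by simp
      then show "emeasure lborel {s. c * s + t \<in> X} = ennreal (1 / \<bar>c\<bar>) * emeasure lborel X"
        using c by (simp add: mult.assoc[symmetric] flip: ennreal_mult)
    qed
    have "affine_map n c a -` Pi\<^sub>E {..<n} A \<inter> space ?L = (\<Pi>\<^sub>E i\<in>{..<n}. {s. c * s + a i \<in> A i})"
      by (auto simp: affine_map_def space_PiM PiE_def Pi_def extensional_def)
    then have "emeasure ?D (Pi\<^sub>E {..<n} A) = ennreal (\<bar>c\<bar> ^ n) * emeasure ?L (\<Pi>\<^sub>E i\<in>{..<n}. {s. c * s + a i \<in> A i})"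
      using A by (simp add: emeasure_distr sets_PiM_I_finite)
    also have "\<dots> = ennreal (\<bar>c\<bar> ^ n) * (\<Prod>i<n. ennreal (1 / \<bar>c\<bar>) * emeasure lborel (A i))"
      using A by (subst Leb.emeasure_PiM) (auto simp: *)
    also have "\<dots> = (\<Prod>i<n. emeasure lborel (A i))"
      using c by (simp add: prod.distrib ennreal_power mult.assoc[symmetric] power_divide flip: ennreal_mult)
    finally show "emeasure ?D (Pi\<^sub>E {..<n} A) = (\<Prod>i<n. emeasure lborel (A i))" .
  qed simp_all
  then have "(\<integral>\<^sup>+x. F x \<partial>?L) = (\<integral>\<^sup>+x. F x \<partial>?D)" by simp
  also have "\<dots> = ennreal (\<bar>c\<bar> ^ n) * (\<integral>\<^sup>+x. F (affine_map n c a x) \<partial>?L)"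
    by (simp add: nn_integral_scale_measure nn_integral_distr)
  finally show ?thesis .
qed

lemma
  fixes F :: "_ \<Rightarrow> 'b::{banach, second_countable_topology}"
  assumes c: "c \<noteq> 0" and [measurable]: "F \<in> borel_measurable (Leb {..<n})"
  shows integrable_affine_map_iff:
      "integrable (Leb {..<n}) (\<lambda>x. F (affine_map n c a x)) \<longleftrightarrow> integrable (Leb {..<n}) F"
    and integral_affine_map:
      "(\<integral>x. F x \<partial>Leb {..<n}) = \<bar>c\<bar> ^ n *\<^sub>R (\<integral>x. F (affine_map n c a x) \<partial>Leb {..<n})"
proof -
  let ?L = "Leb {..<n}"
  let ?D = "density (distr ?L ?L (affine_map n c a)) (\<lambda>_. ennreal (\<bar>c\<bar> ^ n))"
  have "?D = ?L"
  proof (rule measure_eqI)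
    fix A assume "A \<in> sets ?D"
    then have [measurable]: "A \<in> sets ?L" by simp
    have "emeasure ?D A = (\<integral>\<^sup>+x. indicator A x \<partial>?D)"
      by (rule nn_integral_indicator[symmetric]) simp
    also have "\<dots> = ennreal (\<bar>c\<bar> ^ n) * (\<integral>\<^sup>+x. indicator A (affine_map n c a x) \<partial>?L)"
      by (subst nn_integral_density, simp_all del: nn_integral_indicator)
         (subst nn_integral_cmult, simp_all del: nn_integral_indicator add: nn_integral_distr)
    also have "\<dots> = emeasure ?L A"
      using nn_integral_affine_map[OF c, of "indicator A" n a] by simp
    finally show "emeasure ?D A = emeasure ?L A" .
  qed simp
  note D = this
  have "integrable ?L F \<longleftrightarrow> integrable ?D F" by (simp add: D)
  also have "\<dots> \<longleftrightarrow> integrable ?L (\<lambda>x. F (affine_map n c a x))"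
  proof -
    have "integrable ?L (\<lambda>x. \<bar>c\<bar> ^ n *\<^sub>R F (affine_map n c a x)) \<longleftrightarrow> integrable ?L (\<lambda>x. F (affine_map n c a x))"
      using c integrable_scaleR_right[of "1 / \<bar>c\<bar> ^ n" ?L "\<lambda>x. \<bar>c\<bar> ^ n *\<^sub>R F (affine_map n c a x)"]
      by (auto intro: integrable_scaleR_right)
    then show ?thesis by (subst integrable_density) (auto simp: integrable_distr_eq)
  qed
  finally show "integrable ?L (\<lambda>x. F (affine_map n c a x)) \<longleftrightarrow> integrable ?L F" by simp
  have "(\<integral>x. F x \<partial>?L) = (\<integral>x. F x \<partial>?D)" by (simp add: D)
  also have "\<dots> = \<bar>c\<bar> ^ n *\<^sub>R (\<integral>x. F (affine_map n c a x) \<partial>?L)"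
    by (subst integral_density) (auto simp: integral_distr)
  finally show "(\<integral>x. F x \<partial>?L) = \<bar>c\<bar> ^ n *\<^sub>R (\<integral>x. F (affine_map n c a x) \<partial>?L)" .
qed

section \<open>Even log-concave densities on the line\<close>

locale even_log_concave_density =
  fixes \<phi> :: "real \<Rightarrow> real"
  assumes borel [measurable]: "\<phi> \<in> borel_measurable borel"
    and nonneg: "\<And>u. 0 \<le> \<phi> u"
    and even: "\<And>u. \<phi> (- u) = \<phi> u"
    and log_concave: "\<And>u v a. 0 < a \<Longrightarrow> a < 1 \<Longrightarrow>
      \<phi> u powr (1 - a) * \<phi> v powr a \<le> \<phi> ((1 - a) * u + a * v)"
    and integrable: "integrable lborel \<phi>"
    and integral: "(\<integral>u. \<phi> u \<partial>lborel) = 1"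
begin

text \<open>A point \<open>u\<close> with \<open>\<bar>u\<bar> < \<bar>v\<bar>\<close> is a convex combination of \<open>v\<close> and \<open>- v\<close>, where \<open>\<phi>\<close> takes the same value.\<close>
lemma decreasing: assumes "\<bar>u\<bar> \<le> \<bar>v\<bar>" shows "\<phi> v \<le> \<phi> u"
proof -
  have *: "\<phi> v \<le> \<phi> u" if "0 \<le> u" "u < v" for u v
  proof -
    define a where "a = (1 - u / v) / 2"
    have a: "0 < a" "a < 1" "(1 - a) * v + a * (- v) = u"
      using that by (auto simp: a_def field_simps)
    have "\<phi> v = \<phi> v powr (1 - a) * \<phi> v powr a"
      using nonneg[of v] by (cases "\<phi> v = 0") (auto simp flip: powr_add)
    also have "\<dots> \<le> \<phi> u" using log_concave[OF a(1,2), of v "-v"] a(3) even by simp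
    finally show ?thesis .
  qed
  have "\<phi> \<bar>v\<bar> \<le> \<phi> \<bar>u\<bar>" using *[of "\<bar>u\<bar>" "\<bar>v\<bar>"] assms by (cases "\<bar>u\<bar> = \<bar>v\<bar>") auto
  then show ?thesis using even by (auto simp: abs_if split: if_splits)
qed

lemma le_at_0: "\<phi> u \<le> \<phi> 0" by (rule decreasing) simp

lemma pos_at_0: "0 < \<phi> 0"
proof (rule ccontr)
  assume "\<not> 0 < \<phi> 0"
  then have "\<phi> u = 0" for u using le_at_0[of u] nonneg[of u] by auto
  then show False using integral by simp
qed

lemma integrable_mult_cos: "integrable lborel (\<lambda>u. \<phi> u * cos (s * u))"
  by (rule Bochner_Integration.integrable_bound[OF integrable]) (auto simp: abs_mult nonneg mult_left_le)

lemma shift: 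
  fixes f :: "real \<Rightarrow> real"
  shows "integrable lborel (\<lambda>u. \<phi> (u - h))" "(\<integral>u. f (u - h) \<partial>lborel) = (\<integral>u. f u \<partial>lborel)"
  using lborel_integrable_real_affine[OF integrable, of 1 "-h"] lborel_integral_real_affine[of 1 f "-h"]
  by (simp_all add: algebra_simps)

text \<open>Translation by half a period turns \<open>cos\<close> into \<open>- cos\<close>; so the integral is bounded by half the
  total variation between the density and its translate, which unimodality makes explicit.\<close>
lemma cos_transform_decay:
  assumes s: "0 < s"
  shows "\<bar>\<integral>u. \<phi> u * cos (s * u) \<partial>lborel\<bar> \<le> pi * \<phi> 0 / s"
proof -
  define h where "h = pi / s"
  have h: "0 < h" "s * h = pi" using s by (auto simp: h_def)
  let ?m = "\<integral>u. \<phi> u * cos (s * u) \<partial>lborel"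
  have int_h: "integrable lborel (\<lambda>u. \<phi> (u - h) * cos (s * u))"
    by (rule Bochner_Integration.integrable_bound[OF shift(1)[of h]]) (auto simp: abs_mult nonneg mult_left_le)
  have "?m = (\<integral>u. \<phi> (u - h) * cos (s * (u - h)) \<partial>lborel)"
    using shift(2)[of "\<lambda>u. \<phi> u * cos (s * u)" h] by simp
  also have "\<dots> = - (\<integral>u. \<phi> (u - h) * cos (s * u) \<partial>lborel)"
    by (subst integral_minus[symmetric]) (auto intro!: Bochner_Integration.integral_cong simp: right_diff_distrib h cos_diff)
  finally have eq: "2 * ?m = (\<integral>u. (\<phi> u - \<phi> (u - h)) * cos (s * u) \<partial>lborel)"
    using int_h integrable_mult_cos by (simp add: left_diff_distrib)
  have "\<bar>2 * ?m\<bar> \<le> (\<integral>u. \<bar>\<phi> u - \<phi> (u - h)\<bar> \<partial>lborel)"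
    unfolding eq
  proof (intro order_trans[OF integral_abs_bound] integral_mono)
    show "integrable lborel (\<lambda>u. \<bar>(\<phi> u - \<phi> (u - h)) * cos (s * u)\<bar>)"
      using int_h integrable_mult_cos by (intro integrable_abs) (simp add: left_diff_distrib)
    show "\<bar>(\<phi> u - \<phi> (u - h)) * cos (s * u)\<bar> \<le> \<bar>\<phi> u - \<phi> (u - h)\<bar>" for u
      by (simp add: abs_mult mult_left_le)
  qed (use integrable shift(1)[of h] in auto)
  also have "(\<integral>u. \<bar>\<phi> u - \<phi> (u - h)\<bar> \<partial>lborel)
     = (\<integral>u. 2 * (\<phi> u * indicator {..h/2} u - \<phi> (u - h) * indicator {..- h/2} (u - h)) - (\<phi> u - \<phi> (u - h)) \<partial>lborel)"
  proof (intro Bochner_Integration.integral_cong refl)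
    fix u
    have "u \<le> h / 2 \<Longrightarrow> \<phi> (u - h) \<le> \<phi> u" "\<not> u \<le> h / 2 \<Longrightarrow> \<phi> u \<le> \<phi> (u - h)"
      using h by (auto intro!: decreasing)
    then show "\<bar>\<phi> u - \<phi> (u - h)\<bar> = 2 * (\<phi> u * indicator {..h/2} u - \<phi> (u - h) * indicator {..- h/2} (u - h)) - (\<phi> u - \<phi> (u - h))"
      by (cases "u \<le> h / 2") (auto simp: indicator_def)
  qed
  also have "\<dots> = 2 * ((\<integral>u. \<phi> u * indicator {..h/2} u \<partial>lborel) - (\<integral>u. \<phi> u * indicator {..- h/2} u \<partial>lborel))"
    using integrable shift(1)[of h] shift(2)[of \<phi> h] shift(2)[of "\<lambda>u. \<phi> u * indicator {..- h/2} u" h]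
      integrable_real_mult_indicator[OF _ shift(1)[of h], of "{..h/2}"]
      integrable_real_mult_indicator[OF _ integrable, of "{..h/2}"]
      lborel_integrable_real_affine[OF integrable_real_mult_indicator[OF _ integrable, of "{..-h/2}"], of 1 "-h"]
    by simp
  also have "(\<integral>u. \<phi> u * indicator {..h/2} u \<partial>lborel) - (\<integral>u. \<phi> u * indicator {..- h/2} u \<partial>lborel)
     = (\<integral>u. \<phi> u * indicator {-h/2<..h/2} u \<partial>lborel)"
  proof -
    have "integrable lborel (\<lambda>u. \<phi> u * indicator {..h/2} u)" "integrable lborel (\<lambda>u. \<phi> u * indicator {..- h/2} u)"
      by (auto intro!: integrable_real_mult_indicator integrable)
    note Bochner_Integration.integral_diff[OF this, symmetric]
    also have "(\<integral>u. \<phi> u * indicator {..h/2} u - \<phi> u * indicator {..- h/2} u \<partial>lborel)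
        = (\<integral>u. \<phi> u * indicator {-h/2<..h/2} u \<partial>lborel)"
      using h by (intro Bochner_Integration.integral_cong) (auto simp: indicator_def)
    finally show ?thesis .
  qed
  also have "(\<integral>u. \<phi> u * indicator {-h/2<..h/2} u \<partial>lborel) \<le> (\<integral>u. \<phi> 0 * indicator {-h/2<..h/2} u \<partial>lborel)"
  proof (rule integral_mono)
    show "integrable lborel (\<lambda>u. \<phi> 0 * indicator {-h/2<..h/2} u)"
      using h by (intro integrable_mult_right integrable_real_indicator) auto
    show "integrable lborel (\<lambda>u. \<phi> u * indicator {-h/2<..h/2} u)"
      by (intro integrable_real_mult_indicator integrable) auto
  qed (auto simp: indicator_def le_at_0)
  also have "(\<integral>u. \<phi> 0 * indicator {-h/2<..h/2} u \<partial>lborel) = \<phi> 0 * h" using h by simp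
  finally have "\<bar>2 * ?m\<bar> \<le> 2 * (\<phi> 0 * h)" by simp
  then show ?thesis by (simp add: h_def mult.commute)
qed

lemma cos_transform_scaled:
  assumes "0 < a"
  shows "(\<integral>u. \<phi> u * cos (a * u) \<partial>lborel) = (\<integral>u. \<phi> (u / a) / a * cos u \<partial>lborel)"
    "integrable lborel (\<lambda>u. \<phi> (u / a) / a)" "(\<integral>u. \<phi> (u / a) / a \<partial>lborel) = 1"
proof -
  show "(\<integral>u. \<phi> u * cos (a * u) \<partial>lborel) = (\<integral>u. \<phi> (u / a) / a * cos u \<partial>lborel)"
    using assms lborel_integral_real_affine[of "1 / a" "\<lambda>u. \<phi> u * cos (a * u)" 0] by simp
  show "(\<integral>u. \<phi> (u / a) / a \<partial>lborel) = 1"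
    using assms lborel_integral_real_affine[of "1 / a" \<phi> 0] integral by simp
  show "integrable lborel (\<lambda>u. \<phi> (u / a) / a)"
    using assms lborel_integrable_real_affine[OF integrable, of "1 / a" 0] by simp
qed

text \<open>Changing the frequency amounts to dilating the density. As \<open>\<phi> (u / a) \<le> \<phi> (u / b)\<close>, the
  \<open>L\<^sup>1\<close> distance of the two dilated densities is controlled by integrals that are known exactly.\<close>
lemma cos_transform_lipschitz:
  assumes a: "0 < a" "a \<le> b"
  shows "\<bar>(\<integral>u. \<phi> u * cos (a * u) \<partial>lborel) - (\<integral>u. \<phi> u * cos (b * u) \<partial>lborel)\<bar> \<le> 2 * (1 - a / b)"
proof -
  have b: "0 < b" using a by simp
  let ?f = "\<lambda>a u. \<phi> (u / a) / a"
  note A = cos_transform_scaled[OF a(1)] and B = cos_transform_scaled[OF b]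
  have intc: "integrable lborel (\<lambda>u. ?f c u * cos u)" if "0 < c" for c
    by (rule Bochner_Integration.integrable_bound[OF cos_transform_scaled(2)[OF that]])
       (use that in \<open>auto simp: abs_mult nonneg mult_left_le divide_right_mono\<close>)
  have iA: "integrable lborel (\<lambda>u. \<phi> (u / a))" and iB: "integrable lborel (\<lambda>u. \<phi> (u / b))"
    using lborel_integrable_real_affine[OF integrable, of "1 / a" 0] lborel_integrable_real_affine[OF integrable, of "1 / b" 0] a b
    by simp_all
  have vA: "(\<integral>u. \<phi> (u / a) \<partial>lborel) = a" and vB: "(\<integral>u. \<phi> (u / b) \<partial>lborel) = b"
    using A(3) B(3) a b by auto
  have "\<bar>(\<integral>u. \<phi> u * cos (a * u) \<partial>lborel) - (\<integral>u. \<phi> u * cos (b * u) \<partial>lborel)\<bar>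
    = \<bar>\<integral>u. (?f a u - ?f b u) * cos u \<partial>lborel\<bar>"
    using intc[OF a(1)] intc[OF b] by (simp add: A(1) B(1) left_diff_distrib)
  also have "\<dots> \<le> (\<integral>u. (1/a - 1/b) * \<phi> (u / a) + (\<phi> (u / b) - \<phi> (u / a)) / b \<partial>lborel)"
  proof (intro order_trans[OF integral_abs_bound] integral_mono)
    fix u
    have "\<phi> (u / a) \<le> \<phi> (u / b)"
      using a b by (intro decreasing) (simp add: abs_divide frac_le)
    moreover have "?f a u - ?f b u = (1/a - 1/b) * \<phi> (u / a) - (\<phi> (u / b) - \<phi> (u / a)) / b"
      using a b by (simp add: field_simps)
    moreover have "0 \<le> (1/a - 1/b) * \<phi> (u / a)" using a b nonneg by (simp add: frac_le)
    moreover have "0 \<le> (\<phi> (u / b) - \<phi> (u / a)) / b" using b calculation(1) by simp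
    ultimately have "\<bar>?f a u - ?f b u\<bar> \<le> (1/a - 1/b) * \<phi> (u / a) + (\<phi> (u / b) - \<phi> (u / a)) / b"
      by linarith
    moreover have "\<bar>(?f a u - ?f b u) * cos u\<bar> \<le> \<bar>?f a u - ?f b u\<bar>"
      by (simp add: abs_mult mult_left_le)
    ultimately show "\<bar>(?f a u - ?f b u) * cos u\<bar> \<le> (1/a - 1/b) * \<phi> (u / a) + (\<phi> (u / b) - \<phi> (u / a)) / b"
      by (rule order_trans[rotated])
  next
    show "integrable lborel (\<lambda>u. \<bar>(?f a u - ?f b u) * cos u\<bar>)"
      using intc[OF a(1)] intc[OF b] by (intro integrable_abs) (simp add: left_diff_distrib)
    show "integrable lborel (\<lambda>u. (1/a - 1/b) * \<phi> (u / a) + (\<phi> (u / b) - \<phi> (u / a)) / b)"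
      using iA iB by simp
  qed
  also have "\<dots> = (1/a - 1/b) * a + (b - a) / b"
    using iA iB vA vB by simp
  also have "\<dots> = 2 * (1 - a / b)" using a b by (simp add: field_simps)
  finally show ?thesis .
qed

text \<open>Half of the maximum is an upper bound at distance \<open>1 / \<phi> 0\<close>, since otherwise the integral over
  \<open>{- 1 / \<phi> 0..1 / \<phi> 0}\<close> would exceed 1. Log-concavity then propagates this halving.
  The rate \<open>2/3\<close> is a lower bound of \<open>ln 2\<close>.\<close>
lemma exponential_bound: "\<phi> u \<le> 2 * \<phi> 0 * exp (- (2/3 * \<phi> 0 * \<bar>u\<bar>))"
proof -
  let ?c = "\<phi> 0"
  note c = pos_at_0
  have half: "\<phi> (1 / ?c) \<le> ?c / 2"
  proof -
    have "(\<integral>u. \<phi> (1 / ?c) * indicator {- (1 / ?c)..1 / ?c} u \<partial>lborel) \<le> (\<integral>u. \<phi> u \<partial>lborel)"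
    proof (intro integral_mono integrable)
      show "\<phi> (1 / ?c) * indicator {- (1 / ?c)..1 / ?c} u \<le> \<phi> u" for u
        using c nonneg by (auto simp: indicator_def intro!: decreasing)
    qed (simp add: emeasure_lborel_Icc_eq)
    then show ?thesis using c by (simp add: integral field_simps)
  qed
  have *: "\<phi> u \<le> ?c * exp (- (ln 2 * ?c * u))" if u: "1 / ?c < u" for u
  proof (cases "\<phi> u = 0")
    case True then show ?thesis using c by simp
  next
    case False
    then have p: "0 < \<phi> u" using nonneg[of u] by simp
    define a where "a = 1 / (?c * u)"
    have cu: "1 < ?c * u" using u c by (simp add: field_simps)
    have u0: "0 < u" using u c by (meson less_trans zero_less_divide_1_iff)
    have a: "0 < a" "a < 1" "a * u = 1 / ?c" "1 / a = ?c * u"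
      using cu u0 c by (auto simp: a_def field_simps)
    have "?c powr (1 - a) * \<phi> u powr a \<le> ?c / 2"
      using log_concave[OF a(1,2), of 0 u] a(3) half by simp
    then have "ln (?c powr (1 - a) * \<phi> u powr a) \<le> ln (?c / 2)"
      using c p by (subst ln_le_cancel_iff) auto
    then have "(1 - a) * ln ?c + a * ln (\<phi> u) \<le> ln ?c - ln 2"
      using c p by (simp add: ln_mult ln_div ln_powr)
    then have "a * ln (\<phi> u) \<le> a * ln ?c - ln 2" by (simp add: algebra_simps)
    then have "(1 / a) * (a * ln (\<phi> u)) \<le> (1 / a) * (a * ln ?c - ln 2)"
      using a(1) by (intro mult_left_mono) auto
    then have "ln (\<phi> u) \<le> ln ?c - (1 / a) * ln 2" using a(1) by (simp add: right_diff_distrib)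
    then have "ln (\<phi> u) \<le> ln ?c - ln 2 * ?c * u" by (simp only: a(4) mult_ac)
    then have "exp (ln (\<phi> u)) \<le> exp (ln ?c - ln 2 * ?c * u)" by simp
    then show ?thesis using p c by (simp add: exp_diff exp_minus divide_inverse)
  qed
  have **: "\<phi> u \<le> 2 * ?c * exp (- (ln 2 * ?c * u))" if u: "0 \<le> u" for u
  proof (cases "1 / ?c < u")
    case True
    then show ?thesis using *[OF True] mult_pos_pos[OF c exp_gt_zero[of "- (ln 2 * ?c * u)"]] by linarith
  next
    case False
    then have "?c * u \<le> 1" using c by (simp add: field_simps)
    then have "ln 2 * ?c * u \<le> ln 2" by (simp add: mult.assoc)
    then have "exp (- ln 2) \<le> exp (- (ln 2 * ?c * u))" by simp
    then have "1 \<le> 2 * exp (- (ln 2 * ?c * u))" by (simp add: exp_minus)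
    then have "?c * 1 \<le> ?c * (2 * exp (- (ln 2 * ?c * u)))" using c by (intro mult_left_mono) auto
    then show ?thesis using le_at_0[of u] by simp
  qed
  have "\<phi> u = \<phi> \<bar>u\<bar>" using even by (auto simp: abs_if)
  also have "\<dots> \<le> 2 * ?c * exp (- (ln 2 * ?c * \<bar>u\<bar>))" by (rule **) simp
  also have "\<dots> \<le> 2 * ?c * exp (- (2/3 * ?c * \<bar>u\<bar>))"
    using c mult_right_mono[OF ln2_ge_two_thirds, of "?c * \<bar>u\<bar>"] by (simp add: mult_ac)
  finally show ?thesis .
qed

text \<open>Together with the decay of the cosine transform, whose constant involves \<open>\<phi> 0\<close>, this makes the first
  absolute moment the only scale that enters the later estimates.\<close>
lemma first_moment:
  shows "integrable lborel (\<lambda>u. \<phi> u * \<bar>u\<bar>)" "\<phi> 0 * (\<integral>u. \<phi> u * \<bar>u\<bar> \<partial>lborel) \<le> 9"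
proof -
  let ?c = "\<phi> 0"
  define l where "l = 2/3 * ?c"
  have l: "0 < l" using pos_at_0 by (simp add: l_def)
  have "(\<integral>\<^sup>+u. ennreal (\<bar>u\<bar> * exp (- (l * \<bar>u\<bar>))) \<partial>lborel) = ennreal (2 / l\<^sup>2)"
  proof -
    let ?e = "\<lambda>u. ennreal (u * exp (- (l * u))) * indicator {0..} u"
    have half: "(\<integral>\<^sup>+u. ?e u \<partial>lborel) = ennreal (1 / l\<^sup>2)"
    proof -
      have "(\<integral>\<^sup>+u. ?e u \<partial>lborel) = ennreal (1 / l) * (\<integral>\<^sup>+u. ennreal (exponential_density l u * u ^ 1) \<partial>lborel)"
        using l by (subst nn_integral_cmult[symmetric])
          (auto intro!: nn_integral_cong simp: exponential_density_def indicator_def mult_ac ennreal_mult'[symmetric])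
      also have "\<dots> = ennreal (1 / l\<^sup>2)"
        using nn_integral_erlang_ith_moment[OF l, of 0 1] l
        by (simp add: ennreal_mult'[symmetric] power2_eq_square)
      finally show ?thesis .
    qed
    have "(\<integral>\<^sup>+u. ennreal (\<bar>u\<bar> * exp (- (l * \<bar>u\<bar>))) \<partial>lborel) = (\<integral>\<^sup>+u. ?e u + ?e (0 + (-1) * u) \<partial>lborel)"
      by (intro nn_integral_cong) (auto simp: indicator_def abs_if)
    also have "\<dots> = (\<integral>\<^sup>+u. ?e u \<partial>lborel) + (\<integral>\<^sup>+u. ?e (0 + (-1) * u) \<partial>lborel)"
      by (intro nn_integral_add) auto
    also have "(\<integral>\<^sup>+u. ?e (0 + (-1) * u) \<partial>lborel) = (\<integral>\<^sup>+u. ?e u \<partial>lborel)"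
      using nn_integral_real_affine[of ?e "-1" 0] by simp
    finally show ?thesis using l by (simp add: half flip: ennreal_plus)
  qed
  then have int: "has_bochner_integral lborel (\<lambda>u. \<bar>u\<bar> * exp (- (l * \<bar>u\<bar>))) (2 / l\<^sup>2)"
    using l by (intro has_bochner_integral_nn_integral) auto
  have bound: "\<phi> u * \<bar>u\<bar> \<le> 2 * ?c * (\<bar>u\<bar> * exp (- (l * \<bar>u\<bar>)))" for u
    using mult_right_mono[OF exponential_bound[of u], of "\<bar>u\<bar>"] by (simp add: l_def mult_ac)
  have i2: "integrable lborel (\<lambda>u. 2 * ?c * (\<bar>u\<bar> * exp (- (l * \<bar>u\<bar>))))"
    using int by (auto simp: has_bochner_integral_iff)
  show i1: "integrable lborel (\<lambda>u. \<phi> u * \<bar>u\<bar>)"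
    by (rule Bochner_Integration.integrable_bound[OF i2]) (use bound nonneg pos_at_0 in \<open>auto simp: abs_mult\<close>)
  have "(\<integral>u. \<phi> u * \<bar>u\<bar> \<partial>lborel) \<le> 2 * ?c * (2 / l\<^sup>2)"
    using integral_mono[OF i1 i2 bound] int by (simp add: has_bochner_integral_iff)
  then have "?c * (\<integral>u. \<phi> u * \<bar>u\<bar> \<partial>lborel) \<le> ?c * (2 * ?c * (2 / l\<^sup>2))"
    using pos_at_0 by (intro mult_left_mono) auto
  also have "\<dots> = 9" using pos_at_0 by (simp add: l_def power2_eq_square)
  finally show "\<phi> 0 * (\<integral>u. \<phi> u * \<bar>u\<bar> \<partial>lborel) \<le> 9" .
qed

end

section \<open>One-dimensional projections of a log-concave law\<close>

lemma abs_cos_diff_le: "\<bar>cos x - cos y\<bar> \<le> \<bar>x - y\<bar>" for x y :: real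
proof -
  have "\<bar>cos x - cos y\<bar> = 2 * (\<bar>sin ((x + y) / 2)\<bar> * \<bar>sin ((y - x) / 2)\<bar>)"
    by (simp only: cos_diff_cos abs_mult abs_numeral mult.assoc)
  also have "\<dots> \<le> 2 * (1 * \<bar>(y - x) / 2\<bar>)"
    by (intro mult_left_mono mult_mono abs_sin_x_le_abs_x abs_sin_le_one abs_ge_zero) auto
  finally show ?thesis by simp
qed

text \<open>The law of a linear functional need not come with a log-concave density that is defined at every point.
  What Prekopa-Leindler gives directly is log-concavity of the mass of intervals of a fixed length.\<close>
locale interval_log_concave =
  real_distribution \<rho> for \<rho> :: "real measure" +
  assumes symm: "distr \<rho> borel uminus = \<rho>"
    and log_concave: "\<And>a d u v. 0 < a \<Longrightarrow> a < 1 \<Longrightarrow> 0 < d \<Longrightarrow>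
      measure \<rho> {u - d..u + d} powr (1 - a) * measure \<rho> {v - d..v + d} powr a
      \<le> measure \<rho> {((1 - a) * u + a * v) - d..((1 - a) * u + a * v) + d}"
begin

lemma emeasure_UNIV [simp]: "emeasure \<rho> UNIV = 1"
  using emeasure_space_1 by simp

lemma measure_UNIV [simp]: "measure \<rho> UNIV = 1"
  using prob_space by simp

text \<open>The density of the convolution of \<open>\<rho>\<close> with the uniform law on \<open>{- d..d}\<close>. It is even and log-concave at
  every point, so the estimates for densities apply to it, and \<open>d\<close> tends to 0 afterwards.\<close>
definition smoothed :: "real \<Rightarrow> real \<Rightarrow> real" where
  "smoothed d u = measure \<rho> {u - d..u + d} / (2 * d)"

lemma measurable_interval [measurable]: "(\<lambda>u. measure \<rho> {u - d..u + d}) \<in> borel_measurable borel"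
proof -
  have "{p \<in> space (borel \<Otimes>\<^sub>M borel). fst p - d \<le> snd p \<and> snd p \<le> fst p + (d :: real)} \<in> sets (borel \<Otimes>\<^sub>M borel)"
    by measurable
  then have "{p :: real \<times> real. fst p - d \<le> snd p \<and> snd p \<le> fst p + d} \<in> sets (borel \<Otimes>\<^sub>M borel)"
    by (simp add: space_pair_measure)
  then have "(\<lambda>u. emeasure \<rho> (Pair u -` {p :: real \<times> real. fst p - d \<le> snd p \<and> snd p \<le> fst p + d})) \<in> borel_measurable borel"
    by (intro measurable_emeasure_Pair) (simp add: sets_pair_measure_cong[OF refl events_eq_borel])
  then have "(\<lambda>u. emeasure \<rho> {u - d..u + d}) \<in> borel_measurable borel"
    by (simp add: vimage_def atLeastAtMost_def atLeast_def atMost_def Collect_conj_eq)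
  then show ?thesis by (simp add: measure_def)
qed

lemma nn_integral_smoothed:
  assumes d: "0 < d" and [measurable]: "G \<in> borel_measurable borel"
  shows "(\<integral>\<^sup>+u. ennreal (smoothed d u) * G u \<partial>lborel)
    = ennreal (1 / (2 * d)) * (\<integral>\<^sup>+x. (\<integral>\<^sup>+u. indicator {x - d..x + d} u * G u \<partial>lborel) \<partial>\<rho>)"
proof -
  interpret P: pair_sigma_finite \<rho> lborel ..
  have [measurable]: "(\<lambda>p. indicator {fst p - d..fst p + d} (snd p) :: ennreal) \<in> borel_measurable (\<rho> \<Otimes>\<^sub>M lborel)"
    by (simp add: indicator_def) measurable
  have "(\<integral>\<^sup>+x. (\<integral>\<^sup>+u. indicator {x - d..x + d} u * G u \<partial>lborel) \<partial>\<rho>)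
     = (\<integral>\<^sup>+u. (\<integral>\<^sup>+x. indicator {x - d..x + d} u * G u \<partial>\<rho>) \<partial>lborel)"
    by (rule P.Fubini'[symmetric]) (simp add: split_beta')
  also have "\<dots> = (\<integral>\<^sup>+u. (\<integral>\<^sup>+x. indicator {u - d..u + d} x * G u \<partial>\<rho>) \<partial>lborel)"
    by (intro nn_integral_cong arg_cong2[where f="(*)"] refl) (auto simp: indicator_def)
  also have "\<dots> = (\<integral>\<^sup>+u. ennreal (2 * d) * (ennreal (smoothed d u) * G u) \<partial>lborel)"
    using d
    by (intro nn_integral_cong, subst nn_integral_multc)
       (auto simp: smoothed_def emeasure_eq_measure mult.assoc[symmetric] simp flip: ennreal_mult)
  also have "\<dots> = ennreal (2 * d) * (\<integral>\<^sup>+u. ennreal (smoothed d u) * G u \<partial>lborel)"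
    unfolding smoothed_def by (subst nn_integral_cmult) auto
  finally show ?thesis using d by (simp add: mult.assoc[symmetric] flip: ennreal_mult)
qed

lemma nn_integral_smoothed_1:
  assumes d: "0 < d" shows "(\<integral>\<^sup>+u. ennreal (smoothed d u) \<partial>lborel) = 1"
  using nn_integral_smoothed[OF d, of "\<lambda>_. 1"] d
  by (simp add: emeasure_space_1 flip: ennreal_mult)

lemma even_log_concave_density_smoothed:
  assumes d: "0 < d" shows "even_log_concave_density (smoothed d)"
proof
  show m [measurable]: "smoothed d \<in> borel_measurable borel" unfolding smoothed_def by measurable
  show nn: "0 \<le> smoothed d u" for u using d by (simp add: smoothed_def)
  show "smoothed d (- u) = smoothed d u" for u
  proof -
    have "measure \<rho> {u - d..u + d} = measure (distr \<rho> borel uminus) {u - d..u + d}" by (simp add: symm)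
    also have "\<dots> = measure \<rho> {- u - d..- u + d}"
      by (subst measure_distr) (auto intro!: arg_cong[where f="measure \<rho>"])
    finally show ?thesis by (simp add: smoothed_def)
  qed
  show "smoothed d u powr (1 - a) * smoothed d v powr a \<le> smoothed d ((1 - a) * u + a * v)"
    if a: "0 < a" "a < 1" for u v a
  proof -
    have "smoothed d u powr (1 - a) * smoothed d v powr a
      = measure \<rho> {u - d..u + d} powr (1 - a) * measure \<rho> {v - d..v + d} powr a / ((2 * d) powr (1 - a) * (2 * d) powr a)"
      using d by (simp add: smoothed_def powr_divide)
    also have "(2 * d) powr (1 - a) * (2 * d) powr a = 2 * d" using d by (simp flip: powr_add)
    also have "measure \<rho> {u - d..u + d} powr (1 - a) * measure \<rho> {v - d..v + d} powr a / (2 * d)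
      \<le> smoothed d ((1 - a) * u + a * v)"
      using log_concave[OF a d, of u v] d by (simp add: smoothed_def divide_right_mono)
    finally show ?thesis .
  qed
  have *: "has_bochner_integral lborel (smoothed d) 1"
    using nn_integral_smoothed_1[OF d] nn by (intro has_bochner_integral_nn_integral) auto
  show "integrable lborel (smoothed d)" "(\<integral>u. smoothed d u \<partial>lborel) = 1"
    using * by (auto simp: has_bochner_integral_iff)
qed

lemma smoothed_cos_transform:
  assumes d: "0 < d" and s: "0 < s"
  shows "\<bar>(\<integral>u. smoothed d u * cos (s * u) \<partial>lborel) - (\<integral>x. cos (s * x) \<partial>\<rho>)\<bar> \<le> s * d"
proof -
  interpret P: pair_sigma_finite \<rho> lborel ..
  interpret even_log_concave_density "smoothed d" by (rule even_log_concave_density_smoothed[OF d])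
  have [measurable]: "(\<lambda>p. indicator {fst p - d..fst p + d} (snd p) :: real) \<in> borel_measurable (\<rho> \<Otimes>\<^sub>M lborel)"
    "(\<lambda>p. indicator {fst p - d..fst p + d} (snd p) :: ennreal) \<in> borel_measurable (\<rho> \<Otimes>\<^sub>M lborel)"
    by (simp_all add: indicator_def) measurable
  have int: "integrable (\<rho> \<Otimes>\<^sub>M lborel) (\<lambda>p. indicator {fst p - d..fst p + d} (snd p) * cos (s * snd p))"
  proof (rule integrableI_bounded)
    have "(\<integral>\<^sup>+p. ennreal (norm (indicator {fst p - d..fst p + d} (snd p) * cos (s * snd p))) \<partial>(\<rho> \<Otimes>\<^sub>M lborel))
      \<le> (\<integral>\<^sup>+p. indicator {fst p - d..fst p + d} (snd p) \<partial>(\<rho> \<Otimes>\<^sub>M lborel))"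
      by (intro nn_integral_mono) (auto simp: indicator_def)
    also have "\<dots> = (\<integral>\<^sup>+x. (\<integral>\<^sup>+u. indicator {x - d..x + d} u \<partial>lborel) \<partial>\<rho>)"
      by (subst lborel.nn_integral_fst[symmetric]) auto
    also have "\<dots> < \<infinity>" using d by (simp add: emeasure_space_1 ennreal_mult_less_top)
    finally show "(\<integral>\<^sup>+p. ennreal (norm (indicator {fst p - d..fst p + d} (snd p) * cos (s * snd p))) \<partial>(\<rho> \<Otimes>\<^sub>M lborel)) < \<infinity>" .
  qed measurable
  define J where "J x = (\<integral>u. indicator {x - d..x + d} u * cos (s * u) \<partial>lborel)" for x
  have Jint: "integrable \<rho> J"
    unfolding J_def using P.integrable_fst'[OF int] by simp
  have "(\<integral>x. J x \<partial>\<rho>) = (\<integral>u. (\<integral>x. indicator {x - d..x + d} u * cos (s * u) \<partial>\<rho>) \<partial>lborel)"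
    unfolding J_def using P.Fubini_integral[of "\<lambda>x u. indicator {x - d..x + d} u * cos (s * u)"] int
    by (simp add: split_beta')
  also have "\<dots> = (\<integral>u. (\<integral>x. indicator {u - d..u + d} x * cos (s * u) \<partial>\<rho>) \<partial>lborel)"
    by (intro Bochner_Integration.integral_cong arg_cong2[where f="(*)"] refl) (auto simp: indicator_def)
  also have "\<dots> = (\<integral>u. 2 * d * (smoothed d u * cos (s * u)) \<partial>lborel)"
    using d by (intro Bochner_Integration.integral_cong refl) (simp add: smoothed_def)
  finally have eq: "(\<integral>x. J x \<partial>\<rho>) = 2 * d * (\<integral>u. smoothed d u * cos (s * u) \<partial>lborel)" by simp
  have J: "\<bar>J x - 2 * d * cos (s * x)\<bar> \<le> 2 * d * (s * d)" for x
  proof -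
    have i1: "integrable lborel (\<lambda>u. indicator {x - d..x + d} u * c :: real)" for c
      by (intro integrable_mult_left integrable_real_indicator) (auto simp: emeasure_lborel_Icc_eq)
    have i2: "integrable lborel (\<lambda>u. indicator {x - d..x + d} u * cos (s * u))"
      by (rule Bochner_Integration.integrable_bound[OF i1[of 1]]) (auto simp: indicator_def)
    have i3: "(\<integral>u. indicator {x - d..x + d} u * c \<partial>lborel) = 2 * d * c" for c using d by simp
    have "2 * d * cos (s * x) = (\<integral>u. indicator {x - d..x + d} u * cos (s * x) \<partial>lborel)" by (rule i3[symmetric])
    then have eq: "J x - 2 * d * cos (s * x) = (\<integral>u. indicator {x - d..x + d} u * cos (s * u) - indicator {x - d..x + d} u * cos (s * x) \<partial>lborel)"
      using Bochner_Integration.integral_diff[OF i2 i1[of "cos (s * x)"]] by (simp add: J_def)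
    have "\<bar>J x - 2 * d * cos (s * x)\<bar> \<le> (\<integral>u. indicator {x - d..x + d} u * (s * d) \<partial>lborel)"
      unfolding eq
    proof (rule order_trans[OF integral_abs_bound], rule integral_mono)
      show "integrable lborel (\<lambda>u. \<bar>indicator {x - d..x + d} u * cos (s * u) - indicator {x - d..x + d} u * cos (s * x)\<bar>)"
        using Bochner_Integration.integrable_diff[OF i2 i1[of "cos (s * x)"]] by (rule integrable_abs)
      show "integrable lborel (\<lambda>u. indicator {x - d..x + d} u * (s * d))" by (rule i1)
      show "\<bar>indicator {x - d..x + d} u * cos (s * u) - indicator {x - d..x + d} u * cos (s * x)\<bar>
         \<le> indicator {x - d..x + d} u * (s * d)" for u
      proof (cases "u \<in> {x - d..x + d}")
        case True
        have "\<bar>cos (s * u) - cos (s * x)\<bar> \<le> \<bar>s * u - s * x\<bar>" by (rule abs_cos_diff_le)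
        also have "\<dots> = s * \<bar>u - x\<bar>" using s by (simp add: abs_mult flip: right_diff_distrib)
        also have "\<dots> \<le> s * d" using s True by (intro mult_left_mono) (auto simp: abs_le_iff)
        finally show ?thesis using True by simp
      qed simp
    qed
    then show ?thesis by (simp only: i3)
  qed
  have ic: "integrable \<rho> (\<lambda>x. cos (s * x))"
    by (rule integrable_const_bound[of _ 1]) auto
  have "\<bar>(\<integral>x. J x \<partial>\<rho>) - 2 * d * (\<integral>x. cos (s * x) \<partial>\<rho>)\<bar> = \<bar>\<integral>x. J x - 2 * d * cos (s * x) \<partial>\<rho>\<bar>"
    using Jint ic by simp
  also have "\<dots> \<le> (\<integral>x. 2 * d * (s * d) \<partial>\<rho>)"
    using Jint ic J by (intro order_trans[OF integral_abs_bound] integral_mono) auto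
  also have "\<dots> = 2 * d * (s * d)" by simp
  finally have "2 * d * \<bar>(\<integral>u. smoothed d u * cos (s * u) \<partial>lborel) - (\<integral>x. cos (s * x) \<partial>\<rho>)\<bar> \<le> 2 * d * (s * d)"
    using d unfolding eq by (simp add: abs_mult flip: right_diff_distrib)
  then show ?thesis using d by simp
qed

lemma smoothed_first_moment:
  assumes d: "0 < d"
  shows "integrable \<rho> (\<lambda>x. \<bar>x\<bar>)"
    and "(\<integral>x. \<bar>x\<bar> \<partial>\<rho>) - d \<le> (\<integral>u. smoothed d u * \<bar>u\<bar> \<partial>lborel)"
proof -
  interpret even_log_concave_density "smoothed d" by (rule even_log_concave_density_smoothed[OF d])
  let ?I = "\<integral>u. smoothed d u * \<bar>u\<bar> \<partial>lborel"
  have "(\<integral>\<^sup>+x. ennreal \<bar>x\<bar> \<partial>\<rho>) \<le> (\<integral>\<^sup>+x. ennreal (max 0 (\<bar>x\<bar> - d)) + ennreal d \<partial>\<rho>)"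
  proof (rule nn_integral_mono)
    fix x
    have "ennreal \<bar>x\<bar> \<le> ennreal (max 0 (\<bar>x\<bar> - d) + d)" by (intro ennreal_leI) linarith
    also have "\<dots> = ennreal (max 0 (\<bar>x\<bar> - d)) + ennreal d" using d by (intro ennreal_plus) auto
    finally show "ennreal \<bar>x\<bar> \<le> ennreal (max 0 (\<bar>x\<bar> - d)) + ennreal d" .
  qed
  also have "\<dots> = (\<integral>\<^sup>+x. ennreal (max 0 (\<bar>x\<bar> - d)) \<partial>\<rho>) + ennreal d"
    by (subst nn_integral_add) (auto simp: emeasure_space_1)
  also have "(\<integral>\<^sup>+x. ennreal (max 0 (\<bar>x\<bar> - d)) \<partial>\<rho>)
      \<le> (\<integral>\<^sup>+x. ennreal (1 / (2 * d)) * (\<integral>\<^sup>+u. indicator {x - d..x + d} u * ennreal \<bar>u\<bar> \<partial>lborel) \<partial>\<rho>)"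
  proof (rule nn_integral_mono)
    fix x
    have "ennreal (max 0 (\<bar>x\<bar> - d)) = ennreal (1 / (2 * d)) * (\<integral>\<^sup>+u. indicator {x - d..x + d} u * ennreal (max 0 (\<bar>x\<bar> - d)) \<partial>lborel)"
      using d by (subst nn_integral_multc) (auto simp: mult.assoc[symmetric] simp flip: ennreal_mult)
    also have "\<dots> \<le> ennreal (1 / (2 * d)) * (\<integral>\<^sup>+u. indicator {x - d..x + d} u * ennreal \<bar>u\<bar> \<partial>lborel)"
    proof (rule mult_left_mono, rule nn_integral_mono)
      show "indicator {x - d..x + d} u * ennreal (max 0 (\<bar>x\<bar> - d)) \<le> indicator {x - d..x + d} u * ennreal \<bar>u\<bar>" for u
        by (cases "u \<in> {x - d..x + d}") (auto intro!: ennreal_leI simp del: ennreal_le_iff)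
    qed simp
    finally show "ennreal (max 0 (\<bar>x\<bar> - d)) \<le> ennreal (1 / (2 * d)) * (\<integral>\<^sup>+u. indicator {x - d..x + d} u * ennreal \<bar>u\<bar> \<partial>lborel)" .
  qed
  also have "\<dots> = (\<integral>\<^sup>+u. ennreal (smoothed d u) * ennreal \<bar>u\<bar> \<partial>lborel)"
  proof (subst nn_integral_smoothed[OF d], simp, rule nn_integral_cmult)
    have [measurable]: "(\<lambda>p. indicator {fst p - d..fst p + d} (snd p) :: ennreal) \<in> borel_measurable (\<rho> \<Otimes>\<^sub>M lborel)"
      by (simp add: indicator_def) measurable
    show "(\<lambda>x. \<integral>\<^sup>+u. indicator {x - d..x + d} u * ennreal \<bar>u\<bar> \<partial>lborel) \<in> borel_measurable \<rho>"
      by (rule lborel.borel_measurable_nn_integral) (simp add: split_beta')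
  qed
  also have "\<dots> = (\<integral>\<^sup>+u. ennreal (smoothed d u * \<bar>u\<bar>) \<partial>lborel)"
    using nonneg by (simp add: ennreal_mult)
  also have "\<dots> = ennreal ?I"
    using nonneg by (intro nn_integral_eq_integral first_moment) auto
  finally have *: "(\<integral>\<^sup>+x. ennreal \<bar>x\<bar> \<partial>\<rho>) \<le> ennreal (?I + d)"
    using d nonneg by (simp add: ennreal_plus add_right_mono)
  show i: "integrable \<rho> (\<lambda>x. \<bar>x\<bar>)"
    using * by (intro integrableI_bounded) (auto intro: le_less_trans)
  have "0 \<le> ?I" using nonneg by simp
  then show "(\<integral>x. \<bar>x\<bar> \<partial>\<rho>) - d \<le> ?I"
    using * d by (simp only: nn_integral_eq_integral[OF i AE_I2[OF abs_ge_zero]]) (subst (asm) ennreal_le_iff, auto)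
qed

lemma integrable_abs_id: "integrable \<rho> (\<lambda>x. \<bar>x\<bar>)"
  by (rule smoothed_first_moment[of 1]) simp

theorem cos_transform_decay:
  assumes s: "0 < s"
  shows "s * (\<integral>x. \<bar>x\<bar> \<partial>\<rho>) * \<bar>\<integral>x. cos (s * x) \<partial>\<rho>\<bar> \<le> 9 * pi"
proof (cases "(\<integral>x. \<bar>x\<bar> \<partial>\<rho>) = 0")
  case False
  let ?l = "\<integral>x. \<bar>x\<bar> \<partial>\<rho>" and ?m = "\<integral>x. cos (s * x) \<partial>\<rho>"
  have l: "0 < ?l" using False by (simp add: order_less_le)
  have "s * (?l - d) * (\<bar>?m\<bar> - s * d) \<le> 9 * pi" if d: "0 < d" "d < ?l" for d
  proof -
    interpret even_log_concave_density "smoothed d" by (rule even_log_concave_density_smoothed[OF d(1)])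
    let ?c = "smoothed d 0" and ?M = "\<integral>u. smoothed d u * cos (s * u) \<partial>lborel"
      and ?I = "\<integral>u. smoothed d u * \<bar>u\<bar> \<partial>lborel"
    have "s * (?l - d) * (\<bar>?m\<bar> - s * d) \<le> s * (?l - d) * \<bar>?M\<bar>"
      using smoothed_cos_transform[OF d(1) s] s d by (intro mult_left_mono) auto
    also have "\<dots> \<le> s * ?I * (pi * ?c / s)"
      using smoothed_first_moment(2)[OF d(1)] cos_transform_decay[OF s] s d
      by (intro mult_mono mult_left_mono) auto
    also have "\<dots> = pi * (?c * ?I)" using s by simp
    also have "\<dots> \<le> pi * 9" by (intro mult_left_mono first_moment) auto
    finally show ?thesis by simp
  qed
  then have "eventually (\<lambda>d. s * (?l - d) * (\<bar>?m\<bar> - s * d) \<le> 9 * pi) (at_right 0)"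
    unfolding eventually_at_right_field using l by blast
  moreover have "((\<lambda>d. s * (?l - d) * (\<bar>?m\<bar> - s * d)) \<longlongrightarrow> s * (?l - 0) * (\<bar>?m\<bar> - s * 0)) (at_right 0)"
    by (intro tendsto_intros)
  ultimately show ?thesis by (intro tendsto_upperbound[where F="at_right 0"]) auto
qed simp

theorem cos_transform_lipschitz:
  assumes a: "0 < a" "a \<le> b"
  shows "\<bar>(\<integral>x. cos (a * x) \<partial>\<rho>) - (\<integral>x. cos (b * x) \<partial>\<rho>)\<bar> \<le> 2 * (1 - a / b)"
proof (rule field_le_epsilon)
  fix e :: real assume e: "0 < e"
  have b: "0 < b" using a by simp
  define d where "d = e / (a + b)"
  have d: "0 < d" "a * d + b * d = e"
  proof -
    show "0 < d" using e a b by (simp add: d_def)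
    have "a * d + b * d = (a + b) * d" by (simp add: distrib_right)
    also have "\<dots> = e" using a b by (simp add: d_def)
    finally show "a * d + b * d = e" .
  qed
  interpret even_log_concave_density "smoothed d" by (rule even_log_concave_density_smoothed[OF d(1)])
  show "\<bar>(\<integral>x. cos (a * x) \<partial>\<rho>) - (\<integral>x. cos (b * x) \<partial>\<rho>)\<bar> \<le> 2 * (1 - a / b) + e"
    using smoothed_cos_transform[OF d(1) a(1)] smoothed_cos_transform[OF d(1) b] cos_transform_lipschitz[OF a] d(2)
    by linarith
qed

end

definition dot :: "nat \<Rightarrow> (nat \<Rightarrow> real) \<Rightarrow> (nat \<Rightarrow> real) \<Rightarrow> real" where
  "dot n \<xi> x = (\<Sum>i<n. \<xi> i * x i)"

lemma measurable_dot [measurable]: "dot n \<xi> \<in> borel_measurable (Leb {..<n})"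
  unfolding dot_def by measurable

lemma dot_affine_map: "dot n \<xi> (affine_map n c a x) = c * dot n \<xi> x + dot n \<xi> a"
  by (simp add: dot_def affine_map_def sum_distrib_left sum.distrib algebra_simps)

text \<open>Everything that the maximal theorem uses about the kernel in frequency space: along each ray the
  Fourier transform satisfies the estimates of an even log-concave law with first absolute moment \<open>l\<close>.
  The constants do not involve the dimension.\<close>
locale symmetric_averages = prob_space \<mu> for \<mu> :: "(nat \<Rightarrow> real) measure" +
  fixes n :: nat
  assumes sets_eq [measurable_cong]: "sets \<mu> = sets (Leb {..<n})"
    and reflect: "distr \<mu> (Leb {..<n}) (affine_map n (-1) (\<lambda>_. 0)) = \<mu>"
    and transform: "\<exists>l\<ge>0. (\<forall>s>0. s * l * \<bar>\<integral>x. cos (s * dot n \<xi> x) \<partial>\<mu>\<bar> \<le> 9 * pi) \<and>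
      (\<forall>s>0. \<bar>1 - (\<integral>x. cos (s * dot n \<xi> x) \<partial>\<mu>)\<bar> \<le> s * l) \<and>
      (\<forall>a b. 0 < a \<longrightarrow> a \<le> b \<longrightarrow>
        \<bar>(\<integral>x. cos (a * dot n \<xi> x) \<partial>\<mu>) - (\<integral>x. cos (b * dot n \<xi> x) \<partial>\<mu>)\<bar> \<le> min (2 * (1 - a / b)) ((b - a) * l))"

text \<open>The kernel \<open>K\<close> is log-concave at every point but only Lebesgue measurable; \<open>K0\<close> is a Borel version of it,
  which differs from \<open>K\<close> on the null set \<open>Z\<close> only.\<close>
locale log_concave_kernel =
  fixes n :: nat and K K0 :: "(nat \<Rightarrow> real) \<Rightarrow> real" and Z :: "(nat \<Rightarrow> real) set"
  assumes log_concave: "log_concave n K" and symmetric: "symmetric_fun n K"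
    and Z: "Z \<in> null_sets (Leb {..<n})"
    and K0_borel [measurable]: "K0 \<in> borel_measurable (Leb {..<n})"
    and K0: "\<And>x. x \<in> space (Leb {..<n}) \<Longrightarrow> x \<notin> Z \<Longrightarrow> K0 x = K x" "\<And>x. 0 \<le> K0 x"
    and prob: "(\<integral>\<^sup>+x. K0 x \<partial>Leb {..<n}) = 1"
begin

definition law :: "(nat \<Rightarrow> real) measure" where
  "law = density (Leb {..<n}) (\<lambda>x. ennreal (K0 x))"

lemma sets_law [simp, measurable_cong]: "sets law = sets (Leb {..<n})"
  and space_law [simp]: "space law = space (Leb {..<n})"
  by (simp_all add: law_def)

lemma prob_space_law: "prob_space law"
  using prob by (intro prob_spaceI) (simp add: law_def emeasure_density)

lemma integrable_K0: "integrable (Leb {..<n}) K0"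
  using prob K0(2) by (intro integrableI_bounded) auto

lemma Rn_eq: "Rn n = space (Leb {..<n})"
  by (simp add: Rn_def space_PiM)

lemma K0_reflect: "AE x in Leb {..<n}. K0 (affine_map n (-1) (\<lambda>_. 0) x) = K0 x"
proof -
  have [measurable]: "Z \<in> sets (Leb {..<n})" using Z by auto
  have "(\<integral>\<^sup>+x. indicator Z (affine_map n (-1) (\<lambda>_. 0) x) \<partial>Leb {..<n}) = emeasure (Leb {..<n}) Z"
    using nn_integral_affine_map[of "-1" "indicator Z" n "\<lambda>_. 0"] by simp
  also have "\<dots> = 0" using Z by auto
  finally have "AE x in Leb {..<n}. affine_map n (-1) (\<lambda>_. 0) x \<notin> Z"
    by (subst (asm) nn_integral_0_iff_AE) (auto simp: indicator_def)
  moreover have "AE x in Leb {..<n}. x \<notin> Z" by (rule AE_not_in[OF Z])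
  moreover have "AE x in Leb {..<n}. x \<in> space (Leb {..<n})" by simp
  ultimately show ?thesis
  proof eventually_elim
    case (elim x)
    have "K (affine_map n (-1) (\<lambda>_. 0) x) = K x"
      using symmetric elim(3) by (simp add: symmetric_fun_def Rn_eq affine_map_def)
    then show ?case using elim K0(1) by simp
  qed
qed

lemma distr_law_reflect: "distr law (Leb {..<n}) (affine_map n (-1) (\<lambda>_. 0)) = law"
proof (rule measure_eqI)
  fix A assume "A \<in> sets (distr law (Leb {..<n}) (affine_map n (-1) (\<lambda>_. 0)))"
  then have A [measurable]: "A \<in> sets (Leb {..<n})" by simp
  let ?r = "affine_map n (-1) (\<lambda>_. 0)"
  have "emeasure (distr law (Leb {..<n}) ?r) A = (\<integral>\<^sup>+x. indicator A x \<partial>distr law (Leb {..<n}) ?r)"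
    by (rule nn_integral_indicator[symmetric]) simp
  also have "\<dots> = (\<integral>\<^sup>+x. ennreal (K0 x) * indicator A (?r x) \<partial>Leb {..<n})"
    unfolding law_def by (subst nn_integral_distr, simp, simp, subst nn_integral_density) auto
  also have "\<dots> = (\<integral>\<^sup>+x. ennreal (K0 (?r x)) * indicator A (?r x) \<partial>Leb {..<n})"
    using K0_reflect by (intro nn_integral_cong_AE) auto
  also have "\<dots> = (\<integral>\<^sup>+x. ennreal (K0 x) * indicator A x \<partial>Leb {..<n})"
    using nn_integral_affine_map[of "-1" "\<lambda>x. ennreal (K0 x) * indicator A x" n "\<lambda>_. 0"] by simp
  also have "\<dots> = emeasure law A" by (simp add: law_def emeasure_density)
  finally show "emeasure (distr law (Leb {..<n}) ?r) A = emeasure law A" .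
qed simp

definition slab :: "(nat \<Rightarrow> real) \<Rightarrow> real \<Rightarrow> real \<Rightarrow> (nat \<Rightarrow> real) set" where
  "slab \<xi> u d = {x \<in> space (Leb {..<n}). \<bar>dot n \<xi> x - u\<bar> \<le> d}"

lemma slab_sets [measurable]: "slab \<xi> u d \<in> sets (Leb {..<n})"
  unfolding slab_def by measurable

lemma measure_law:
  assumes [measurable]: "A \<in> sets (Leb {..<n})"
  shows "measure law A = (\<integral>x. K0 x * indicator A x \<partial>Leb {..<n})"
proof -
  interpret prob_space law by (rule prob_space_law)
  have "emeasure law A = (\<integral>\<^sup>+x. ennreal (K0 x * indicator A x) \<partial>Leb {..<n})"
    by (auto simp: law_def emeasure_density indicator_def intro!: nn_integral_cong)
  also have "\<dots> = ennreal (\<integral>x. K0 x * indicator A x \<partial>Leb {..<n})"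
    using K0(2) by (intro nn_integral_eq_integral integrable_real_mult_indicator integrable_K0) auto
  finally show ?thesis using K0(2) by (simp add: measure_def)
qed

text \<open>Prekopa-Leindler needs three functions whose inequality holds at every point; so truncations of
  \<open>K0\<close> are lowered to 0 on the exceptional set on the left and raised to the truncation level there on
  the right.\<close>
lemma slab_log_concave:
  assumes a: "0 < a" "a < 1" and d: "0 < d"
  shows "measure law (slab \<xi> u d) powr (1 - a) * measure law (slab \<xi> v d) powr a
    \<le> measure law (slab \<xi> ((1 - a) * u + a * v) d)"
proof (cases "measure law (slab \<xi> u d) = 0 \<or> measure law (slab \<xi> v d) = 0")
  case True then show ?thesis by auto
next
  case False
  have [measurable]: "Z \<in> sets (Leb {..<n})" using Z by auto
  define Q :: "nat \<Rightarrow> (nat \<Rightarrow> real) set" where "Q N = ({..<n} \<rightarrow>\<^sub>E {- real (Suc N)..real (Suc N)})" for N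
  have [measurable]: "Q N \<in> sets (Leb {..<n})" for N unfolding Q_def by (intro sets_PiM_I_finite) auto
  define F where "F N u x = (if x \<in> Z then 0 else min (K0 x) (real (Suc N)) * indicator (slab \<xi> u d \<inter> Q N) x)" for N u x
  define H where "H N u x = (if x \<in> Z then real (Suc N) else min (K0 x) (real (Suc N))) * indicator (slab \<xi> u d \<inter> Q N) x" for N u x
  have [measurable]: "F N u \<in> borel_measurable (Leb {..<n})" "H N u \<in> borel_measurable (Leb {..<n})" for N u
    unfolding F_def H_def by measurable
  have Q: "x \<in> Q N" if "x \<in> space (Leb {..<n})" "\<not> (\<exists>i\<in>{..<n}. real (Suc N) < \<bar>x i\<bar>)" for x N
    using that by (auto simp: Q_def space_PiM PiE_iff abs_le_iff not_less) (drule bspec, simp, linarith)+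
  have notQ: "x \<notin> Q N" if "\<exists>i\<in>{..<n}. real (Suc N) < \<bar>x i\<bar>" for x N
    using that by (force simp: Q_def PiE_iff)
  have FH: "F N u x \<le> H N u x" for N u x using K0(2) by (auto simp: F_def H_def indicator_def)
  have bF: "box_bounded {..<n} (real (Suc N)) (real (Suc N)) (F N u)" for N u
    using K0(2) notQ by (auto simp: box_bounded_def F_def indicator_def)
  have bH: "box_bounded {..<n} (real (Suc N)) (real (Suc N)) (H N u)" for N u
    using K0(2) notQ by (auto simp: box_bounded_def H_def indicator_def)
  have lim: "(\<lambda>N. \<integral>x. F N u x \<partial>Leb {..<n}) \<longlonglongrightarrow> measure law (slab \<xi> u d)" for u
  proof -
    have "AE x in Leb {..<n}. x \<notin> Z" by (rule AE_not_in[OF Z])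
    then have "AE x in Leb {..<n}. (\<lambda>N. F N u x) \<longlonglongrightarrow> K0 x * indicator (slab \<xi> u d) x"
    proof (rule AE_mp, intro AE_I2 impI)
      fix x assume x: "x \<in> space (Leb {..<n})" "x \<notin> Z"
      obtain N0 :: nat where N0: "max (K0 x) (Max (insert 0 ((\<lambda>i. \<bar>x i\<bar>) ` {..<n}))) \<le> real N0"
        using real_arch_simple by blast
      have "F N u x = K0 x * indicator (slab \<xi> u d) x" if N: "N0 \<le> N" for N
      proof -
        have "\<bar>x i\<bar> \<le> real (Suc N)" if "i < n" for i
        proof -
          have "\<bar>x i\<bar> \<le> real N0" using N0 that by auto
          then show ?thesis using N by simp
        qed
        then have "x \<in> Q N" using x by (intro Q) (auto simp: not_less)
        moreover have "min (K0 x) (real (Suc N)) = K0 x" using N0 N by auto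
        ultimately show ?thesis using x by (simp add: F_def indicator_def)
      qed
      then show "(\<lambda>N. F N u x) \<longlonglongrightarrow> K0 x * indicator (slab \<xi> u d) x"
        by (intro tendsto_eventually) (auto simp: eventually_sequentially)
    qed
    then show ?thesis unfolding measure_law[OF slab_sets]
      by (intro integral_dominated_convergence[where w=K0] integrable_K0)
         (use K0(2) in \<open>auto simp: F_def indicator_def\<close>)
  qed
  let ?w = "(1 - a) * u + a * v"
  have HN: "(\<integral>x. H N ?w x \<partial>Leb {..<n}) \<le> measure law (slab \<xi> ?w d)" for N
  proof -
    have "(\<integral>x. H N ?w x \<partial>Leb {..<n}) \<le> (\<integral>x. K0 x * indicator (slab \<xi> ?w d) x \<partial>Leb {..<n})"
    proof (rule integral_mono_AE)
      show "integrable (Leb {..<n}) (H N ?w)" by (rule integrable_box_bounded[OF _ bH]) simp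
      show "integrable (Leb {..<n}) (\<lambda>x. K0 x * indicator (slab \<xi> ?w d) x)"
        by (intro integrable_real_mult_indicator integrable_K0) auto
      show "AE x in Leb {..<n}. H N ?w x \<le> K0 x * indicator (slab \<xi> ?w d) x"
        using AE_not_in[OF Z] by eventually_elim (use K0(2) in \<open>auto simp: H_def indicator_def\<close>)
    qed
    then show ?thesis by (simp add: measure_law)
  qed
  have "(\<integral>x. F N u x \<partial>Leb {..<n}) powr (1 - a) * (\<integral>x. F N v x \<partial>Leb {..<n}) powr a \<le> (\<integral>x. H N ?w x \<partial>Leb {..<n})" for N
  proof (rule prekopa_leindler[OF _ a _ bF bF bH])
    fix x y assume x: "x \<in> space (Leb {..<n})" and y: "y \<in> space (Leb {..<n})"
    let ?z = "\<lambda>i\<in>{..<n}. (1 - a) * x i + a * y i"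
    have z: "?z \<in> space (Leb {..<n})" by (simp add: space_PiM)
    show "F N u x powr (1 - a) * F N v y powr a \<le> H N ?w ?z"
    proof (cases "x \<notin> Z \<and> y \<notin> Z \<and> x \<in> slab \<xi> u d \<inter> Q N \<and> y \<in> slab \<xi> v d \<inter> Q N")
      case True
      let ?N = "real (Suc N)"
      have "dot n \<xi> ?z - ?w = (1 - a) * (dot n \<xi> x - u) + a * (dot n \<xi> y - v)"
        by (simp add: dot_def sum_distrib_left sum.distrib sum_subtractf algebra_simps)
      also have "\<bar>\<dots>\<bar> \<le> (1 - a) * \<bar>dot n \<xi> x - u\<bar> + a * \<bar>dot n \<xi> y - v\<bar>"
        using a by (intro order_trans[OF abs_triangle_ineq]) (simp add: abs_mult)
      also have "\<dots> \<le> (1 - a) * d + a * d"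
        using True a by (intro add_mono mult_left_mono) (auto simp: slab_def)
      finally have zs: "?z \<in> slab \<xi> ?w d" using z by (simp add: slab_def algebra_simps)
      have zQ: "?z \<in> Q N"
      proof -
        have "\<bar>(1 - a) * x i + a * y i\<bar> \<le> ?N" if i: "i < n" for i
        proof -
          have "\<bar>x i\<bar> \<le> ?N" "\<bar>y i\<bar> \<le> ?N" using True i notQ[of N x] notQ[of N y] by (meson IntD2 lessThan_iff not_less)+
          then have "(1 - a) * \<bar>x i\<bar> + a * \<bar>y i\<bar> \<le> (1 - a) * ?N + a * ?N"
            using a by (intro add_mono mult_left_mono) auto
          also have "(1 - a) * ?N + a * ?N = ?N" by (simp add: algebra_simps)
          finally have "(1 - a) * \<bar>x i\<bar> + a * \<bar>y i\<bar> \<le> ?N" .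
          moreover have "\<bar>(1 - a) * x i\<bar> + \<bar>a * y i\<bar> = (1 - a) * \<bar>x i\<bar> + a * \<bar>y i\<bar>"
            using a by (simp add: abs_mult)
          ultimately show ?thesis using abs_triangle_ineq[of "(1 - a) * x i" "a * y i"] by linarith
        qed
        then show ?thesis by (intro Q[OF z]) (auto simp: not_less)
      qed
      have Kx: "K0 x = K x" "K0 y = K y" using True x y K0(1) by auto
      have Kz: "K x powr (1 - a) * K y powr a \<le> K ?z"
        using log_concave x y a by (auto simp: log_concave_def Rn_eq)
      have "min (K0 x) ?N powr (1 - a) * min (K0 y) ?N powr a \<le> K0 x powr (1 - a) * K0 y powr a"
        using a K0(2) by (intro mult_mono powr_mono2) auto
      moreover have "min (K0 x) ?N powr (1 - a) * min (K0 y) ?N powr a \<le> ?N powr (1 - a) * ?N powr a"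
        using a K0(2) by (intro mult_mono powr_mono2) auto
      moreover have "?N powr (1 - a) * ?N powr a = ?N" by (simp flip: powr_add)
      ultimately have "min (K0 x) ?N powr (1 - a) * min (K0 y) ?N powr a \<le> min (K ?z) ?N"
        using Kz by (simp add: Kx)
      also have "\<dots> \<le> H N ?w ?z" using zs zQ z K0(1)[OF z] by (auto simp: H_def)
      finally show ?thesis using True by (simp add: F_def)
    next
      case False
      then have "F N u x = 0 \<or> F N v y = 0" by (auto simp: F_def)
      moreover have "0 \<le> H N ?w ?z" using K0(2) by (auto simp: H_def)
      ultimately show ?thesis by auto
    qed
  qed auto
  then have "(\<integral>x. F N u x \<partial>Leb {..<n}) powr (1 - a) * (\<integral>x. F N v x \<partial>Leb {..<n}) powr a \<le> measure law (slab \<xi> ?w d)" for N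
    using HN order_trans by blast
  moreover have "(\<lambda>N. (\<integral>x. F N u x \<partial>Leb {..<n}) powr (1 - a) * (\<integral>x. F N v x \<partial>Leb {..<n}) powr a)
     \<longlonglongrightarrow> measure law (slab \<xi> u d) powr (1 - a) * measure law (slab \<xi> v d) powr a"
    using False by (intro tendsto_mult tendsto_powr lim tendsto_const) auto
  ultimately show ?thesis by (intro LIMSEQ_le_const2) auto
qed

lemma interval_log_concave_projection: "interval_log_concave (distr law borel (dot n \<xi>))"
proof -
  interpret prob_space law by (rule prob_space_law)
  have dotm: "dot n \<xi> \<in> measurable law borel" by measurable
  interpret R: real_distribution "distr law borel (dot n \<xi>)" by (rule real_distribution_distr[OF dotm])
  have slab: "measure (distr law borel (dot n \<xi>)) {u - d..u + d} = measure law (slab \<xi> u d)" for u d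
    by (subst measure_distr) (auto simp: slab_def abs_le_iff intro!: arg_cong[where f="measure law"])
  show ?thesis
  proof
    have "distr (distr law borel (dot n \<xi>)) borel uminus = distr law borel (\<lambda>x. dot n \<xi> (affine_map n (-1) (\<lambda>_. 0) x))"
      by (subst distr_distr) (auto simp: o_def dot_affine_map intro!: distr_cong, simp add: dot_def)
    also have "\<dots> = distr (distr law (Leb {..<n}) (affine_map n (-1) (\<lambda>_. 0))) borel (dot n \<xi>)"
      by (subst distr_distr) (auto simp: o_def)
    finally show "distr (distr law borel (dot n \<xi>)) borel uminus = distr law borel (dot n \<xi>)"
      by (simp add: distr_law_reflect)
  qed (simp_all add: slab slab_log_concave)
qed

theorem symmetric_averages_law: "symmetric_averages law n"
proof -
  interpret prob_space law by (rule prob_space_law)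
  show ?thesis
  proof
    fix \<xi>
    interpret I: interval_log_concave "distr law borel (dot n \<xi>)" by (rule interval_log_concave_projection)
    have [measurable]: "dot n \<xi> \<in> measurable law borel" by measurable
    let ?l = "\<integral>x. \<bar>dot n \<xi> x\<bar> \<partial>law" and ?m = "\<lambda>s. \<integral>x. cos (s * dot n \<xi> x) \<partial>law"
    have m: "(\<integral>x. cos (s * x) \<partial>distr law borel (dot n \<xi>)) = ?m s" for s
      by (subst integral_distr) auto
    have l: "(\<integral>x. \<bar>x\<bar> \<partial>distr law borel (dot n \<xi>)) = ?l"
      by (subst integral_distr) auto
    have il: "integrable law (\<lambda>x. \<bar>dot n \<xi> x\<bar>)"
      using I.integrable_abs_id by (subst (asm) integrable_distr_eq) auto
    have ic: "integrable law (\<lambda>x. cos (s * dot n \<xi> x))" for s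
      by (rule integrable_const_bound[of _ 1]) auto
    have lip: "\<bar>?m a - ?m b\<bar> \<le> (b - a) * ?l" if "a \<le> b" for a b
    proof -
      have "\<bar>?m a - ?m b\<bar> = \<bar>\<integral>x. cos (a * dot n \<xi> x) - cos (b * dot n \<xi> x) \<partial>law\<bar>"
        by (subst Bochner_Integration.integral_diff[OF ic ic]) simp
      also have "\<dots> \<le> (\<integral>x. (b - a) * \<bar>dot n \<xi> x\<bar> \<partial>law)"
      proof (rule order_trans[OF integral_abs_bound], rule integral_mono)
        fix x
        have "\<bar>cos (a * dot n \<xi> x) - cos (b * dot n \<xi> x)\<bar> \<le> \<bar>a * dot n \<xi> x - b * dot n \<xi> x\<bar>"
          by (rule abs_cos_diff_le)
        also have "\<dots> = \<bar>(b - a) * dot n \<xi> x\<bar>" by (simp add: left_diff_distrib)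
        also have "\<dots> = (b - a) * \<bar>dot n \<xi> x\<bar>" using that by (simp add: abs_mult)
        finally show "\<bar>cos (a * dot n \<xi> x) - cos (b * dot n \<xi> x)\<bar> \<le> (b - a) * \<bar>dot n \<xi> x\<bar>" .
      qed (use ic il in auto)
      finally show ?thesis by simp
    qed
    show "\<exists>l\<ge>0. (\<forall>s>0. s * l * \<bar>?m s\<bar> \<le> 9 * pi) \<and> (\<forall>s>0. \<bar>1 - ?m s\<bar> \<le> s * l) \<and>
      (\<forall>a b. 0 < a \<longrightarrow> a \<le> b \<longrightarrow> \<bar>?m a - ?m b\<bar> \<le> min (2 * (1 - a / b)) ((b - a) * l))"
    proof (intro exI[of _ ?l] conjI allI impI)
      show "\<bar>1 - ?m s\<bar> \<le> s * ?l" if "0 < s" for s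
        using lip[of 0 s] that prob_space by simp
      show "\<bar>?m a - ?m b\<bar> \<le> min (2 * (1 - a / b)) ((b - a) * ?l)" if "0 < a" "a \<le> b" for a b
        using I.cos_transform_lipschitz[OF that] lip[OF that(2)] by (simp add: m)
    qed (use I.cos_transform_decay in \<open>simp_all add: m l\<close>)
  qed (simp_all add: distr_law_reflect)
qed

end

section \<open>Continuity of translations\<close>

lemma line_shift:
  fixes f :: "real \<Rightarrow> real"
  shows "integrable lborel f \<Longrightarrow> integrable lborel (\<lambda>s. f (s + a))"
    and "(\<integral>s. f (s + a) \<partial>lborel) = (\<integral>s. f s \<partial>lborel)"
  using lborel_integrable_real_affine[of f 1 a] lborel_integral_real_affine[of 1 f a]
  by (simp_all add: add.commute)

lemma L1_translation_approx:
  fixes f :: "real \<Rightarrow> real"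
  assumes f: "integrable lborel f"
    and approx: "\<And>e. 0 < e \<Longrightarrow> \<exists>g. integrable lborel g \<and> (\<integral>s. \<bar>f s - g s\<bar> \<partial>lborel) < e \<and>
      (\<lambda>k. \<integral>s. \<bar>g (s + a k) - g s\<bar> \<partial>lborel) \<longlonglongrightarrow> 0"
  shows "(\<lambda>k::nat. \<integral>s. \<bar>f (s + a k) - f s\<bar> \<partial>lborel) \<longlonglongrightarrow> 0"
proof (rule LIMSEQ_I)
  fix e :: real assume e: "0 < e"
  obtain g where g: "integrable lborel g" "(\<integral>s. \<bar>f s - g s\<bar> \<partial>lborel) < e / 3"
    and lim: "(\<lambda>k. \<integral>s. \<bar>g (s + a k) - g s\<bar> \<partial>lborel) \<longlonglongrightarrow> 0"
    using approx[of "e / 3"] e by auto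
  obtain N where N: "\<And>k. N \<le> k \<Longrightarrow> norm ((\<integral>s. \<bar>g (s + a k) - g s\<bar> \<partial>lborel) - 0) < e / 3"
    using LIMSEQ_D[OF lim, of "e / 3"] e by auto
  have "norm ((\<integral>s. \<bar>f (s + a k) - f s\<bar> \<partial>lborel) - 0) < e" if k: "N \<le> k" for k
  proof -
    let ?d = "\<lambda>s. \<bar>f s - g s\<bar>"
    have d: "integrable lborel ?d" using f g by (intro integrable_abs Bochner_Integration.integrable_diff)
    have gd: "integrable lborel (\<lambda>s. \<bar>g (s + a k) - g s\<bar>)"
      using g by (intro integrable_abs Bochner_Integration.integrable_diff line_shift)
    have "(\<integral>s. \<bar>f (s + a k) - f s\<bar> \<partial>lborel) \<le> (\<integral>s. \<bar>g (s + a k) - g s\<bar> + (?d (s + a k) + ?d s) \<partial>lborel)"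
    proof (rule integral_mono)
      show "integrable lborel (\<lambda>s. \<bar>f (s + a k) - f s\<bar>)"
        using f by (intro integrable_abs Bochner_Integration.integrable_diff line_shift)
      show "integrable lborel (\<lambda>s. \<bar>g (s + a k) - g s\<bar> + (?d (s + a k) + ?d s))"
        by (intro Bochner_Integration.integrable_add gd d line_shift(1)[OF d])
    qed linarith
    also have "\<dots> = (\<integral>s. \<bar>g (s + a k) - g s\<bar> \<partial>lborel) + ((\<integral>s. ?d (s + a k) \<partial>lborel) + (\<integral>s. ?d s \<partial>lborel))"
      using gd d line_shift(1)[OF d, of "a k"] by simp
    also have "(\<integral>s. ?d (s + a k) \<partial>lborel) = (\<integral>s. ?d s \<partial>lborel)" by (rule line_shift)
    finally show ?thesis using N[OF k] g(2) by simp
  qed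
  then show "\<exists>no. \<forall>k\<ge>no. norm ((\<integral>s. \<bar>f (s + a k) - f s\<bar> \<partial>lborel) - 0) < e" by blast
qed

text \<open>The indicator of an open set is lower semicontinuous, so the part of \<open>U\<close> that is lost under a small
  translation has small measure; the part that is gained has the same measure.\<close>
lemma L1_translation_open:
  fixes U :: "real set"
  assumes U: "open U" "emeasure lborel U < \<infinity>" and a: "a \<longlonglongrightarrow> 0"
  shows "(\<lambda>k. \<integral>s. \<bar>indicator U (s + a k) - indicator U s :: real\<bar> \<partial>lborel) \<longlonglongrightarrow> 0"
proof -
  let ?u = "indicator U :: real \<Rightarrow> real"
  have u: "integrable lborel ?u" using U by (intro integrable_real_indicator) auto
  note us = line_shift(1)[OF u]
  have iu: "integrable lborel (\<lambda>s. ?u s * ?u (s + a k))" for k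
  proof (rule Bochner_Integration.integrable_bound[OF u])
    have [measurable]: "U \<in> sets borel" using U by auto
    show "(\<lambda>s. ?u s * ?u (s + a k)) \<in> borel_measurable lborel" by measurable
  qed (auto simp: indicator_def)
  have "(\<lambda>k. \<integral>s. ?u s - ?u s * ?u (s + a k) \<partial>lborel) \<longlonglongrightarrow> (\<integral>s. 0 \<partial>(lborel :: real measure))"
  proof (rule integral_dominated_convergence[where w="?u"])
    show "AE s in lborel. (\<lambda>k. ?u s - ?u s * ?u (s + a k)) \<longlonglongrightarrow> 0"
    proof (rule AE_I2)
      fix s
      show "(\<lambda>k. ?u s - ?u s * ?u (s + a k)) \<longlonglongrightarrow> 0"
      proof (cases "s \<in> U")
        case True
        have "(\<lambda>k. s + a k) \<longlonglongrightarrow> s + 0" by (intro tendsto_intros a)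
        then have "eventually (\<lambda>k. s + a k \<in> U) sequentially"
          using topological_tendstoD[OF _ U(1)] True by simp
        then show ?thesis
          by (intro tendsto_eventually) (auto elim: eventually_mono simp: True)
      qed simp
    qed
    show "(\<lambda>s. ?u s - ?u s * ?u (s + a k)) \<in> borel_measurable lborel" for k
      using Bochner_Integration.integrable_diff[OF u iu[of k]] by simp
    show "AE s in lborel. norm (?u s - ?u s * ?u (s + a k)) \<le> ?u s" for k
      by (auto simp: indicator_def)
  qed (use u in auto)
  then have "(\<lambda>k. 2 * (\<integral>s. ?u s - ?u s * ?u (s + a k) \<partial>lborel)) \<longlonglongrightarrow> 0"
    by (auto intro: tendsto_mult_right_zero)
  moreover have "(\<integral>s. \<bar>?u (s + a k) - ?u s\<bar> \<partial>lborel) = 2 * (\<integral>s. ?u s - ?u s * ?u (s + a k) \<partial>lborel)" for k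
  proof -
    have "(\<integral>s. \<bar>?u (s + a k) - ?u s\<bar> \<partial>lborel) = (\<integral>s. 2 * (?u s - ?u s * ?u (s + a k)) + (?u (s + a k) - ?u s) \<partial>lborel)"
      by (intro Bochner_Integration.integral_cong) (auto simp: indicator_def)
    also have "\<dots> = 2 * (\<integral>s. ?u s - ?u s * ?u (s + a k) \<partial>lborel) + ((\<integral>s. ?u (s + a k) \<partial>lborel) - (\<integral>s. ?u s \<partial>lborel))"
      using u us[of "a k"] iu[of k] by simp
    also have "(\<integral>s. ?u (s + a k) \<partial>lborel) = (\<integral>s. ?u s \<partial>lborel)" by (rule line_shift)
    finally show ?thesis by simp
  qed
  ultimately show ?thesis by simp
qed

lemma L1_translation_line:
  fixes f :: "real \<Rightarrow> real"
  assumes f: "integrable lborel f" and a: "a \<longlonglongrightarrow> 0"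
  shows "(\<lambda>k. \<integral>s. \<bar>f (s + a k) - f s\<bar> \<partial>lborel) \<longlonglongrightarrow> 0"
  using f
proof (induction rule: integrable_induct)
  case (base A c)
  have ind: "(\<lambda>k. \<integral>s. \<bar>indicator A (s + a k) - indicator A s :: real\<bar> \<partial>lborel) \<longlonglongrightarrow> 0"
  proof (rule L1_translation_approx)
    show iA: "integrable lborel (indicator A :: real \<Rightarrow> real)"
      using base by (intro integrable_real_indicator) auto
    fix e :: real assume e: "0 < e"
    obtain U where U: "open U" "A \<subseteq> U" "U - A \<in> lmeasurable" "emeasure lebesgue (U - A) < ennreal e"
      using sets_lebesgue_outer_open[OF sets_completionI_sets[of A lborel] e] base(1) by auto
    have m: "U - A \<in> sets lborel" using U(1) base(1) by auto
    have lt: "emeasure lborel (U - A) < ennreal e" using U(4) m by simp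
    have "emeasure lborel U \<le> emeasure lborel (U - A) + emeasure lborel A"
      using U base(1) m by (subst plus_emeasure) (auto intro!: emeasure_mono)
    also have "\<dots> < \<infinity>" using lt base(2) by (simp add: ennreal_add_less_top less_trans[OF lt])
    finally have fin: "emeasure lborel U < \<infinity>" .
    show "\<exists>g. integrable lborel g \<and> (\<integral>s. \<bar>indicator A s - g s\<bar> \<partial>lborel) < e \<and>
      (\<lambda>k. \<integral>s. \<bar>g (s + a k) - g s\<bar> \<partial>lborel) \<longlonglongrightarrow> (0::real)"
    proof (intro exI[of _ "indicator U"] conjI L1_translation_open U fin a)
      show "integrable lborel (indicator U :: real \<Rightarrow> real)" using U fin by (intro integrable_real_indicator) auto
      have "(\<integral>s. \<bar>indicator A s - indicator U s\<bar> \<partial>lborel) = (\<integral>s. indicator (U - A) s \<partial>lborel :: real)"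
        using U(2) by (intro Bochner_Integration.integral_cong) (auto simp: indicator_def)
      also have "\<dots> = measure lborel (U - A)" using m by simp
      also have "\<dots> < e" using lt e by (simp add: measure_def enn2real_less_iff less_trans[OF lt])
      finally show "(\<integral>s. \<bar>indicator A s - indicator U s\<bar> \<partial>lborel) < e" .
    qed
  qed
  have "(\<lambda>k. \<bar>c\<bar> * (\<integral>s. \<bar>indicator A (s + a k) - indicator A s :: real\<bar> \<partial>lborel)) \<longlonglongrightarrow> 0"
    by (rule tendsto_mult_right_zero[OF ind])
  moreover have "\<bar>c\<bar> * (\<integral>s. \<bar>indicator A (s + a k) - indicator A s :: real\<bar> \<partial>lborel) =
    (\<integral>s. \<bar>indicator A (s + a k) *\<^sub>R c - indicator A s *\<^sub>R c\<bar> \<partial>lborel)" for k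
  proof -
    have "\<bar>indicator A (s + a k) *\<^sub>R c - indicator A s *\<^sub>R c\<bar> = \<bar>c\<bar> * \<bar>indicator A (s + a k) - indicator A s\<bar>" for s
      unfolding scaleR_left_diff_distrib[symmetric] by (simp add: abs_mult)
    then show ?thesis by simp
  qed
  ultimately show ?case by simp
next
  case (add f g)
  have "(\<lambda>k. (\<integral>s. \<bar>f (s + a k) - f s\<bar> \<partial>lborel) + (\<integral>s. \<bar>g (s + a k) - g s\<bar> \<partial>lborel)) \<longlonglongrightarrow> 0 + 0"
    by (intro tendsto_add add)
  then have upper: "(\<lambda>k. (\<integral>s. \<bar>f (s + a k) - f s\<bar> \<partial>lborel) + (\<integral>s. \<bar>g (s + a k) - g s\<bar> \<partial>lborel)) \<longlonglongrightarrow> 0"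
    by simp
  show ?case
  proof (rule tendsto_sandwich[OF _ _ tendsto_const upper])
    show "\<forall>\<^sub>F k in sequentially. (\<integral>s. \<bar>f (s + a k) + g (s + a k) - (f s + g s)\<bar> \<partial>lborel)
       \<le> (\<integral>s. \<bar>f (s + a k) - f s\<bar> \<partial>lborel) + (\<integral>s. \<bar>g (s + a k) - g s\<bar> \<partial>lborel)"
    proof (intro always_eventually allI)
      fix k
      have i: "integrable lborel (\<lambda>s. \<bar>f (s + a k) - f s\<bar>)" "integrable lborel (\<lambda>s. \<bar>g (s + a k) - g s\<bar>)"
        using add by (auto intro!: integrable_abs Bochner_Integration.integrable_diff line_shift)
      have "(\<integral>s. \<bar>f (s + a k) + g (s + a k) - (f s + g s)\<bar> \<partial>lborel)
        \<le> (\<integral>s. \<bar>f (s + a k) - f s\<bar> + \<bar>g (s + a k) - g s\<bar> \<partial>lborel)"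
      proof (rule integral_mono)
        show "integrable lborel (\<lambda>s. \<bar>f (s + a k) + g (s + a k) - (f s + g s)\<bar>)"
          using add by (auto intro!: integrable_abs Bochner_Integration.integrable_diff Bochner_Integration.integrable_add line_shift)
      qed (use i in auto)
      then show "(\<integral>s. \<bar>f (s + a k) + g (s + a k) - (f s + g s)\<bar> \<partial>lborel)
       \<le> (\<integral>s. \<bar>f (s + a k) - f s\<bar> \<partial>lborel) + (\<integral>s. \<bar>g (s + a k) - g s\<bar> \<partial>lborel)" using i by simp
    qed
  qed auto
next
  case (lim f s)
  show ?case
  proof (rule L1_translation_approx[OF lim(4)])
    fix e :: real assume e: "0 < e"
    have "(\<lambda>i. \<integral>x. \<bar>f x - s i x\<bar> \<partial>lborel) \<longlonglongrightarrow> (\<integral>x. 0 \<partial>(lborel :: real measure))"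
    proof (rule integral_dominated_convergence[where w="\<lambda>x. 3 * \<bar>f x\<bar>"])
      show "AE x in lborel. (\<lambda>i. \<bar>f x - s i x\<bar>) \<longlonglongrightarrow> 0"
      proof (rule AE_I2)
        fix x :: real
        have "(\<lambda>i. \<bar>f x - s i x\<bar>) \<longlonglongrightarrow> \<bar>f x - f x\<bar>" by (intro tendsto_intros lim(2)) simp
        then show "(\<lambda>i. \<bar>f x - s i x\<bar>) \<longlonglongrightarrow> 0" by simp
      qed
      show "AE x in lborel. norm \<bar>f x - s i x\<bar> \<le> 3 * \<bar>f x\<bar>" for i
      proof (rule AE_I2)
        fix x show "norm \<bar>f x - s i x\<bar> \<le> 3 * \<bar>f x\<bar>" using lim(3)[of x i] by simp
      qed
    qed (use lim in auto)
    then obtain i where "norm ((\<integral>x. \<bar>f x - s i x\<bar> \<partial>lborel) - 0) < e"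
      using LIMSEQ_D[of "\<lambda>i. \<integral>x. \<bar>f x - s i x\<bar> \<partial>lborel" 0 e] e by auto
    then show "\<exists>g. integrable lborel g \<and> (\<integral>s. \<bar>f s - g s\<bar> \<partial>lborel) < e \<and>
      (\<lambda>k. \<integral>s. \<bar>g (s + a k) - g s\<bar> \<partial>lborel) \<longlonglongrightarrow> 0"
      using lim(1,5) by (intro exI[of _ "s i"]) auto
  qed
qed

text \<open>Almost every slice in direction \<open>i\<close> is integrable, so the result on the line applies to it, and dominated
  convergence integrates over the slices.\<close>
lemma L1_translation_coordinate:
  assumes i: "i < n" and f: "integrable (Leb {..<n}) f" and a: "a \<longlonglongrightarrow> 0"
  shows "(\<lambda>k. \<integral>\<^sup>+x. ennreal \<bar>f (x(i := x i + a k)) - f x\<bar> \<partial>Leb {..<n}) \<longlonglongrightarrow> 0"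
proof -
  define J where "J = {..<n} - {i}"
  have J: "{..<n} = insert i J" "i \<notin> J" "finite J" using i by (auto simp: J_def)
  have fm [measurable]: "f \<in> borel_measurable (Leb (insert i J))" using f J by simp
  have upd [measurable]: "(\<lambda>x. x(i := x i + c)) \<in> measurable (Leb (insert i J)) (Leb (insert i J))" for c
    using measurable_fun_upd[of "insert i J" "insert i J" i "\<lambda>x. x" "Leb (insert i J)" "\<lambda>_. lborel" "\<lambda>x. x i + c"]
    by simp
  let ?u = "\<lambda>k x. \<integral>\<^sup>+s. ennreal \<bar>f (x(i := s + a k)) - f (x(i := s))\<bar> \<partial>lborel"
  let ?w = "\<lambda>x. \<integral>\<^sup>+s. ennreal \<bar>f (x(i := s))\<bar> \<partial>lborel"
  have pm: "(\<lambda>p. (fst p)(i := snd p + c)) \<in> measurable (Leb J \<Otimes>\<^sub>M lborel) (Leb (insert i J))" for c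
    by (rule measurable_fun_upd[where J=J]) auto
  have pm0: "(\<lambda>p. (fst p)(i := snd p)) \<in> measurable (Leb J \<Otimes>\<^sub>M lborel) (Leb (insert i J))"
    by (rule measurable_fun_upd[where J=J]) auto
  note [measurable] = measurable_compose[OF pm fm] measurable_compose[OF pm0 fm]
  have um: "?u k \<in> borel_measurable (Leb J)" for k
    by (rule lborel.borel_measurable_nn_integral) (simp add: split_beta')
  have wm: "?w \<in> borel_measurable (Leb J)"
    by (rule lborel.borel_measurable_nn_integral) (simp add: split_beta')
  have wfin: "(\<integral>\<^sup>+x. ?w x \<partial>Leb J) < \<infinity>"
  proof -
    have "(\<integral>\<^sup>+x. ?w x \<partial>Leb J) = (\<integral>\<^sup>+x. ennreal \<bar>f x\<bar> \<partial>Leb (insert i J))"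
      using J by (intro Leb.product_nn_integral_insert[symmetric]) auto
    also have "\<dots> < \<infinity>" using f J by (simp add: integrable_iff_bounded)
    finally show ?thesis .
  qed
  have fs: "(\<lambda>s. f (x(i := s))) \<in> borel_measurable borel" if x: "x \<in> space (Leb J)" for x
    using measurable_compose[OF measurable_component_update, of x J "\<lambda>_. lborel" i f borel] x J by simp
  have "(\<lambda>k. \<integral>\<^sup>+x. ?u k x \<partial>Leb J) \<longlonglongrightarrow> (\<integral>\<^sup>+x. 0 \<partial>Leb J)"
  proof (rule nn_integral_dominated_convergence[where w="\<lambda>x. 2 * ?w x"])
    show "AE x in Leb J. ?u k x \<le> 2 * ?w x" for k
    proof (rule AE_I2)
      fix x assume x: "x \<in> space (Leb J)"
      note [measurable] = fs[OF x]
      have "?u k x \<le> (\<integral>\<^sup>+s. ennreal \<bar>f (x(i := s + a k))\<bar> + ennreal \<bar>f (x(i := s))\<bar> \<partial>lborel)"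
        by (intro nn_integral_mono) (auto simp flip: ennreal_plus intro!: ennreal_leI)
      also have "\<dots> = (\<integral>\<^sup>+s. ennreal \<bar>f (x(i := s + a k))\<bar> \<partial>lborel) + ?w x"
        by (rule nn_integral_add) auto
      also have "(\<integral>\<^sup>+s. ennreal \<bar>f (x(i := s + a k))\<bar> \<partial>lborel) = ?w x"
        using nn_integral_real_affine[of "\<lambda>s. ennreal \<bar>f (x(i := s))\<bar>" 1 "a k"] by (simp add: add.commute)
      finally show "?u k x \<le> 2 * ?w x" by (simp only: mult_2)
    qed
    have "AE x in Leb J. ?w x \<noteq> \<infinity>"
      using wfin wm by (intro nn_integral_PInf_AE) auto
    then show "AE x in Leb J. (\<lambda>k. ?u k x) \<longlonglongrightarrow> 0"
    proof (rule AE_mp, intro AE_I2 impI)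
      fix x assume x: "x \<in> space (Leb J)" and fin: "?w x \<noteq> \<infinity>"
      note [measurable] = fs[OF x]
      have int: "integrable lborel (\<lambda>s. f (x(i := s)))"
        using fin by (intro integrableI_bounded) (auto simp: less_top)
      have "(\<lambda>k. ennreal (\<integral>s. \<bar>f (x(i := s + a k)) - f (x(i := s))\<bar> \<partial>lborel)) \<longlonglongrightarrow> ennreal 0"
        by (intro tendsto_ennrealI L1_translation_line[OF int a])
      moreover have "ennreal (\<integral>s. \<bar>f (x(i := s + a k)) - f (x(i := s))\<bar> \<partial>lborel) = ?u k x" for k
        using int by (intro nn_integral_eq_integral[symmetric])
          (auto intro!: integrable_abs Bochner_Integration.integrable_diff line_shift(1)[OF int])
      ultimately show "(\<lambda>k. ?u k x) \<longlonglongrightarrow> 0" by simp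
    qed
    show "(\<integral>\<^sup>+x. 2 * ?w x \<partial>Leb J) < \<infinity>"
      using wfin by (subst nn_integral_cmult[OF wm]) (simp add: ennreal_mult_less_top)
  qed (use um wm in auto)
  moreover have "(\<integral>\<^sup>+x. ?u k x \<partial>Leb J) = (\<integral>\<^sup>+x. ennreal \<bar>f (x(i := x i + a k)) - f x\<bar> \<partial>Leb (insert i J))" for k
    using J by (subst Leb.product_nn_integral_insert) auto
  ultimately show ?thesis using J by simp
qed

text \<open>The translation is performed one coordinate after the other.\<close>
lemma L1_translation:
  assumes f: "integrable (Leb {..<n}) f" and a: "a \<longlonglongrightarrow> 0"
  shows "(\<lambda>k. \<integral>\<^sup>+x. ennreal \<bar>f (affine_map n 1 (\<lambda>i. v i * a k) x) - f x\<bar> \<partial>Leb {..<n}) \<longlonglongrightarrow> 0"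
proof -
  have [measurable]: "f \<in> borel_measurable (Leb {..<n})" using f by auto
  let ?P = "\<lambda>j k. affine_map n 1 (\<lambda>i. if i < j then v i * a k else 0)"
  have "(\<lambda>k. \<integral>\<^sup>+x. ennreal \<bar>f (?P j k x) - f x\<bar> \<partial>Leb {..<n}) \<longlonglongrightarrow> 0" if "j \<le> n" for j
    using that
  proof (induction j)
    case 0
    have "?P 0 k x = x" if "x \<in> space (Leb {..<n})" for k x
      using that by (auto simp: affine_map_def space_PiM PiE_def extensional_def)
    then have "(\<integral>\<^sup>+x. ennreal \<bar>f (?P 0 k x) - f x\<bar> \<partial>Leb {..<n}) = 0" for k
      by (subst nn_integral_cong[where v="\<lambda>_. 0"]) auto
    then show ?case by simp
  next
    case (Suc j)
    then have j: "j < n" by simp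
    let ?D = "\<lambda>k x. ennreal \<bar>f (x(j := x j + v j * a k)) - f x\<bar>"
    have upd: "(\<lambda>x. x(j := x j + c)) \<in> measurable (Leb {..<n}) (Leb {..<n})" for c
      using j measurable_fun_upd[of "{..<n}" "{..<n}" j "\<lambda>x. x" "Leb {..<n}" "\<lambda>_. lborel" "\<lambda>x. x j + c"]
      by auto
    note [measurable] = measurable_compose[OF upd \<open>f \<in> borel_measurable (Leb {..<n})\<close>]
    have step: "?P (Suc j) k x = (?P j k x)(j := ?P j k x j + v j * a k)" for k x
      using j by (auto simp: affine_map_def fun_eq_iff)
    have "(\<lambda>k. v j * a k) \<longlonglongrightarrow> v j * 0" by (intro tendsto_intros a)
    then have "(\<lambda>k. \<integral>\<^sup>+x. ?D k x \<partial>Leb {..<n}) \<longlonglongrightarrow> 0"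
      using L1_translation_coordinate[OF j f, of "\<lambda>k. v j * a k"] by simp
    from tendsto_add[OF this Suc.IH] j
    have upper: "(\<lambda>k. (\<integral>\<^sup>+x. ?D k x \<partial>Leb {..<n}) + (\<integral>\<^sup>+x. ennreal \<bar>f (?P j k x) - f x\<bar> \<partial>Leb {..<n})) \<longlonglongrightarrow> 0" by simp
    show ?case
    proof (rule tendsto_sandwich[OF _ _ tendsto_const upper])
      have "(\<integral>\<^sup>+x. ennreal \<bar>f (?P (Suc j) k x) - f x\<bar> \<partial>Leb {..<n})
        \<le> (\<integral>\<^sup>+x. ?D k x \<partial>Leb {..<n}) + (\<integral>\<^sup>+x. ennreal \<bar>f (?P j k x) - f x\<bar> \<partial>Leb {..<n})" for k
      proof -
        have "(\<integral>\<^sup>+x. ennreal \<bar>f (?P (Suc j) k x) - f x\<bar> \<partial>Leb {..<n})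
          \<le> (\<integral>\<^sup>+x. ?D k (?P j k x) + ennreal \<bar>f (?P j k x) - f x\<bar> \<partial>Leb {..<n})"
          unfolding step by (intro nn_integral_mono) (auto simp flip: ennreal_plus intro!: ennreal_leI)
        also have "\<dots> = (\<integral>\<^sup>+x. ?D k (?P j k x) \<partial>Leb {..<n}) + (\<integral>\<^sup>+x. ennreal \<bar>f (?P j k x) - f x\<bar> \<partial>Leb {..<n})"
        proof (rule nn_integral_add)
          have "?D k \<in> borel_measurable (Leb {..<n})" by measurable
          from measurable_compose[OF measurable_affine_map this]
          show "(\<lambda>x. ?D k (?P j k x)) \<in> borel_measurable (Leb {..<n})" .
        qed measurable
        also have "(\<integral>\<^sup>+x. ?D k (?P j k x) \<partial>Leb {..<n}) = (\<integral>\<^sup>+x. ?D k x \<partial>Leb {..<n})"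
          by (subst nn_integral_affine_map[of 1 "?D k" n "\<lambda>i. if i < j then v i * a k else 0"]) auto
        finally show ?thesis .
      qed
      then show "\<forall>\<^sub>F k in sequentially. (\<integral>\<^sup>+x. ennreal \<bar>f (?P (Suc j) k x) - f x\<bar> \<partial>Leb {..<n})
        \<le> (\<integral>\<^sup>+x. ?D k x \<partial>Leb {..<n}) + (\<integral>\<^sup>+x. ennreal \<bar>f (?P j k x) - f x\<bar> \<partial>Leb {..<n})" by simp
    qed simp
  qed
  from this[OF order_refl]
  show ?thesis
    by (simp add: affine_map_def cong: restrict_cong)
qed

section \<open>Fourier transform of bounded integrable functions\<close>

text \<open>A working class of functions: it is closed under sums, products and averages, on it the averages
  are defined at every point, and it contains truncations that approximate every square integrable
  function.\<close>
definition bounded_integrable :: "nat \<Rightarrow> ((nat \<Rightarrow> real) \<Rightarrow> real) \<Rightarrow> bool" where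
  "bounded_integrable n f \<longleftrightarrow> integrable (Leb {..<n}) f \<and> (\<exists>B. \<forall>x\<in>space (Leb {..<n}). \<bar>f x\<bar> \<le> B)"

lemma bounded_integrable_measurable:
  "bounded_integrable n f \<Longrightarrow> f \<in> borel_measurable (Leb {..<n})"
  by (auto simp: bounded_integrable_def)

lemma bounded_integrable_bound:
  assumes "bounded_integrable n f"
  shows "\<exists>B\<ge>0. \<forall>x\<in>space (Leb {..<n}). \<bar>f x\<bar> \<le> B"
proof -
  obtain B where B: "\<forall>x\<in>space (Leb {..<n}). \<bar>f x\<bar> \<le> B" using assms by (auto simp: bounded_integrable_def)
  then show ?thesis by (intro exI[of _ "max 0 B"]) (auto simp: le_max_iff_disj)
qed

lemma integrable_mult_bounded:
  fixes f g :: "_ \<Rightarrow> real"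
  assumes f: "integrable M f" and g: "g \<in> borel_measurable M" "\<And>x. x \<in> space M \<Longrightarrow> \<bar>g x\<bar> \<le> B"
  shows "integrable M (\<lambda>x. f x * g x)"
proof (rule Bochner_Integration.integrable_bound)
  show "integrable M (\<lambda>x. B * f x)" using f by simp
  show "AE x in M. norm (f x * g x) \<le> norm (B * f x)"
  proof (rule AE_I2)
    fix x assume x: "x \<in> space M"
    have "\<bar>f x\<bar> * \<bar>g x\<bar> \<le> \<bar>f x\<bar> * \<bar>B\<bar>" using g(2)[OF x] by (intro mult_left_mono) auto
    then show "norm (f x * g x) \<le> norm (B * f x)" by (simp add: abs_mult mult.commute)
  qed
qed (use f g in auto)

lemma bounded_integrable_mult:
  assumes f: "bounded_integrable n f" and g: "g \<in> borel_measurable (Leb {..<n})"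
    "\<And>x. x \<in> space (Leb {..<n}) \<Longrightarrow> \<bar>g x\<bar> \<le> B"
  shows "bounded_integrable n (\<lambda>x. f x * g x)"
proof -
  obtain A where A: "0 \<le> A" "\<And>x. x \<in> space (Leb {..<n}) \<Longrightarrow> \<bar>f x\<bar> \<le> A" using bounded_integrable_bound[OF f] by auto
  have "\<bar>f x * g x\<bar> \<le> A * B" if "x \<in> space (Leb {..<n})" for x
    unfolding abs_mult using A g(2) that by (intro mult_mono) auto
  then show ?thesis using f g integrable_mult_bounded[of "Leb {..<n}" f g B]
    by (auto simp: bounded_integrable_def)
qed

lemma bounded_integrable_product:
  assumes "bounded_integrable n f" "bounded_integrable n g"
  shows "bounded_integrable n (\<lambda>x. f x * g x)"
proof -
  obtain B where "\<And>x. x \<in> space (Leb {..<n}) \<Longrightarrow> \<bar>g x\<bar> \<le> B" using bounded_integrable_bound[OF assms(2)] by auto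
  then show ?thesis using assms by (intro bounded_integrable_mult bounded_integrable_measurable)
qed

lemma bounded_integrable_add:
  assumes "bounded_integrable n f" "bounded_integrable n g"
  shows "bounded_integrable n (\<lambda>x. f x + g x)"
proof -
  obtain A B where "\<And>x. x \<in> space (Leb {..<n}) \<Longrightarrow> \<bar>f x\<bar> \<le> A" "\<And>x. x \<in> space (Leb {..<n}) \<Longrightarrow> \<bar>g x\<bar> \<le> B"
    using bounded_integrable_bound[OF assms(1)] bounded_integrable_bound[OF assms(2)] by auto
  then have "\<bar>f x + g x\<bar> \<le> A + B" if "x \<in> space (Leb {..<n})" for x
    using that by (meson abs_triangle_ineq add_mono order_trans)
  then show ?thesis using assms by (auto simp: bounded_integrable_def)
qed

lemma bounded_integrable_cmult:
  "bounded_integrable n f \<Longrightarrow> bounded_integrable n (\<lambda>x. c * f x)"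
  using bounded_integrable_mult[of n f "\<lambda>_. c" "\<bar>c\<bar>"] by (simp add: mult.commute)

lemma bounded_integrable_diff:
  assumes "bounded_integrable n f" "bounded_integrable n g"
  shows "bounded_integrable n (\<lambda>x. f x - g x)"
  using bounded_integrable_add[OF assms(1) bounded_integrable_cmult[OF assms(2), of "-1"]] by simp

lemma bounded_integrable_sum:
  "(\<And>i. i \<in> I \<Longrightarrow> bounded_integrable n (f i)) \<Longrightarrow> bounded_integrable n (\<lambda>x. \<Sum>i\<in>I. f i x)"
  by (induction I rule: infinite_finite_induct)
     (auto intro: bounded_integrable_add simp: bounded_integrable_def[of _ "\<lambda>_. 0"])

definition autocorrelation :: "nat \<Rightarrow> ((nat \<Rightarrow> real) \<Rightarrow> real) \<Rightarrow> (nat \<Rightarrow> real) \<Rightarrow> real" where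
  "autocorrelation n f z = (\<integral>x. f x * f (affine_map n 1 z x) \<partial>Leb {..<n})"

text \<open>At the origin the autocorrelation is the squared \<open>L\<^sup>2\<close> norm; continuity there is inherited from the
  continuity of translations in \<open>L\<^sup>1\<close>.\<close>
lemma autocorrelation_continuous:
  assumes f: "bounded_integrable n f" and a: "a \<longlonglongrightarrow> 0"
  shows "(\<lambda>k. autocorrelation n f (affine_map n (a k) (\<lambda>_. 0) v)) \<longlonglongrightarrow> (\<integral>x. (f x)\<^sup>2 \<partial>Leb {..<n})"
proof -
  have int: "integrable (Leb {..<n}) f" using f by (simp add: bounded_integrable_def)
  have [measurable]: "f \<in> borel_measurable (Leb {..<n})" using int by auto
  obtain B where B: "0 \<le> B" "\<And>x. x \<in> space (Leb {..<n}) \<Longrightarrow> \<bar>f x\<bar> \<le> B" using bounded_integrable_bound[OF f] by auto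
  let ?t = "\<lambda>k. affine_map n 1 (\<lambda>i. v i * a k)"
  let ?D = "\<lambda>k. \<integral>x. \<bar>f (?t k x) - f x\<bar> \<partial>Leb {..<n}"
  have eq: "autocorrelation n f (affine_map n (a k) (\<lambda>_. 0) v) = (\<integral>x. f x * f (?t k x) \<partial>Leb {..<n})" for k
    unfolding autocorrelation_def
    by (intro Bochner_Integration.integral_cong refl arg_cong2[where f="(*)"] arg_cong[where f=f])
       (auto simp: affine_map_def mult.commute)
  have it: "integrable (Leb {..<n}) (\<lambda>x. f (?t k x))" for k
    using int integrable_affine_map_iff[of 1 f n "\<lambda>i. v i * a k"] by simp
  have iD: "integrable (Leb {..<n}) (\<lambda>x. \<bar>f (?t k x) - f x\<bar>)" for k
    using it int by (intro integrable_abs Bochner_Integration.integrable_diff)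
  have "(\<lambda>k. \<integral>\<^sup>+x. ennreal \<bar>f (?t k x) - f x\<bar> \<partial>Leb {..<n}) \<longlonglongrightarrow> 0"
    by (rule L1_translation[OF int a])
  then have "(\<lambda>k. ennreal (?D k)) \<longlonglongrightarrow> ennreal 0"
    by (subst (asm) nn_integral_eq_integral[OF iD]) auto
  then have D: "?D \<longlonglongrightarrow> 0"
    by (subst (asm) tendsto_ennreal_iff) auto
  have if2: "integrable (Leb {..<n}) (\<lambda>x. f x * f (?t k x))" for k
    by (rule integrable_mult_bounded[OF int, where B=B]) (auto intro: B)
  have if1: "integrable (Leb {..<n}) (\<lambda>x. f x * f x)"
    by (rule integrable_mult_bounded[OF int, where B=B]) (auto intro: B)
  have "\<bar>(\<integral>x. f x * f (?t k x) \<partial>Leb {..<n}) - (\<integral>x. (f x)\<^sup>2 \<partial>Leb {..<n})\<bar> \<le> B * ?D k" for k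
  proof -
    have "\<bar>(\<integral>x. f x * f (?t k x) \<partial>Leb {..<n}) - (\<integral>x. (f x)\<^sup>2 \<partial>Leb {..<n})\<bar>
      = \<bar>\<integral>x. f x * f (?t k x) - f x * f x \<partial>Leb {..<n}\<bar>"
      using if1 if2 by (simp add: power2_eq_square)
    also have "\<dots> \<le> (\<integral>x. B * \<bar>f (?t k x) - f x\<bar> \<partial>Leb {..<n})"
    proof (rule order_trans[OF integral_abs_bound], rule integral_mono)
      fix x assume x: "x \<in> space (Leb {..<n})"
      have "\<bar>f x * f (?t k x) - f x * f x\<bar> = \<bar>f x\<bar> * \<bar>f (?t k x) - f x\<bar>"
        by (simp only: abs_mult right_diff_distrib[symmetric])
      also have "\<dots> \<le> B * \<bar>f (?t k x) - f x\<bar>" using B(2)[OF x] by (intro mult_right_mono) auto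
      finally show "\<bar>f x * f (?t k x) - f x * f x\<bar> \<le> B * \<bar>f (?t k x) - f x\<bar>" .
    qed (use if1 if2 iD in auto)
    finally show ?thesis by simp
  qed
  then have bound: "\<forall>k. norm ((\<integral>x. f x * f (?t k x) \<partial>Leb {..<n}) - (\<integral>x. (f x)\<^sup>2 \<partial>Leb {..<n})) \<le> B * ?D k"
    by (simp only: real_norm_def) blast
  have "(\<lambda>k. B * ?D k) \<longlonglongrightarrow> 0" by (rule tendsto_mult_right_zero[OF D])
  then have "(\<lambda>k. (\<integral>x. f x * f (?t k x) \<partial>Leb {..<n}) - (\<integral>x. (f x)\<^sup>2 \<partial>Leb {..<n})) \<longlonglongrightarrow> 0"
    by (rule Lim_null_comparison[OF always_eventually[OF bound]])
  then show ?thesis unfolding eq by (subst Lim_null)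
qed

definition fourier :: "nat \<Rightarrow> ((nat \<Rightarrow> real) \<Rightarrow> real) \<Rightarrow> (nat \<Rightarrow> real) \<Rightarrow> complex" where
  "fourier n f \<xi> = (\<integral>x. complex_of_real (f x) * cis (dot n \<xi> x) \<partial>Leb {..<n})"

lemma measurable_cis [measurable]: "cis \<in> borel_measurable borel"
  by (intro borel_measurable_continuous_onI continuous_intros)

lemma integrable_mult_cis:
  assumes "integrable M f" "g \<in> borel_measurable M"
  shows "integrable M (\<lambda>x. complex_of_real (f x) * cis (g x))"
  using assms(2) by (intro Bochner_Integration.integrable_bound[OF assms(1)])
    (use assms in \<open>auto simp: norm_mult\<close>)

lemma measurable_dot_pair [measurable]:
  "(\<lambda>p. dot n (fst p) (snd p)) \<in> borel_measurable (Leb {..<n} \<Otimes>\<^sub>M Leb {..<n})"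
  unfolding dot_def by measurable

text \<open>In the product of the transform and its conjugate, the substitution of \<open>x + z\<close> for the second variable
  leaves only the phase of the difference \<open>z\<close>.\<close>
lemma cmod_fourier_square:
  assumes f: "integrable (Leb {..<n}) f"
  shows "complex_of_real ((cmod (fourier n f \<xi>))\<^sup>2) = (\<integral>z. complex_of_real (autocorrelation n f z) * cis (dot n \<xi> z) \<partial>Leb {..<n})"
    and "integrable (Leb {..<n}) (autocorrelation n f)"
proof -
  let ?L = "Leb {..<n}"
  interpret L: sigma_finite_measure ?L by (rule sigma_finite_Leb) simp
  interpret LL: pair_sigma_finite ?L ?L ..
  have fm [measurable]: "f \<in> borel_measurable ?L" using f by auto
  note [measurable] = measurable_compose[OF measurable_affine_map_pair fm]
  have int: "integrable (?L \<Otimes>\<^sub>M ?L) (\<lambda>p. f (snd p) * f (affine_map n 1 (fst p) (snd p)))"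
  proof (rule integrableI_bounded)
    have "(\<integral>\<^sup>+p. ennreal (norm (f (snd p) * f (affine_map n 1 (fst p) (snd p)))) \<partial>(?L \<Otimes>\<^sub>M ?L))
      = (\<integral>\<^sup>+x. (\<integral>\<^sup>+z. ennreal \<bar>f x\<bar> * ennreal \<bar>f (affine_map n 1 z x)\<bar> \<partial>?L) \<partial>?L)"
      by (subst LL.nn_integral_snd[symmetric]) (auto simp: abs_mult ennreal_mult)
    also have "\<dots> = (\<integral>\<^sup>+x. ennreal \<bar>f x\<bar> * (\<integral>\<^sup>+z. ennreal \<bar>f z\<bar> \<partial>?L) \<partial>?L)"
    proof (rule nn_integral_cong)
      fix x assume x: "x \<in> space ?L"
      have "(\<integral>\<^sup>+z. ennreal \<bar>f x\<bar> * ennreal \<bar>f (affine_map n 1 z x)\<bar> \<partial>?L)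
        = (\<integral>\<^sup>+z. ennreal \<bar>f x\<bar> * ennreal \<bar>f (affine_map n 1 x z)\<bar> \<partial>?L)"
        by (simp add: affine_map_def add.commute)
      also have "\<dots> = ennreal \<bar>f x\<bar> * (\<integral>\<^sup>+z. ennreal \<bar>f (affine_map n 1 x z)\<bar> \<partial>?L)"
        by (rule nn_integral_cmult) measurable
      also have "(\<integral>\<^sup>+z. ennreal \<bar>f (affine_map n 1 x z)\<bar> \<partial>?L) = (\<integral>\<^sup>+z. ennreal \<bar>f z\<bar> \<partial>?L)"
        by (subst (2) nn_integral_affine_map[of 1 _ n x]) auto
      finally show "(\<integral>\<^sup>+z. ennreal \<bar>f x\<bar> * ennreal \<bar>f (affine_map n 1 z x)\<bar> \<partial>?L) = ennreal \<bar>f x\<bar> * (\<integral>\<^sup>+z. ennreal \<bar>f z\<bar> \<partial>?L)" .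
    qed
    also have "\<dots> = (\<integral>\<^sup>+x. ennreal \<bar>f x\<bar> \<partial>?L) * (\<integral>\<^sup>+z. ennreal \<bar>f z\<bar> \<partial>?L)"
      by (rule nn_integral_multc) measurable
    also have "\<dots> < \<infinity>" using f by (auto simp: integrable_iff_bounded ennreal_mult_less_top)
    finally show "(\<integral>\<^sup>+p. ennreal (norm (f (snd p) * f (affine_map n 1 (fst p) (snd p)))) \<partial>(?L \<Otimes>\<^sub>M ?L)) < \<infinity>" .
  qed measurable
  show "integrable ?L (autocorrelation n f)"
    unfolding autocorrelation_def using LL.integrable_fst'[OF int] by simp
  have int': "integrable (?L \<Otimes>\<^sub>M ?L) (\<lambda>p. complex_of_real (f (snd p) * f (affine_map n 1 (fst p) (snd p))) * cis (dot n \<xi> (fst p)))"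
    by (rule integrable_mult_cis[OF int]) measurable
  have fc: "integrable ?L (\<lambda>x. complex_of_real (f x) * cis (dot n \<xi> x))"
    by (rule integrable_mult_cis[OF f]) measurable
  have "complex_of_real ((cmod (fourier n f \<xi>))\<^sup>2) = cnj (fourier n f \<xi>) * fourier n f \<xi>"
    using complex_norm_square[of "fourier n f \<xi>"] by (simp only: mult.commute)
  also have "\<dots> = (\<integral>x. cnj (complex_of_real (f x) * cis (dot n \<xi> x)) * fourier n f \<xi> \<partial>?L)"
  proof -
    have "cnj (fourier n f \<xi>) = (\<integral>x. cnj (complex_of_real (f x) * cis (dot n \<xi> x)) \<partial>?L)"
      unfolding fourier_def by (rule Bochner_Integration.integral_cnj[symmetric])
    then show ?thesis by (simp only: integral_mult_left_zero)
  qed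
  also have "\<dots> = (\<integral>x. (\<integral>z. complex_of_real (f x * f (affine_map n 1 z x)) * cis (dot n \<xi> z) \<partial>?L) \<partial>?L)"
  proof (rule Bochner_Integration.integral_cong[OF refl])
    fix x
    have "fourier n f \<xi> = (\<integral>z. complex_of_real (f (affine_map n 1 x z)) * cis (dot n \<xi> (affine_map n 1 x z)) \<partial>?L)"
      unfolding fourier_def by (subst integral_affine_map[of 1 _ n x]) auto
    also have "\<dots> = (\<integral>z. cis (dot n \<xi> x) * (complex_of_real (f (affine_map n 1 z x)) * cis (dot n \<xi> z)) \<partial>?L)"
      by (intro Bochner_Integration.integral_cong refl)
         (simp add: dot_affine_map cis_mult[symmetric] mult_ac, simp add: affine_map_def add.commute)
    finally have F: "fourier n f \<xi> = cis (dot n \<xi> x) * (\<integral>z. complex_of_real (f (affine_map n 1 z x)) * cis (dot n \<xi> z) \<partial>?L)"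
      by simp
    have "cnj (cis t) * cis t = 1" for t by (simp add: cis_cnj cis_mult)
    then have "cnj (complex_of_real (f x) * cis (dot n \<xi> x)) * fourier n f \<xi>
      = complex_of_real (f x) * (\<integral>z. complex_of_real (f (affine_map n 1 z x)) * cis (dot n \<xi> z) \<partial>?L)"
      unfolding F by (simp add: mult.assoc[symmetric] mult.commute[of _ "cis _"])
    then show "cnj (complex_of_real (f x) * cis (dot n \<xi> x)) * fourier n f \<xi>
      = (\<integral>z. complex_of_real (f x * f (affine_map n 1 z x)) * cis (dot n \<xi> z) \<partial>?L)"
      by (simp add: mult.assoc)
  qed
  also have "\<dots> = (\<integral>z. (\<integral>x. complex_of_real (f x * f (affine_map n 1 z x)) * cis (dot n \<xi> z) \<partial>?L) \<partial>?L)"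
    using LL.Fubini_integral[of "\<lambda>z x. complex_of_real (f x * f (affine_map n 1 z x)) * cis (dot n \<xi> z)"] int'
    by (simp add: split_beta')
  also have "\<dots> = (\<integral>z. complex_of_real (autocorrelation n f z) * cis (dot n \<xi> z) \<partial>?L)"
    unfolding autocorrelation_def by (simp del: of_real_mult)
  finally show "complex_of_real ((cmod (fourier n f \<xi>))\<^sup>2) = (\<integral>z. complex_of_real (autocorrelation n f z) * cis (dot n \<xi> z) \<partial>?L)" .
qed

section \<open>Square functions\<close>

definition gauss :: "nat \<Rightarrow> (nat \<Rightarrow> real) \<Rightarrow> real" where
  "gauss n v = (\<Prod>i<n. std_normal_density (v i))"

lemma gauss_nonneg: "0 \<le> gauss n v"
  unfolding gauss_def by (intro prod_nonneg) auto

lemma integrable_gauss: "integrable (Leb {..<n}) (gauss n)"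
  and integral_gauss: "(\<integral>v. gauss n v \<partial>Leb {..<n}) = 1"
proof -
  have i: "integrable lborel std_normal_density" using integrable_std_normal_moment[of 0] by simp
  have v: "(\<integral>t. std_normal_density t \<partial>lborel) = 1" using integral_std_normal_moment_even[of 0] by simp
  show "integrable (Leb {..<n}) (gauss n)"
    unfolding gauss_def by (intro Leb.product_integrable_prod i) auto
  show "(\<integral>v. gauss n v \<partial>Leb {..<n}) = 1"
    unfolding gauss_def by (subst Leb.product_integral_prod) (auto simp: i v)
qed

lemma measurable_gauss [measurable]: "gauss n \<in> borel_measurable (Leb {..<n})"
  using integrable_gauss by auto

lemma std_normal_fourier:
  "(\<integral>t. complex_of_real (std_normal_density t) * cis (a * t) \<partial>lborel) = complex_of_real (exp (- a\<^sup>2 / 2))"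
proof -
  have "complex_of_real (exp (- a\<^sup>2 / 2)) = char std_normal_distribution a"
    by (simp add: char_std_normal_distribution)
  also have "\<dots> = (\<integral>t. std_normal_density t *\<^sub>R cis (a * t) \<partial>lborel)"
    unfolding char_def cis_conv_exp[symmetric] by (subst integral_density) (auto simp: cis_conv_exp mult_ac)
  finally show ?thesis by (simp add: scaleR_conv_of_real)
qed

lemma cis_sum: "finite I \<Longrightarrow> cis (\<Sum>i\<in>I. f i) = (\<Prod>i\<in>I. cis (f i))"
  by (induction I rule: finite_induct) (simp_all flip: cis_mult)

lemma gauss_fourier:
  "(\<integral>\<xi>. complex_of_real (gauss n \<xi>) * cis (k * dot n \<xi> z) \<partial>Leb {..<n})
    = complex_of_real (\<Prod>i<n. exp (- (k * z i)\<^sup>2 / 2))"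
proof -
  have i: "integrable lborel (\<lambda>t. complex_of_real (std_normal_density t) * cis (a * t))" for a
    using integrable_std_normal_moment[of 0] by (intro integrable_mult_cis) auto
  have "(\<integral>\<xi>. complex_of_real (gauss n \<xi>) * cis (k * dot n \<xi> z) \<partial>Leb {..<n})
    = (\<integral>\<xi>. (\<Prod>j<n. complex_of_real (std_normal_density (\<xi> j)) * cis ((k * z j) * \<xi> j)) \<partial>Leb {..<n})"
    by (intro Bochner_Integration.integral_cong refl)
       (simp add: gauss_def dot_def sum_distrib_left cis_sum prod.distrib mult_ac)
  also have "\<dots> = (\<Prod>j<n. complex_of_real (exp (- (k * z j)\<^sup>2 / 2)))"
    by (subst Leb.product_integral_prod) (auto simp: i std_normal_fourier)
  finally show ?thesis by simp
qed

lemma prod_exp_eq_gauss: "(\<Prod>i<n. exp (- (z i)\<^sup>2 / 2)) = sqrt (2 * pi) ^ n * gauss n z"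
  by (simp add: gauss_def std_normal_density_def prod.distrib power_divide prod_dividef)

text \<open>A Gaussian weight in frequency makes Plancherel's formula a finite identity: the weighted energy is a
  Gaussian average of the autocorrelation. As \<open>k\<close> grows the average concentrates at the origin.\<close>
lemma fourier_energy:
  assumes f: "integrable (Leb {..<n}) f" and k: "0 < k"
  shows "(\<integral>\<xi>. gauss n \<xi> * (cmod (fourier n f (\<lambda>i. k * \<xi> i)))\<^sup>2 \<partial>Leb {..<n})
    = (sqrt (2 * pi) / k) ^ n * (\<integral>v. autocorrelation n f (affine_map n (1 / k) (\<lambda>_. 0) v) * gauss n v \<partial>Leb {..<n})"
proof -
  let ?L = "Leb {..<n}"
  let ?A = "autocorrelation n f"
  interpret L: sigma_finite_measure ?L by (rule sigma_finite_Leb) simp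
  interpret LL: pair_sigma_finite ?L ?L ..
  have dk: "dot n (\<lambda>i. k * \<xi> i) z = k * dot n \<xi> z" for \<xi> z
    by (simp add: dot_def sum_distrib_left mult_ac)
  have A: "integrable ?L ?A" by (rule cmod_fourier_square[OF f])
  then have [measurable]: "?A \<in> borel_measurable ?L" by auto
  have int0: "integrable (?L \<Otimes>\<^sub>M ?L) (\<lambda>p. gauss n (fst p) * ?A (snd p))"
  proof (rule integrableI_bounded)
    have "(\<integral>\<^sup>+p. ennreal (norm (gauss n (fst p) * ?A (snd p))) \<partial>(?L \<Otimes>\<^sub>M ?L))
      = (\<integral>\<^sup>+\<xi>. (\<integral>\<^sup>+z. ennreal (gauss n \<xi>) * ennreal \<bar>?A z\<bar> \<partial>?L) \<partial>?L)"
      by (subst L.nn_integral_fst[symmetric]) (auto simp: abs_mult ennreal_mult gauss_nonneg)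
    also have "\<dots> = (\<integral>\<^sup>+\<xi>. ennreal (gauss n \<xi>) \<partial>?L) * (\<integral>\<^sup>+z. ennreal \<bar>?A z\<bar> \<partial>?L)"
      by (simp add: nn_integral_cmult nn_integral_multc)
    also have "\<dots> < \<infinity>"
      using A integrable_gauss[of n] by (auto simp: integrable_iff_bounded ennreal_mult_less_top gauss_nonneg)
    finally show "(\<integral>\<^sup>+p. ennreal (norm (gauss n (fst p) * ?A (snd p))) \<partial>(?L \<Otimes>\<^sub>M ?L)) < \<infinity>" .
  qed measurable
  have int: "integrable (?L \<Otimes>\<^sub>M ?L) (\<lambda>p. complex_of_real (gauss n (fst p) * ?A (snd p)) * cis (k * dot n (fst p) (snd p)))"
    by (rule integrable_mult_cis[OF int0]) measurable
  have "complex_of_real (\<integral>\<xi>. gauss n \<xi> * (cmod (fourier n f (\<lambda>i. k * \<xi> i)))\<^sup>2 \<partial>?L)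
    = (\<integral>\<xi>. complex_of_real (gauss n \<xi>) * complex_of_real ((cmod (fourier n f (\<lambda>i. k * \<xi> i)))\<^sup>2) \<partial>?L)"
    by (simp only: integral_complex_of_real[symmetric] of_real_mult)
  also have "\<dots> = (\<integral>\<xi>. (\<integral>z. complex_of_real (gauss n \<xi> * ?A z) * cis (k * dot n \<xi> z) \<partial>?L) \<partial>?L)"
    unfolding cmod_fourier_square(1)[OF f] dk
    by (simp only: integral_mult_right_zero[symmetric] of_real_mult mult.assoc)
  also have "\<dots> = (\<integral>z. (\<integral>\<xi>. complex_of_real (gauss n \<xi> * ?A z) * cis (k * dot n \<xi> z) \<partial>?L) \<partial>?L)"
    using LL.Fubini_integral[of "\<lambda>\<xi> z. complex_of_real (gauss n \<xi> * ?A z) * cis (k * dot n \<xi> z)"] int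
    by (simp add: split_beta')
  also have "\<dots> = (\<integral>z. complex_of_real (?A z * (\<Prod>i<n. exp (- (k * z i)\<^sup>2 / 2))) \<partial>?L)"
  proof (rule Bochner_Integration.integral_cong[OF refl])
    fix z
    have "(\<integral>\<xi>. complex_of_real (gauss n \<xi> * ?A z) * cis (k * dot n \<xi> z) \<partial>?L)
      = (\<integral>\<xi>. complex_of_real (?A z) * (complex_of_real (gauss n \<xi>) * cis (k * dot n \<xi> z)) \<partial>?L)"
      by (simp add: mult_ac)
    also have "\<dots> = complex_of_real (?A z) * complex_of_real (\<Prod>i<n. exp (- (k * z i)\<^sup>2 / 2))"
      by (simp only: integral_mult_right_zero gauss_fourier)
    finally show "(\<integral>\<xi>. complex_of_real (gauss n \<xi> * ?A z) * cis (k * dot n \<xi> z) \<partial>?L)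
      = complex_of_real (?A z * (\<Prod>i<n. exp (- (k * z i)\<^sup>2 / 2)))" by simp
  qed
  also have "\<dots> = complex_of_real (\<integral>z. ?A z * (\<Prod>i<n. exp (- (k * z i)\<^sup>2 / 2)) \<partial>?L)"
    by (rule integral_complex_of_real)
  finally have "(\<integral>\<xi>. gauss n \<xi> * (cmod (fourier n f (\<lambda>i. k * \<xi> i)))\<^sup>2 \<partial>?L)
    = (\<integral>z. ?A z * (\<Prod>i<n. exp (- (k * z i)\<^sup>2 / 2)) \<partial>?L)"
    by (simp only: of_real_eq_iff)
  also have "\<dots> = \<bar>1 / k\<bar> ^ n *\<^sub>R (\<integral>v. ?A (affine_map n (1 / k) (\<lambda>_. 0) v) *
      (\<Prod>i<n. exp (- (k * affine_map n (1 / k) (\<lambda>_. 0) v i)\<^sup>2 / 2)) \<partial>?L)"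
    using k by (intro integral_affine_map) auto
  also have "(\<lambda>v. \<Prod>i<n. exp (- (k * affine_map n (1 / k) (\<lambda>_. 0) v i)\<^sup>2 / 2)) = (\<lambda>v. sqrt (2 * pi) ^ n * gauss n v)"
    unfolding prod_exp_eq_gauss[symmetric] using k by (intro ext prod.cong refl) (simp add: affine_map_def)
  also have "(\<integral>v. ?A (affine_map n (1 / k) (\<lambda>_. 0) v) * (sqrt (2 * pi) ^ n * gauss n v) \<partial>?L)
      = sqrt (2 * pi) ^ n * (\<integral>v. ?A (affine_map n (1 / k) (\<lambda>_. 0) v) * gauss n v \<partial>?L)"
    by (simp only: mult.left_commute[of _ "sqrt (2 * pi) ^ n"] integral_mult_right_zero)
  finally show ?thesis using k by (simp add: power_divide)
qed

lemma smoothed_energy_tendsto: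
  assumes f: "bounded_integrable n f"
  shows "(\<lambda>k. \<integral>v. autocorrelation n f (affine_map n (1 / real (Suc k)) (\<lambda>_. 0) v) * gauss n v \<partial>Leb {..<n})
    \<longlonglongrightarrow> (\<integral>x. (f x)\<^sup>2 \<partial>Leb {..<n})"
    and "integrable (Leb {..<n}) (\<lambda>v. autocorrelation n f (affine_map n (1 / real (Suc k)) (\<lambda>_. 0) v) * gauss n v)"
proof -
  let ?L = "Leb {..<n}"
  let ?S = "\<integral>x. (f x)\<^sup>2 \<partial>?L"
  have int: "integrable ?L f" using f by (simp add: bounded_integrable_def)
  have [measurable]: "f \<in> borel_measurable ?L" using int by auto
  obtain B where B: "0 \<le> B" "\<And>x. x \<in> space ?L \<Longrightarrow> \<bar>f x\<bar> \<le> B" using bounded_integrable_bound[OF f] by auto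
  define C where "C = B * (\<integral>x. \<bar>f x\<bar> \<partial>?L)"
  have bound: "\<bar>autocorrelation n f z\<bar> \<le> C" for z
  proof -
    have "\<bar>autocorrelation n f z\<bar> \<le> (\<integral>x. B * \<bar>f x\<bar> \<partial>?L)"
      unfolding autocorrelation_def
    proof (rule order_trans[OF integral_abs_bound], rule integral_mono)
      show "integrable ?L (\<lambda>x. \<bar>f x * f (affine_map n 1 z x)\<bar>)"
        by (intro integrable_abs integrable_mult_bounded[OF int, where B=B]) (auto intro: B)
      show "integrable ?L (\<lambda>x. B * \<bar>f x\<bar>)" using int by simp
      fix x assume "x \<in> space ?L"
      have "\<bar>f (affine_map n 1 z x)\<bar> * \<bar>f x\<bar> \<le> B * \<bar>f x\<bar>" by (intro mult_right_mono B) auto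
      then show "\<bar>f x * f (affine_map n 1 z x)\<bar> \<le> B * \<bar>f x\<bar>" by (simp add: abs_mult mult.commute)
    qed
    then show ?thesis by (simp add: C_def)
  qed
  have am: "autocorrelation n f \<in> borel_measurable ?L"
    using cmod_fourier_square(2)[OF int] by auto
  note [measurable] = measurable_compose[OF measurable_affine_map am]
  have dom: "\<bar>autocorrelation n f z * gauss n v\<bar> \<le> C * gauss n v" for z v
    unfolding abs_mult using bound[of z] gauss_nonneg[of n v] by (intro mult_mono) (auto intro: order_trans[OF abs_ge_zero bound])
  have Cg: "integrable ?L (\<lambda>v. C * gauss n v)" using integrable_gauss by simp
  show "integrable ?L (\<lambda>v. autocorrelation n f (affine_map n (1 / real (Suc k)) (\<lambda>_. 0) v) * gauss n v)"
    by (rule Bochner_Integration.integrable_bound[OF Cg]) (use dom in \<open>auto intro: order_trans[OF _ abs_ge_self]\<close>)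
  have "(\<lambda>k. 1 / real (Suc k)) \<longlonglongrightarrow> 0" by real_asymp
  note c = autocorrelation_continuous[OF f this]
  have "(\<lambda>k. \<integral>v. autocorrelation n f (affine_map n (1 / real (Suc k)) (\<lambda>_. 0) v) * gauss n v \<partial>?L)
    \<longlonglongrightarrow> (\<integral>v. ?S * gauss n v \<partial>?L)"
  proof (rule integral_dominated_convergence[where w="\<lambda>v. C * gauss n v"])
    show "AE v in ?L. (\<lambda>k. autocorrelation n f (affine_map n (1 / real (Suc k)) (\<lambda>_. 0) v) * gauss n v)
        \<longlonglongrightarrow> ?S * gauss n v"
      by (intro AE_I2 tendsto_mult tendsto_const c)
    show "AE v in ?L. norm (autocorrelation n f (affine_map n (1 / real (Suc k)) (\<lambda>_. 0) v) * gauss n v)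
        \<le> C * gauss n v" for k
      unfolding real_norm_def by (intro AE_I2 dom)
  qed (use Cg in \<open>measurable\<close>)
  then show "(\<lambda>k. \<integral>v. autocorrelation n f (affine_map n (1 / real (Suc k)) (\<lambda>_. 0) v) * gauss n v \<partial>?L) \<longlonglongrightarrow> ?S"
    by (simp add: integral_gauss)
qed

text \<open>This replaces Plancherel's theorem. Both sides are compared with the same Gaussian weight, where the
  hypothesis can be integrated, and then the weight is removed.\<close>
theorem square_function_bound:
  assumes I: "finite I" and f: "bounded_integrable n f" and h: "\<And>i. i \<in> I \<Longrightarrow> bounded_integrable n (h i)"
    and le: "\<And>\<xi>. (\<Sum>i\<in>I. (cmod (fourier n (h i) \<xi>))\<^sup>2) \<le> C * (cmod (fourier n f \<xi>))\<^sup>2"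
  shows "(\<Sum>i\<in>I. \<integral>x. (h i x)\<^sup>2 \<partial>Leb {..<n}) \<le> C * (\<integral>x. (f x)\<^sup>2 \<partial>Leb {..<n})"
proof -
  let ?L = "Leb {..<n}"
  let ?J = "\<lambda>f k. \<integral>v. autocorrelation n f (affine_map n (1 / real (Suc k)) (\<lambda>_. 0) v) * gauss n v \<partial>?L"
  interpret L: sigma_finite_measure ?L by (rule sigma_finite_Leb) simp
  have meas: "(\<lambda>\<xi>. (cmod (fourier n f (\<lambda>i. k * \<xi> i)))\<^sup>2) \<in> borel_measurable ?L" if f: "bounded_integrable n f" for f k
  proof -
    have [measurable]: "f \<in> borel_measurable ?L" using f by (rule bounded_integrable_measurable)
    have "(\<lambda>\<xi>. fourier n f (\<lambda>i. k * \<xi> i)) = (\<lambda>\<xi>. \<integral>x. complex_of_real (f x) * cis (k * dot n \<xi> x) \<partial>?L)"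
      by (simp add: fourier_def dot_def sum_distrib_left mult.assoc)
    moreover have "(\<lambda>\<xi>. \<integral>x. complex_of_real (f x) * cis (k * dot n \<xi> x) \<partial>?L) \<in> borel_measurable ?L"
      by (rule L.borel_measurable_lebesgue_integral) (simp add: split_beta')
    ultimately have [measurable]: "(\<lambda>\<xi>. fourier n f (\<lambda>i. k * \<xi> i)) \<in> borel_measurable ?L" by (simp only:)
    show ?thesis by measurable
  qed
  have int: "integrable ?L (\<lambda>\<xi>. gauss n \<xi> * (cmod (fourier n f (\<lambda>i. k * \<xi> i)))\<^sup>2)" if f: "bounded_integrable n f" for f k
  proof (rule integrable_mult_bounded[OF integrable_gauss meas[OF f]])
    fix \<xi>
    have "cmod (fourier n f (\<lambda>i. k * \<xi> i)) \<le> (\<integral>x. \<bar>f x\<bar> \<partial>?L)"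
      unfolding fourier_def using integral_norm_bound[of ?L "\<lambda>x. complex_of_real (f x) * cis (dot n (\<lambda>i. k * \<xi> i) x)"]
      by (simp add: norm_mult)
    then show "\<bar>(cmod (fourier n f (\<lambda>i. k * \<xi> i)))\<^sup>2\<bar> \<le> (\<integral>x. \<bar>f x\<bar> \<partial>?L)\<^sup>2"
      by (simp add: power_mono)
  qed
  have "(\<Sum>i\<in>I. ?J (h i) k) \<le> C * ?J f k" for k
  proof -
    let ?k = "real (Suc k)" and ?c = "(sqrt (2 * pi) / real (Suc k)) ^ n"
    note E = fourier_energy[of n _ ?k]
    have "?c * (\<Sum>i\<in>I. ?J (h i) k) = (\<Sum>i\<in>I. \<integral>\<xi>. gauss n \<xi> * (cmod (fourier n (h i) (\<lambda>j. ?k * \<xi> j)))\<^sup>2 \<partial>?L)"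
      unfolding sum_distrib_left
      by (intro sum.cong refl E[symmetric]) (use h in \<open>auto simp: bounded_integrable_def\<close>)
    also have "\<dots> = (\<integral>\<xi>. (\<Sum>i\<in>I. gauss n \<xi> * (cmod (fourier n (h i) (\<lambda>j. ?k * \<xi> j)))\<^sup>2) \<partial>?L)"
      using int[OF h] by (intro Bochner_Integration.integral_sum[symmetric]) auto
    also have "\<dots> \<le> (\<integral>\<xi>. C * (gauss n \<xi> * (cmod (fourier n f (\<lambda>j. ?k * \<xi> j)))\<^sup>2) \<partial>?L)"
    proof (rule integral_mono)
      show "integrable ?L (\<lambda>\<xi>. \<Sum>i\<in>I. gauss n \<xi> * (cmod (fourier n (h i) (\<lambda>j. ?k * \<xi> j)))\<^sup>2)"
        by (intro Bochner_Integration.integrable_sum int h)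
      show "integrable ?L (\<lambda>\<xi>. C * (gauss n \<xi> * (cmod (fourier n f (\<lambda>j. ?k * \<xi> j)))\<^sup>2))"
        by (intro integrable_mult_right int f)
      show "(\<Sum>i\<in>I. gauss n \<xi> * (cmod (fourier n (h i) (\<lambda>j. ?k * \<xi> j)))\<^sup>2)
        \<le> C * (gauss n \<xi> * (cmod (fourier n f (\<lambda>j. ?k * \<xi> j)))\<^sup>2)" for \<xi>
        using mult_left_mono[OF le[of "\<lambda>j. ?k * \<xi> j"] gauss_nonneg[of n \<xi>]]
        by (simp only: sum_distrib_left mult.left_commute)
    qed
    also have "\<dots> = C * (?c * ?J f k)"
      using f by (simp only: integral_mult_right_zero E bounded_integrable_def of_nat_0_less_iff zero_less_Suc)
    finally have "?c * (\<Sum>i\<in>I. ?J (h i) k) \<le> ?c * (C * ?J f k)" by (simp only: mult.left_commute)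
    moreover have "0 < ?c" by simp
    ultimately show ?thesis by (simp only: mult_le_cancel_left_pos)
  qed
  moreover have "(\<lambda>k. \<Sum>i\<in>I. ?J (h i) k) \<longlonglongrightarrow> (\<Sum>i\<in>I. \<integral>x. (h i x)\<^sup>2 \<partial>?L)"
    by (intro tendsto_sum smoothed_energy_tendsto h)
  moreover have "(\<lambda>k. C * ?J f k) \<longlonglongrightarrow> C * (\<integral>x. (f x)\<^sup>2 \<partial>?L)"
    by (intro tendsto_mult tendsto_const smoothed_energy_tendsto f)
  ultimately show ?thesis by (intro LIMSEQ_le) blast+
qed

section \<open>Averages as multipliers\<close>

abbreviation L2sq :: "nat \<Rightarrow> ((nat \<Rightarrow> real) \<Rightarrow> real) \<Rightarrow> real" where
  "L2sq n f \<equiv> \<integral>x. (f x)\<^sup>2 \<partial>Leb {..<n}"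

context symmetric_averages
begin

definition avg :: "real \<Rightarrow> ((nat \<Rightarrow> real) \<Rightarrow> real) \<Rightarrow> (nat \<Rightarrow> real) \<Rightarrow> real" where
  "avg t f x = (\<integral>z. f (affine_map n (- t) x z) \<partial>\<mu>)"

definition symbol :: "real \<Rightarrow> (nat \<Rightarrow> real) \<Rightarrow> real" where
  "symbol t \<xi> = (\<integral>z. cos (t * dot n \<xi> z) \<partial>\<mu>)"

lemma space_mu [simp]: "space \<mu> = space (Leb {..<n})"
  using sets_eq by (rule sets_eq_imp_space_eq)

lemma measurable_translate_pair:
  "(\<lambda>p. affine_map n c (fst p) (snd p)) \<in> measurable (Leb {..<n} \<Otimes>\<^sub>M \<mu>) (Leb {..<n})"
  unfolding affine_map_def by measurable

lemma affine_swap: "affine_map n c x z = affine_map n 1 (\<lambda>i. c * z i) x"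
  by (auto simp: affine_map_def)

lemma pair_sigma_finite_Leb: "pair_sigma_finite (Leb {..<n}) \<mu>"
proof -
  interpret L: sigma_finite_measure "Leb {..<n}" by (rule sigma_finite_Leb) simp
  show ?thesis ..
qed

lemma integrable_translate_pair:
  fixes f :: "_ \<Rightarrow> real"
  assumes f: "integrable (Leb {..<n}) f"
  shows "integrable (Leb {..<n} \<Otimes>\<^sub>M \<mu>) (\<lambda>p. f (affine_map n c (fst p) (snd p)))"
proof (rule integrableI_bounded)
  interpret P: pair_sigma_finite "Leb {..<n}" \<mu> by (rule pair_sigma_finite_Leb)
  have fm [measurable]: "f \<in> borel_measurable (Leb {..<n})" using f by auto
  show m [measurable]: "(\<lambda>p. f (affine_map n c (fst p) (snd p))) \<in> borel_measurable (Leb {..<n} \<Otimes>\<^sub>M \<mu>)"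
    by (rule measurable_compose[OF measurable_translate_pair fm])
  have "(\<integral>\<^sup>+p. ennreal (norm (f (affine_map n c (fst p) (snd p)))) \<partial>(Leb {..<n} \<Otimes>\<^sub>M \<mu>))
    = (\<integral>\<^sup>+z. (\<integral>\<^sup>+x. ennreal \<bar>f (affine_map n c x z)\<bar> \<partial>Leb {..<n}) \<partial>\<mu>)"
    by (subst P.nn_integral_snd[symmetric]) auto
  also have "\<dots> = (\<integral>\<^sup>+z. (\<integral>\<^sup>+x. ennreal \<bar>f (affine_map n 1 (\<lambda>i. c * z i) x)\<bar> \<partial>Leb {..<n}) \<partial>\<mu>)"
    by (simp only: affine_swap[of c])
  also have "\<dots> = (\<integral>\<^sup>+z. (\<integral>\<^sup>+x. ennreal \<bar>f x\<bar> \<partial>Leb {..<n}) \<partial>\<mu>)"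
  proof (rule nn_integral_cong)
    show "(\<integral>\<^sup>+x. ennreal \<bar>f (affine_map n 1 (\<lambda>i. c * z i) x)\<bar> \<partial>Leb {..<n}) = (\<integral>\<^sup>+x. ennreal \<bar>f x\<bar> \<partial>Leb {..<n})" for z
      using nn_integral_affine_map[of 1 "\<lambda>x. ennreal \<bar>f x\<bar>" n "\<lambda>i. c * z i"] by simp
  qed
  also have "\<dots> < \<infinity>" using f emeasure_space_1 by (simp add: integrable_iff_bounded)
  finally show "(\<integral>\<^sup>+p. ennreal (norm (f (affine_map n c (fst p) (snd p)))) \<partial>(Leb {..<n} \<Otimes>\<^sub>M \<mu>)) < \<infinity>" .
qed

lemma integrable_translate:
  assumes f: "bounded_integrable n f"
  shows "integrable \<mu> (\<lambda>z. f (affine_map n c x z))"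
proof -
  obtain B where B: "\<And>x. x \<in> space (Leb {..<n}) \<Longrightarrow> \<bar>f x\<bar> \<le> B" using bounded_integrable_bound[OF f] by auto
  have fm: "f \<in> borel_measurable (Leb {..<n})" using f by (rule bounded_integrable_measurable)
  have "affine_map n c x \<in> measurable \<mu> (Leb {..<n})" by measurable
  then show ?thesis
    by (intro integrable_const_bound[where B=B] measurable_compose[OF _ fm]) (auto intro: B)
qed

lemma bounded_integrable_avg:
  assumes f: "bounded_integrable n f" shows "bounded_integrable n (avg t f)"
proof -
  interpret P: pair_sigma_finite "Leb {..<n}" \<mu> by (rule pair_sigma_finite_Leb)
  obtain B where B: "\<And>x. x \<in> space (Leb {..<n}) \<Longrightarrow> \<bar>f x\<bar> \<le> B" using bounded_integrable_bound[OF f] by auto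
  have "integrable (Leb {..<n}) (avg t f)"
    unfolding avg_def using P.integrable_fst'[OF integrable_translate_pair[of f "-t"]] f
    by (simp add: bounded_integrable_def)
  moreover have "\<bar>avg t f x\<bar> \<le> B" for x
  proof -
    have "\<bar>avg t f x\<bar> \<le> (\<integral>z. B \<partial>\<mu>)"
      unfolding avg_def
      by (rule order_trans[OF integral_abs_bound], rule integral_mono)
         (use integrable_translate[OF f] B in auto)
    then show ?thesis using prob_space by simp
  qed
  ultimately show ?thesis by (auto simp: bounded_integrable_def)
qed

lemma avg_nonneg: "(\<And>x. 0 \<le> f x) \<Longrightarrow> 0 \<le> avg t f x"
  unfolding avg_def by (intro integral_nonneg_AE) auto

lemma avg_mono:
  assumes "bounded_integrable n f" "bounded_integrable n g" "\<And>x. f x \<le> g x"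
  shows "avg t f x \<le> avg t g x"
  unfolding avg_def using assms by (intro integral_mono integrable_translate)

lemma integral_reflect:
  fixes F :: "_ \<Rightarrow> 'b::{banach, second_countable_topology}"
  assumes F [measurable]: "F \<in> borel_measurable (Leb {..<n})"
  shows "(\<integral>z. F (affine_map n (-1) (\<lambda>_. 0) z) \<partial>\<mu>) = (\<integral>z. F z \<partial>\<mu>)"
proof -
  have "(\<integral>z. F z \<partial>\<mu>) = (\<integral>z. F z \<partial>distr \<mu> (Leb {..<n}) (affine_map n (-1) (\<lambda>_. 0)))"
    by (simp add: reflect)
  also have "\<dots> = (\<integral>z. F (affine_map n (-1) (\<lambda>_. 0) z) \<partial>\<mu>)"
    by (rule integral_distr) measurable
  finally show ?thesis by simp
qed

lemma integral_cis: "(\<integral>z. cis (t * dot n \<xi> z) \<partial>\<mu>) = complex_of_real (symbol t \<xi>)"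
proof -
  let ?I = "\<integral>z. cis (t * dot n \<xi> z) \<partial>\<mu>"
  have i: "integrable \<mu> (\<lambda>z. cis (t * dot n \<xi> z))"
    by (rule integrable_const_bound[where B=1]) auto
  have "?I = (\<integral>z. cis (t * dot n \<xi> (affine_map n (-1) (\<lambda>_. 0) z)) \<partial>\<mu>)"
    by (rule integral_reflect[symmetric]) measurable
  also have "\<dots> = (\<integral>z. cnj (cis (t * dot n \<xi> z)) \<partial>\<mu>)"
    by (intro Bochner_Integration.integral_cong refl) (simp add: dot_affine_map cis_cnj, simp add: dot_def)
  also have "\<dots> = cnj ?I" by (rule Bochner_Integration.integral_cnj)
  finally have "Im ?I = 0" by (metis Reals_cnj_iff complex_is_Real_iff)
  moreover have "Re ?I = symbol t \<xi>"
    unfolding symbol_def by (subst integral_Re[OF i, symmetric]) simp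
  ultimately show ?thesis by (simp add: complex_eq_iff)
qed

text \<open>The averages act as real multipliers. In this way frequency estimates become \<open>L\<^sup>2\<close> estimates through
  the bound for square functions.\<close>
lemma fourier_avg:
  assumes f: "bounded_integrable n f"
  shows "fourier n (avg t f) \<xi> = complex_of_real (symbol t \<xi>) * fourier n f \<xi>"
proof -
  let ?L = "Leb {..<n}"
  interpret P: pair_sigma_finite ?L \<mu> by (rule pair_sigma_finite_Leb)
  have int: "integrable ?L f" using f by (simp add: bounded_integrable_def)
  have [measurable]: "f \<in> borel_measurable ?L" using int by auto
  have intp: "integrable (?L \<Otimes>\<^sub>M \<mu>) (\<lambda>p. complex_of_real (f (affine_map n (-t) (fst p) (snd p))) * cis (dot n \<xi> (fst p)))"
    by (rule integrable_mult_cis[OF integrable_translate_pair[OF int]]) measurable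
  have "fourier n (avg t f) \<xi> = (\<integral>x. (\<integral>z. complex_of_real (f (affine_map n (-t) x z)) * cis (dot n \<xi> x) \<partial>\<mu>) \<partial>?L)"
    by (simp add: fourier_def avg_def)
  also have "\<dots> = (\<integral>z. (\<integral>x. complex_of_real (f (affine_map n (-t) x z)) * cis (dot n \<xi> x) \<partial>?L) \<partial>\<mu>)"
    using P.Fubini_integral[of "\<lambda>x z. complex_of_real (f (affine_map n (-t) x z)) * cis (dot n \<xi> x)"] intp
    by (simp add: split_beta')
  also have "\<dots> = (\<integral>z. cis (t * dot n \<xi> z) * fourier n f \<xi> \<partial>\<mu>)"
  proof (rule Bochner_Integration.integral_cong[OF refl])
    fix z
    have "fourier n f \<xi> = (\<integral>x. complex_of_real (f (affine_map n 1 (\<lambda>i. - t * z i) x)) * cis (dot n \<xi> (affine_map n 1 (\<lambda>i. - t * z i) x)) \<partial>?L)"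
      unfolding fourier_def by (subst integral_affine_map[of 1 _ n "\<lambda>i. - t * z i"]) auto
    also have "\<dots> = (\<integral>x. cis (- (t * dot n \<xi> z)) * (complex_of_real (f (affine_map n (-t) x z)) * cis (dot n \<xi> x)) \<partial>?L)"
    proof (rule Bochner_Integration.integral_cong[OF refl])
      fix x
      have "dot n \<xi> (affine_map n 1 (\<lambda>i. - t * z i) x) = - (t * dot n \<xi> z) + dot n \<xi> x"
        unfolding dot_affine_map by (simp add: dot_def sum_distrib_left sum_negf mult_ac)
      then show "complex_of_real (f (affine_map n 1 (\<lambda>i. - t * z i) x)) * cis (dot n \<xi> (affine_map n 1 (\<lambda>i. - t * z i) x))
        = cis (- (t * dot n \<xi> z)) * (complex_of_real (f (affine_map n (-t) x z)) * cis (dot n \<xi> x))"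
        by (simp only: affine_swap[of "-t"] cis_mult[symmetric] mult_ac)
    qed
    also have "\<dots> = cis (- (t * dot n \<xi> z)) * (\<integral>x. complex_of_real (f (affine_map n (-t) x z)) * cis (dot n \<xi> x) \<partial>?L)"
      by (rule integral_mult_right_zero)
    finally have "cis (t * dot n \<xi> z) * fourier n f \<xi>
      = cis (t * dot n \<xi> z) * (cis (- (t * dot n \<xi> z)) * (\<integral>x. complex_of_real (f (affine_map n (-t) x z)) * cis (dot n \<xi> x) \<partial>?L))"
      by (simp only:)
    also have "\<dots> = (\<integral>x. complex_of_real (f (affine_map n (-t) x z)) * cis (dot n \<xi> x) \<partial>?L)"
      by (simp only: mult.assoc[symmetric] cis_mult) simp
    finally show "(\<integral>x. complex_of_real (f (affine_map n (-t) x z)) * cis (dot n \<xi> x) \<partial>?L) = cis (t * dot n \<xi> z) * fourier n f \<xi>"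
      by (simp only:)
  qed
  also have "\<dots> = complex_of_real (symbol t \<xi>) * fourier n f \<xi>"
    by (simp only: integral_mult_left_zero integral_cis)
  finally show ?thesis .
qed

lemma avg_self_adjoint:
  assumes f: "bounded_integrable n f" and g: "bounded_integrable n g"
  shows "(\<integral>x. avg t f x * g x \<partial>Leb {..<n}) = (\<integral>x. f x * avg t g x \<partial>Leb {..<n})"
proof -
  let ?L = "Leb {..<n}"
  interpret P: pair_sigma_finite ?L \<mu> by (rule pair_sigma_finite_Leb)
  have int: "integrable ?L f" "integrable ?L g" using f g by (auto simp: bounded_integrable_def)
  have [measurable]: "f \<in> borel_measurable ?L" "g \<in> borel_measurable ?L" using int by auto
  obtain B where B: "\<And>x. x \<in> space ?L \<Longrightarrow> \<bar>g x\<bar> \<le> B" using bounded_integrable_bound[OF g] by auto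
  obtain C where C: "\<And>x. x \<in> space ?L \<Longrightarrow> \<bar>f x\<bar> \<le> C" using bounded_integrable_bound[OF f] by auto
  have i1: "integrable (?L \<Otimes>\<^sub>M \<mu>) (\<lambda>p. f (affine_map n (-t) (fst p) (snd p)) * g (fst p))"
    by (rule integrable_mult_bounded[OF integrable_translate_pair[OF int(1)], where B=B])
       (auto simp: space_pair_measure intro: B)
  have i2: "integrable (?L \<Otimes>\<^sub>M \<mu>) (\<lambda>p. g (affine_map n (-t) (fst p) (snd p)) * f (fst p))"
    by (rule integrable_mult_bounded[OF integrable_translate_pair[OF int(2)], where B=C])
       (auto simp: space_pair_measure intro: C)
  have "(\<integral>x. avg t f x * g x \<partial>?L) = (\<integral>x. (\<integral>z. f (affine_map n (-t) x z) * g x \<partial>\<mu>) \<partial>?L)"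
    by (simp add: avg_def)
  also have "\<dots> = (\<integral>z. (\<integral>x. f (affine_map n (-t) x z) * g x \<partial>?L) \<partial>\<mu>)"
    using P.Fubini_integral[of "\<lambda>x z. f (affine_map n (-t) x z) * g x"] i1 by (simp add: split_beta')
  also have "\<dots> = (\<integral>z. (\<integral>x. f x * g (affine_map n t x z) \<partial>?L) \<partial>\<mu>)"
  proof (rule Bochner_Integration.integral_cong[OF refl])
    fix z
    have "(\<integral>x. f x * g (affine_map n t x z) \<partial>?L)
      = (\<integral>x. f (affine_map n 1 (\<lambda>i. - t * z i) x) * g (affine_map n t (affine_map n 1 (\<lambda>i. - t * z i) x) z) \<partial>?L)"
      unfolding affine_swap[of t] by (subst integral_affine_map[of 1 _ n "\<lambda>i. - t * z i"]) auto
    also have "\<dots> = (\<integral>x. f (affine_map n (-t) x z) * g x \<partial>?L)"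
    proof (rule Bochner_Integration.integral_cong[OF refl])
      fix x assume x: "x \<in> space ?L"
      have "affine_map n t (affine_map n 1 (\<lambda>i. - t * z i) x) z = x"
        using x by (auto simp: affine_map_def space_PiM PiE_def extensional_def)
      then show "f (affine_map n 1 (\<lambda>i. - t * z i) x) * g (affine_map n t (affine_map n 1 (\<lambda>i. - t * z i) x) z)
        = f (affine_map n (-t) x z) * g x" by (simp add: affine_swap[of "-t"])
    qed
    finally show "(\<integral>x. f (affine_map n (-t) x z) * g x \<partial>?L) = (\<integral>x. f x * g (affine_map n t x z) \<partial>?L)" by simp
  qed
  also have "\<dots> = (\<integral>z. (\<integral>x. g (affine_map n (-t) x z) * f x \<partial>?L) \<partial>\<mu>)"
  proof -
    have "(\<lambda>z. \<integral>x. g (affine_map n (-t) x z) * f x \<partial>?L) \<in> borel_measurable \<mu>"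
      using P.integrable_snd[of "\<lambda>x z. g (affine_map n (-t) x z) * f x"] i2 by (auto simp: split_beta')
    then have m: "(\<lambda>z. \<integral>x. g (affine_map n (-t) x z) * f x \<partial>?L) \<in> borel_measurable ?L" by simp
    have "affine_map n (- t) x (affine_map n (-1) (\<lambda>_. 0) z) = affine_map n t x z" for x z
      by (auto simp: affine_map_def)
    then show ?thesis
      using integral_reflect[OF m] by (simp add: mult.commute)
  qed
  also have "\<dots> = (\<integral>x. (\<integral>z. g (affine_map n (-t) x z) * f x \<partial>\<mu>) \<partial>?L)"
    using P.Fubini_integral[of "\<lambda>x z. g (affine_map n (-t) x z) * f x"] i2 by (simp add: split_beta')
  also have "\<dots> = (\<integral>x. f x * avg t g x \<partial>?L)" by (simp add: avg_def mult.commute)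
  finally show ?thesis .
qed

lemma fourier_diff:
  assumes "bounded_integrable n f" "bounded_integrable n g"
  shows "fourier n (\<lambda>x. f x - g x) \<xi> = fourier n f \<xi> - fourier n g \<xi>"
proof -
  have "integrable (Leb {..<n}) (\<lambda>x. complex_of_real (f x) * cis (dot n \<xi> x))"
    "integrable (Leb {..<n}) (\<lambda>x. complex_of_real (g x) * cis (dot n \<xi> x))"
    using assms by (auto intro!: integrable_mult_cis simp: bounded_integrable_def)
  then show ?thesis by (simp add: fourier_def left_diff_distrib)
qed

end

section \<open>The maximal function over powers of two\<close>

lemma sum_square_le_twice_triangle:
  fixes a :: "nat \<Rightarrow> nat \<Rightarrow> real"
  assumes sym: "\<And>k l. a k l = a l k" and nonneg: "\<And>k. 0 \<le> a k k"
  shows "(\<Sum>k\<le>N. \<Sum>l\<le>N. a k l) \<le> 2 * (\<Sum>l\<le>N. \<Sum>k\<le>N. if k \<le> l then a k l else 0)"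
proof (induction N)
  case 0 then show ?case using nonneg[of 0] by simp
next
  case (Suc N)
  have "(\<Sum>k\<le>Suc N. \<Sum>l\<le>Suc N. a k l) = (\<Sum>k\<le>N. \<Sum>l\<le>N. a k l) + 2 * (\<Sum>k\<le>N. a k (Suc N)) + a (Suc N) (Suc N)"
  proof -
    have "(\<Sum>l\<le>N. a (Suc N) l) = (\<Sum>k\<le>N. a k (Suc N))" by (intro sum.cong refl sym)
    then show ?thesis by (simp add: sum.distrib)
  qed
  moreover have "(\<Sum>l\<le>Suc N. \<Sum>k\<le>Suc N. if k \<le> l then a k l else 0)
     = (\<Sum>l\<le>N. \<Sum>k\<le>N. if k \<le> l then a k l else 0) + (\<Sum>k\<le>N. a k (Suc N)) + a (Suc N) (Suc N)"
  proof -
    have "(\<Sum>l\<le>N. \<Sum>k\<le>Suc N. if k \<le> l then a k l else 0) = (\<Sum>l\<le>N. \<Sum>k\<le>N. if k \<le> l then a k l else 0)"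
      by (rule sum.cong[OF refl]) auto
    moreover have "(\<Sum>k\<le>N. if k \<le> Suc N then a k (Suc N) else 0) = (\<Sum>k\<le>N. a k (Suc N))"
      by (intro sum.cong refl) simp
    ultimately show ?thesis by simp
  qed
  ultimately show ?case using Suc nonneg[of "Suc N"] by linarith
qed

lemma geometric_row: "(\<Sum>k\<le>N. if k \<le> l then (1/2) ^ (l - k) else 0) \<le> (2 :: real)"
proof -
  have "(\<Sum>k\<le>N. if k \<le> l then (1/2) ^ (l - k) else 0) \<le> 2 * (if N \<le> l then (1/2) ^ (l - N) else (1 :: real))"
  proof (induction N)
    case (Suc N)
    show ?case
    proof (cases "Suc N \<le> l")
      case True
      then have "l - N = Suc (l - Suc N)" by simp
      then show ?thesis using Suc True by simp
    next
      case False then show ?thesis using Suc by (cases "N = l") auto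
    qed
  qed simp
  also have "\<dots> \<le> 2" by (simp add: power_le_one)
  finally show ?thesis .
qed

lemma geometric_column: "(\<Sum>l\<le>N. if k \<le> l then (1/2) ^ (l - k) else 0) \<le> (2 :: real)"
proof -
  have "(\<Sum>l\<le>N. if k \<le> l then (1/2) ^ (l - k) else 0) \<le> (if k \<le> N then 2 - (1/2) ^ (N - k) else (0 :: real))"
  proof (induction N)
    case (Suc N)
    show ?case
    proof (cases "k \<le> N")
      case True
      then have "Suc N - k = Suc (N - k)" by simp
      then show ?thesis using Suc True by simp
    next
      case False then show ?thesis using Suc by (cases "k = Suc N") auto
    qed
  qed simp
  also have "\<dots> \<le> 2" by simp
  finally show ?thesis .
qed

lemma product_le_weighted_squares:
  fixes u v e :: real
  assumes "0 < e" shows "u * v \<le> e / 2 * u\<^sup>2 + 1 / (2 * e) * v\<^sup>2"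
proof -
  have "2 * e * (u * v) \<le> e\<^sup>2 * u\<^sup>2 + v\<^sup>2"
    using zero_le_power2[of "e * u - v"] by (simp add: power2_diff power_mult_distrib)
  then have "(2 * e * (u * v)) / (2 * e) \<le> (e\<^sup>2 * u\<^sup>2 + v\<^sup>2) / (2 * e)"
    using assms by (intro divide_right_mono) auto
  then show ?thesis using assms by (simp add: add_divide_distrib power2_eq_square)
qed

context symmetric_averages
begin

lemma symbol_estimates:
  obtains l where "0 \<le> l" "\<And>s. 0 < s \<Longrightarrow> s * l * \<bar>symbol s \<xi>\<bar> \<le> 36"
    "\<And>s. 0 < s \<Longrightarrow> \<bar>1 - symbol s \<xi>\<bar> \<le> s * l"
    "\<And>a b. 0 < a \<Longrightarrow> a \<le> b \<Longrightarrow> \<bar>symbol a \<xi> - symbol b \<xi>\<bar> \<le> 2 * (1 - a / b)"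
    "\<And>a b. 0 < a \<Longrightarrow> a \<le> b \<Longrightarrow> \<bar>symbol a \<xi> - symbol b \<xi>\<bar> \<le> (b - a) * l"
proof -
  obtain l where l: "0 \<le> l" "\<forall>s>0. s * l * \<bar>symbol s \<xi>\<bar> \<le> 9 * pi"
    "\<forall>s>0. \<bar>1 - symbol s \<xi>\<bar> \<le> s * l"
    "\<forall>a b. 0 < a \<longrightarrow> a \<le> b \<longrightarrow> \<bar>symbol a \<xi> - symbol b \<xi>\<bar> \<le> min (2 * (1 - a / b)) ((b - a) * l)"
    using transform[of \<xi>] unfolding symbol_def by auto
  have "s * l * \<bar>symbol s \<xi>\<bar> \<le> 36" if "0 < s" for s
  proof -
    have "s * l * \<bar>symbol s \<xi>\<bar> \<le> 9 * pi" using l(2) that by blast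
    also have "\<dots> \<le> 36" using pi_less_4 by simp
    finally show ?thesis .
  qed
  then show thesis using l by (intro that[of l]) auto
qed

text \<open>At a scale that is \<open>2 ^ j\<close> times smaller, averaging hardly changes what the larger average has left:
  where \<open>1 - symbol s \<xi>\<close> is not small, the frequency is already damped by the larger average.\<close>
lemma symbol_product_error:
  assumes s: "0 < s"
  shows "\<bar>symbol s \<xi> * symbol (2 ^ j * s) \<xi> - symbol (2 ^ j * s) \<xi>\<bar> \<le> 36 * (1/2) ^ j"
proof -
  obtain l where l: "0 \<le> l" "\<And>s. 0 < s \<Longrightarrow> s * l * \<bar>symbol s \<xi>\<bar> \<le> 36"
    "\<And>s. 0 < s \<Longrightarrow> \<bar>1 - symbol s \<xi>\<bar> \<le> s * l"
    using symbol_estimates[of \<xi>] by metis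
  let ?m = "symbol (2 ^ j * s) \<xi>"
  have "symbol s \<xi> * ?m - ?m = - ((1 - symbol s \<xi>) * ?m)" by (simp add: algebra_simps)
  then have "\<bar>symbol s \<xi> * ?m - ?m\<bar> = \<bar>1 - symbol s \<xi>\<bar> * \<bar>?m\<bar>" by (simp only: abs_minus_cancel abs_mult)
  also have "\<dots> \<le> (s * l) * \<bar>?m\<bar>" using l(3)[OF s] by (intro mult_right_mono) auto
  also have "\<dots> = (1/2) ^ j * (2 ^ j * s * l * \<bar>?m\<bar>)" by (simp add: power_one_over)
  also have "\<dots> \<le> (1/2) ^ j * 36" using l(2)[of "2 ^ j * s"] s by (intro mult_left_mono) auto
  finally show ?thesis by simp
qed

lemma avg_product_error:
  assumes s: "0 < s" and g: "bounded_integrable n g"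
  shows "L2sq n (\<lambda>x. avg s (avg (2 ^ j * s) g) x - avg (2 ^ j * s) g x) \<le> (36 * (1/2) ^ j)\<^sup>2 * L2sq n g"
proof -
  let ?E = "\<lambda>x. avg s (avg (2 ^ j * s) g) x - avg (2 ^ j * s) g x"
  have "(\<Sum>i\<in>{0::nat}. \<integral>x. (?E x)\<^sup>2 \<partial>Leb {..<n}) \<le> (36 * (1/2) ^ j)\<^sup>2 * L2sq n g"
  proof (rule square_function_bound[OF _ g])
    fix \<xi>
    have "fourier n ?E \<xi> = complex_of_real (symbol s \<xi> * symbol (2 ^ j * s) \<xi> - symbol (2 ^ j * s) \<xi>) * fourier n g \<xi>"
      using g by (simp add: fourier_diff fourier_avg bounded_integrable_avg algebra_simps)
    then have "cmod (fourier n ?E \<xi>) = \<bar>symbol s \<xi> * symbol (2 ^ j * s) \<xi> - symbol (2 ^ j * s) \<xi>\<bar> * cmod (fourier n g \<xi>)"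
      by (simp only: norm_mult norm_of_real)
    also have "\<dots> \<le> 36 * (1/2) ^ j * cmod (fourier n g \<xi>)"
      by (intro mult_right_mono symbol_product_error s) auto
    finally have "(cmod (fourier n ?E \<xi>))\<^sup>2 \<le> (36 * (1/2) ^ j * cmod (fourier n g \<xi>))\<^sup>2"
      by (intro power_mono) auto
    then show "(\<Sum>i\<in>{0::nat}. (cmod (fourier n ?E \<xi>))\<^sup>2) \<le> (36 * (1/2) ^ j)\<^sup>2 * (cmod (fourier n g \<xi>))\<^sup>2"
      by (simp only: power_mult_distrib sum.insert finite.emptyI empty_iff not_False_eq_True sum.empty add_0_right)
  qed (use g in \<open>auto intro: bounded_integrable_diff bounded_integrable_avg\<close>)
  then show ?thesis by simp
qed

lemma bounded_integrable_square: "bounded_integrable n f \<Longrightarrow> bounded_integrable n (\<lambda>x. (f x)\<^sup>2)"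
  by (simp add: power2_eq_square bounded_integrable_product)

lemma bounded_integrable_Max:
  assumes "finite I" "I \<noteq> {}" "\<And>i. i \<in> I \<Longrightarrow> bounded_integrable n (F i)" "\<And>i x. i \<in> I \<Longrightarrow> 0 \<le> F i x"
  shows "bounded_integrable n (\<lambda>x. Max ((\<lambda>i. F i x) ` I))"
proof -
  have m: "(\<lambda>x. Max ((\<lambda>i. F i x) ` I)) \<in> borel_measurable (Leb {..<n})"
    using assms by (intro borel_measurable_Max) (auto intro: bounded_integrable_measurable)
  have b: "bounded_integrable n (\<lambda>x. \<Sum>i\<in>I. F i x)" using assms by (intro bounded_integrable_sum) auto
  have le: "(0 \<le> Max ((\<lambda>i. F i x) ` I)) \<and> (Max ((\<lambda>i. F i x) ` I) \<le> (\<Sum>i\<in>I. F i x))" for x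
  proof
    show "Max ((\<lambda>i. F i x) ` I) \<le> (\<Sum>i\<in>I. F i x)"
      using assms by (auto intro: member_le_sum)
    show "0 \<le> Max ((\<lambda>i. F i x) ` I)"
    proof -
      have "Max ((\<lambda>i. F i x) ` I) \<in> (\<lambda>i. F i x) ` I" using assms by (intro Max_in) auto
      then obtain i where "i \<in> I" "Max ((\<lambda>i. F i x) ` I) = F i x" by auto
      then show ?thesis using assms(4) by simp
    qed
  qed
  have "integrable (Leb {..<n}) (\<lambda>x. Max ((\<lambda>i. F i x) ` I))"
    by (rule Bochner_Integration.integrable_bound[of _ "\<lambda>x. \<Sum>i\<in>I. F i x"])
       (use b m le in \<open>auto simp: bounded_integrable_def intro: order_trans[OF _ abs_ge_self]\<close>)
  moreover obtain B where B: "\<And>x. x \<in> space (Leb {..<n}) \<Longrightarrow> \<bar>(\<Sum>i\<in>I. F i x)\<bar> \<le> B"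
    using bounded_integrable_bound[OF b] by auto
  have "\<bar>Max ((\<lambda>i. F i x) ` I)\<bar> \<le> B" if "x \<in> space (Leb {..<n})" for x
    using le[of x] B[OF that] by linarith
  ultimately show ?thesis by (auto simp: bounded_integrable_def)
qed

text \<open>The maximal function \<open>h\<close> is linearized by sets on which the average at scale \<open>k\<close> is the largest one; let
  \<open>g k\<close> be the restriction of \<open>h\<close> to such a set, and \<open>Y\<close> the sum of the averages of the \<open>g k\<close>.
  Then \<open>\<parallel>h\<parallel>\<^sup>2 = \<langle>Y, f\<rangle>\<close>, so it suffices to bound \<open>\<parallel>Y\<parallel>\<close> by \<open>\<parallel>h\<parallel>\<close>. In
  \<open>\<parallel>Y\<parallel>\<^sup>2 = \<Sum> \<langle>A k (g k), A l (g l)\<rangle> = \<Sum> \<langle>g k, A k (A l (g l))\<rangle>\<close> with \<open>k \<le> l\<close> the product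
  \<open>A k A l\<close> is replaced by \<open>A l\<close>, with an error that decays geometrically in \<open>l - k\<close>. The main terms are
  then positive and add up to at most \<open>\<langle>h, Y\<rangle>\<close>, because the \<open>g k\<close> with \<open>k \<le> l\<close> add up to at most \<open>h\<close>.
  So \<open>\<parallel>Y\<parallel>\<^sup>2\<close> is bounded by a multiple of \<open>\<parallel>h\<parallel> \<parallel>Y\<parallel> + \<parallel>h\<parallel>\<^sup>2\<close>.\<close>
theorem lacunary_maximal:
  assumes f: "bounded_integrable n f" "\<And>x. 0 \<le> f x" and \<tau>: "0 < \<tau>"
  shows "L2sq n (\<lambda>x. Max ((\<lambda>k. avg (2 ^ k * \<tau>) f x) ` {..N})) \<le> 292 * L2sq n f"
proof -
  let ?L = "Leb {..<n}"
  define A where "A k = avg (2 ^ k * \<tau>)" for k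
  define h where "h x = Max ((\<lambda>k. A k f x) ` {..N})" for x
  define ch where "ch k x = (if A k f x = h x \<and> (\<forall>j<k. A j f x \<noteq> h x) then 1 else 0 :: real)" for k x
  define g where "g k x = h x * ch k x" for k x
  have Ab: "bounded_integrable n (A k u)" if "bounded_integrable n u" for k u
    using that by (simp add: A_def bounded_integrable_avg)
  have A0: "0 \<le> A k u x" if "\<And>x. 0 \<le> u x" for k u x using that by (simp add: A_def avg_nonneg)
  have hb: "bounded_integrable n h" unfolding h_def by (intro bounded_integrable_Max Ab f A0) auto
  have h_in: "h x \<in> (\<lambda>k. A k f x) ` {..N}" for x unfolding h_def by (intro Max_in) auto
  have h0: "0 \<le> h x" for x using h_in[of x] A0[of f] f(2) by auto
  have [measurable]: "Measurable.pred ?L (\<lambda>x. A k f x = h x)" for k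
    unfolding pred_def
    by (intro borel_measurable_eq bounded_integrable_measurable[OF hb] bounded_integrable_measurable[OF Ab[OF f(1)]])
  have [measurable]: "ch k \<in> borel_measurable ?L" for k unfolding ch_def by measurable
  have ch01: "0 \<le> ch k x" "ch k x \<le> 1" "ch k x * ch k x = ch k x" for k x by (auto simp: ch_def)
  have chsum: "(\<Sum>k\<le>N. ch k x) = 1" for x
  proof -
    obtain k0 where k0: "k0 \<le> N" "A k0 f x = h x"
      using h_in[of x] by auto
    define K where "K = (LEAST k. A k f x = h x)"
    have K: "A K f x = h x" "K \<le> k0" "\<And>j. j < K \<Longrightarrow> A j f x \<noteq> h x"
      unfolding K_def using k0(2) by (auto intro: LeastI Least_le dest: not_less_Least)
    have "ch k x = (if k = K then 1 else 0)" for k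
      using K by (auto simp: ch_def) (metis linorder_neqE_nat)+
    then show ?thesis using K(2) k0(1) by simp
  qed
  have gb: "bounded_integrable n (g k)" for k
    unfolding g_def using ch01 by (intro bounded_integrable_mult[OF hb, where B=1]) auto
  have g0: "0 \<le> g k x" for k x using h0 ch01 by (simp add: g_def)
  have gsum: "(\<Sum>k\<le>N. g k x) = h x" for x using chsum by (simp add: g_def flip: sum_distrib_left)
  have gsq: "(\<Sum>k\<le>N. (g k x)\<^sup>2) = (h x)\<^sup>2" for x
  proof -
    have eq: "(g k x)\<^sup>2 = (h x)\<^sup>2 * ch k x" for k using ch01(3)[of k x] by (simp add: g_def power2_eq_square mult_ac)
    show ?thesis unfolding eq by (simp only: sum_distrib_left[symmetric] chsum mult_1_right)
  qed
  have ib: "integrable ?L u" if "bounded_integrable n u" for u using that by (simp add: bounded_integrable_def)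
  have ip: "integrable ?L (\<lambda>x. u x * v x)" if "bounded_integrable n u" "bounded_integrable n v" for u v
    using bounded_integrable_product[OF that] by (rule ib)
  have sq: "integrable ?L (\<lambda>x. (u x)\<^sup>2)" if "bounded_integrable n u" for u
    using bounded_integrable_square[OF that] by (rule ib)
  define Y where "Y x = (\<Sum>k\<le>N. A k (g k) x)" for x
  have Yb: "bounded_integrable n Y" unfolding Y_def by (intro bounded_integrable_sum Ab gb)
  have H_eq: "L2sq n h = (\<integral>x. Y x * f x \<partial>?L)"
  proof -
    have "(h x)\<^sup>2 = (\<Sum>k\<le>N. g k x * A k f x)" for x
    proof -
      have eq: "g k x * A k f x = h x * g k x" for k by (auto simp: g_def ch_def)
      show ?thesis by (simp only: eq gsum power2_eq_square sum_distrib_left[symmetric])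
    qed
    then have "L2sq n h = (\<Sum>k\<le>N. \<integral>x. g k x * A k f x \<partial>?L)"
      using ip[OF gb Ab[OF f(1)]] by (simp add: Bochner_Integration.integral_sum)
    also have "\<dots> = (\<Sum>k\<le>N. \<integral>x. A k (g k) x * f x \<partial>?L)"
      unfolding A_def by (intro sum.cong refl avg_self_adjoint[symmetric] gb f)
    also have "\<dots> = (\<integral>x. Y x * f x \<partial>?L)"
      using ip[OF Ab[OF gb] f(1)] by (simp add: Y_def sum_distrib_right Bochner_Integration.integral_sum)
    finally show ?thesis .
  qed
  define G where "G k = L2sq n (g k)" for k
  have G0: "0 \<le> G k" for k unfolding G_def by simp
  have Gsum: "(\<Sum>k\<le>N. G k) = L2sq n h"
    using sq[OF gb] by (simp add: G_def gsq flip: Bochner_Integration.integral_sum)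
  define a where "a k l = (\<integral>x. A k (g k) x * A l (g l) x \<partial>?L)" for k l
  define b where "b k l = (\<integral>x. g k x * A l (g l) x \<partial>?L)" for k l
  define w where "w k l = (if k \<le> l then (1/2) ^ (l - k) else 0 :: real)" for k l :: nat
  have b0: "0 \<le> b k l" for k l
    unfolding b_def using g0 A0[OF g0] by (intro integral_nonneg_AE AE_I2 mult_nonneg_nonneg)
  have Y_eq: "L2sq n Y = (\<Sum>k\<le>N. \<Sum>l\<le>N. a k l)"
    using ip[OF Ab[OF gb] Ab[OF gb]]
    by (simp add: Y_def a_def power2_eq_square sum_product Bochner_Integration.integral_sum)
  \<comment> \<open>The constant 18 is half of the 36 in the bound for the product error.\<close>
  have a_le: "a k l \<le> b k l + 18 * w k l * (G k + G l)" if kl: "k \<le> l" for k l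
  proof -
    define e where "e = 36 * (1/2 :: real) ^ (l - k)"
    have e: "0 < e" by (simp add: e_def)
    let ?s = "2 ^ k * \<tau>" and ?E = "\<lambda>x. A k (A l (g l)) x - A l (g l) x"
    have sl: "2 ^ (l - k) * ?s = 2 ^ l * \<tau>" using kl by (simp flip: power_add mult.assoc)
    have "0 < ?s" using \<tau> by simp
    from avg_product_error[OF this gb[of l], of "l - k"] have E2: "L2sq n ?E \<le> e\<^sup>2 * G l"
      unfolding sl A_def G_def e_def .
    have Eb: "bounded_integrable n ?E" by (intro bounded_integrable_diff Ab gb)
    have "a k l = (\<integral>x. g k x * A k (A l (g l)) x \<partial>?L)"
      unfolding a_def A_def by (intro avg_self_adjoint gb) (use Ab[OF gb] in \<open>simp add: A_def\<close>)
    also have "\<dots> = (\<integral>x. g k x * A l (g l) x + g k x * ?E x \<partial>?L)"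
      by (intro Bochner_Integration.integral_cong refl) (simp add: algebra_simps)
    also have "\<dots> = b k l + (\<integral>x. g k x * ?E x \<partial>?L)"
      unfolding b_def by (intro Bochner_Integration.integral_add ip gb Ab Eb)
    finally have 1: "a k l = b k l + (\<integral>x. g k x * ?E x \<partial>?L)" .
    have 2: "(\<integral>x. g k x * ?E x \<partial>?L) \<le> (\<integral>x. e / 2 * (g k x)\<^sup>2 + 1 / (2 * e) * (?E x)\<^sup>2 \<partial>?L)"
    proof (rule integral_mono)
      show "g k x * ?E x \<le> e / 2 * (g k x)\<^sup>2 + 1 / (2 * e) * (?E x)\<^sup>2" for x
        by (rule product_le_weighted_squares[OF e])
      show "integrable ?L (\<lambda>x. g k x * ?E x)" by (rule ip[OF gb Eb])
      show "integrable ?L (\<lambda>x. e / 2 * (g k x)\<^sup>2 + 1 / (2 * e) * (?E x)\<^sup>2)"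
        by (intro Bochner_Integration.integrable_add integrable_mult_right sq gb Eb)
    qed
    have 3: "(\<integral>x. e / 2 * (g k x)\<^sup>2 + 1 / (2 * e) * (?E x)\<^sup>2 \<partial>?L) = e / 2 * G k + 1 / (2 * e) * L2sq n ?E"
      unfolding G_def integral_mult_right_zero[symmetric]
      by (intro Bochner_Integration.integral_add integrable_mult_right sq gb Eb)
    have "1 / (2 * e) * L2sq n ?E \<le> 1 / (2 * e) * (e\<^sup>2 * G l)" using E2 e by (intro mult_left_mono) auto
    also have "1 / (2 * e) * (e\<^sup>2 * G l) = e / 2 * G l" using e by (simp add: power2_eq_square)
    finally have 4: "1 / (2 * e) * L2sq n ?E \<le> e / 2 * G l" .
    have "a k l \<le> b k l + (e / 2 * G k + e / 2 * G l)"
      unfolding 1 using order_trans[OF 2 order_trans[OF eq_refl[OF 3] add_left_mono[OF 4]]] by (rule add_left_mono)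
    then have "a k l \<le> b k l + e / 2 * (G k + G l)" by (simp only: distrib_left)
    then show ?thesis using kl by (simp add: w_def e_def)
  qed
  have "(\<Sum>l\<le>N. \<Sum>k\<le>N. if k \<le> l then a k l else 0) \<le> (\<Sum>l\<le>N. \<Sum>k\<le>N. b k l + (18 * (w k l * G k) + 18 * (w k l * G l)))"
  proof (intro sum_mono)
    fix k l
    show "(if k \<le> l then a k l else 0) \<le> b k l + (18 * (w k l * G k) + 18 * (w k l * G l))"
    proof (cases "k \<le> l")
      case True
      then show ?thesis using a_le[OF True] by (simp add: distrib_left mult.assoc)
    next
      case False
      then show ?thesis using b0[of k l] by (simp add: w_def)
    qed
  qed
  also have "\<dots> = (\<Sum>l\<le>N. \<Sum>k\<le>N. b k l) + (18 * (\<Sum>l\<le>N. \<Sum>k\<le>N. w k l * G k) + 18 * (\<Sum>l\<le>N. \<Sum>k\<le>N. w k l * G l))"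
    by (simp add: sum.distrib sum_distrib_left)
  also have "(\<Sum>l\<le>N. \<Sum>k\<le>N. b k l) = (\<integral>x. h x * Y x \<partial>?L)"
  proof -
    have "h x * Y x = (\<Sum>l\<le>N. \<Sum>k\<le>N. g k x * A l (g l) x)" for x
      unfolding gsum[symmetric] Y_def sum_product by (rule sum.swap)
    then have "(\<integral>x. h x * Y x \<partial>?L) = (\<integral>x. (\<Sum>l\<le>N. \<Sum>k\<le>N. g k x * A l (g l) x) \<partial>?L)"
      by (simp only:)
    also have "\<dots> = (\<Sum>l\<le>N. \<Sum>k\<le>N. b k l)"
      unfolding b_def by (simp add: Bochner_Integration.integral_sum ip[OF gb Ab[OF gb]])
    finally show ?thesis by simp
  qed
  also have "(\<Sum>l\<le>N. \<Sum>k\<le>N. w k l * G k) \<le> 2 * L2sq n h"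
  proof -
    have "(\<Sum>l\<le>N. \<Sum>k\<le>N. w k l * G k) = (\<Sum>k\<le>N. (\<Sum>l\<le>N. w k l) * G k)"
      by (subst sum.swap) (simp add: sum_distrib_right)
    also have "\<dots> \<le> (\<Sum>k\<le>N. 2 * G k)"
      using geometric_column[where N=N] G0 by (intro sum_mono mult_right_mono) (auto simp: w_def)
    finally show ?thesis by (simp add: Gsum flip: sum_distrib_left)
  qed
  also have "(\<Sum>l\<le>N. \<Sum>k\<le>N. w k l * G l) \<le> 2 * L2sq n h"
  proof -
    have "(\<Sum>l\<le>N. \<Sum>k\<le>N. w k l * G l) = (\<Sum>l\<le>N. (\<Sum>k\<le>N. w k l) * G l)"
      by (simp add: sum_distrib_right)
    also have "\<dots> \<le> (\<Sum>l\<le>N. 2 * G l)"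
      using geometric_row[where N=N] G0 by (intro sum_mono mult_right_mono) (auto simp: w_def)
    finally show ?thesis by (simp add: Gsum flip: sum_distrib_left)
  qed
  finally have tri: "(\<Sum>l\<le>N. \<Sum>k\<le>N. if k \<le> l then a k l else 0) \<le> (\<integral>x. h x * Y x \<partial>?L) + 72 * L2sq n h" by simp
  have "L2sq n Y \<le> 2 * (\<Sum>l\<le>N. \<Sum>k\<le>N. if k \<le> l then a k l else 0)"
    unfolding Y_eq by (rule sum_square_le_twice_triangle) (auto simp: a_def mult.commute)
  also have "\<dots> \<le> 2 * ((\<integral>x. h x * Y x \<partial>?L) + 72 * L2sq n h)" using tri by simp
  finally have X: "L2sq n Y \<le> 2 * (\<integral>x. h x * Y x \<partial>?L) + 144 * L2sq n h" by simp
  have "(\<integral>x. h x * Y x \<partial>?L) \<le> (\<integral>x. (h x)\<^sup>2 + (Y x)\<^sup>2 / 4 \<partial>?L)"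
  proof (rule integral_mono)
    fix x show "h x * Y x \<le> (h x)\<^sup>2 + (Y x)\<^sup>2 / 4"
      using zero_le_power2[of "h x - Y x / 2"] by (simp add: power2_diff power_divide)
  qed (use sq hb Yb ip in auto)
  also have "\<dots> = L2sq n h + L2sq n Y / 4" using sq hb Yb by simp
  finally have X2: "L2sq n Y \<le> 292 * L2sq n h" using X by linarith
  have "L2sq n h \<le> (\<integral>x. (Y x)\<^sup>2 / 584 + 146 * (f x)\<^sup>2 \<partial>?L)"
    unfolding H_eq
  proof (rule integral_mono)
    fix x show "Y x * f x \<le> (Y x)\<^sup>2 / 584 + 146 * (f x)\<^sup>2"
      using zero_le_power2[of "Y x - 292 * f x"] by (simp add: power2_diff power_mult_distrib)
  qed (use sq f Yb ip in auto)
  also have "\<dots> = L2sq n Y / 584 + 146 * L2sq n f" using sq f Yb by simp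
  finally have "L2sq n h \<le> 292 * L2sq n f" using X2 by linarith
  then show ?thesis by (simp add: h_def A_def)
qed

end

section \<open>Chaining over dyadic subdivisions\<close>

text \<open>\<open>G\<close> increases from 0 to 1, and its increments over octaves have the size of the left-hand side; so a sum
  of the left-hand side over octaves telescopes.\<close>
lemma dyadic_increment:
  fixes u :: real
  assumes u: "0 \<le> u"
  defines "G \<equiv> \<lambda>u :: real. sqrt u / (1 + sqrt u)"
  shows "min (sqrt u) (1 / sqrt u) \<le> 12 * (G (2 * u) - G u)"
proof (cases "u = 0")
  case True then show ?thesis by (simp add: G_def)
next
  case False
  define a where "a = sqrt u"
  define r where "r = sqrt (2 :: real)"
  have a: "0 < a" using u False by (simp add: a_def)
  have r: "1.4 \<le> r" "r \<le> 1.5"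
    unfolding r_def by (rule real_le_rsqrt, simp add: power2_eq_square, rule real_le_lsqrt, simp_all add: power2_eq_square)
  have r1: "2 + 2 * r \<le> 12 * (r - 1)" using r by simp
  have "G (2 * u) - G u = (r - 1) * a / ((1 + r * a) * (1 + a))"
  proof -
    have nz: "1 + r * a \<noteq> 0" "1 + a \<noteq> 0" using a r by (auto simp: add_nonneg_eq_0_iff)
    have "G (2 * u) - G u = r * a / (1 + r * a) - a / (1 + a)"
      by (simp add: G_def real_sqrt_mult a_def r_def)
    also have "\<dots> = (r * a * (1 + a) - a * (1 + r * a)) / ((1 + r * a) * (1 + a))" by (rule diff_frac_eq[OF nz])
    also have "r * a * (1 + a) - a * (1 + r * a) = (r - 1) * a" by (simp add: algebra_simps)
    finally show ?thesis .
  qed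
  moreover have "min a (1 / a) * ((1 + r * a) * (1 + a)) \<le> 12 * ((r - 1) * a)"
  proof (cases "a \<le> 1")
    case True
    have "(1 + r * a) * (1 + a) \<le> (1 + r * 1) * (1 + 1)" using a r True by (intro mult_mono add_mono) auto
    also have "\<dots> \<le> 12 * (r - 1)" using r1 by simp
    finally have "a * ((1 + r * a) * (1 + a)) \<le> a * (12 * (r - 1))" using a by (intro mult_left_mono) auto
    moreover have "min a (1 / a) * ((1 + r * a) * (1 + a)) \<le> a * ((1 + r * a) * (1 + a))"
      using a r by (intro mult_right_mono) auto
    ultimately show ?thesis by (simp add: mult_ac)
  next
    case False
    have "(1 + r * a) * (1 + a) \<le> (a + r * a) * (a + a)" using a r False by (intro mult_mono add_mono) auto
    also have "\<dots> = a * a * (2 + 2 * r)" by (simp add: algebra_simps)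
    also have "\<dots> \<le> a * a * (12 * (r - 1))" using a r1 by (intro mult_left_mono) auto
    finally have "1 / a * ((1 + r * a) * (1 + a)) \<le> 1 / a * (a * a * (12 * (r - 1)))" using a by (intro mult_left_mono) auto
    moreover have "min a (1 / a) * ((1 + r * a) * (1 + a)) \<le> 1 / a * ((1 + r * a) * (1 + a))"
      using a r by (intro mult_right_mono) auto
    ultimately show ?thesis using a by (simp add: mult_ac)
  qed
  moreover have "0 < (1 + r * a) * (1 + a)" using a r by (intro mult_pos_pos add_pos_pos) auto
  ultimately show ?thesis by (simp add: a_def[symmetric] pos_le_divide_eq)
qed

lemma dyadic_sum_bound:
  fixes c :: real
  assumes c: "0 \<le> c"
  shows "(\<Sum>k\<le>N. min (sqrt (2 ^ k * c)) (1 / sqrt (2 ^ k * c))) \<le> 12"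
proof -
  let ?G = "\<lambda>u :: real. sqrt u / (1 + sqrt u)"
  have "(\<Sum>k\<le>N. min (sqrt (2 ^ k * c)) (1 / sqrt (2 ^ k * c))) \<le> (\<Sum>k\<le>N. 12 * (?G (2 ^ Suc k * c) - ?G (2 ^ k * c)))"
    using dyadic_increment[of "2 ^ k * c" for k] c by (intro sum_mono) (simp add: mult.assoc)
  also have "\<dots> = 12 * (\<Sum>k\<le>N. ?G (2 ^ Suc k * c) - ?G (2 ^ k * c))" by (simp only: sum_distrib_left)
  also have "(\<Sum>k\<le>N. ?G (2 ^ Suc k * c) - ?G (2 ^ k * c)) = ?G (2 ^ Suc N * c) - ?G (2 ^ 0 * c)"
    by (induction N) auto
  also have "?G (2 ^ Suc N * c) - ?G (2 ^ 0 * c) \<le> 1 - 0"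
  proof (rule diff_mono)
    have "x / (1 + x) \<le> 1" if "0 \<le> x" for x :: real using that by (simp add: divide_le_eq_1)
    then show "?G (2 ^ Suc N * c) \<le> 1" using c by (metis mult_nonneg_nonneg real_sqrt_ge_zero zero_le_numeral zero_le_power)
    show "0 \<le> ?G (2 ^ 0 * c)" using c by simp
  qed
  finally show ?thesis by simp
qed

text \<open>Interpolation between the three bounds on \<open>d\<close>: the exponent \<open>3/2\<close> of \<open>D\<close> exceeds 1, which compensates the
  \<open>1 / D\<close> points in an octave, and \<open>sqrt u\<close>, \<open>1 / sqrt u\<close> make the sum over octaves converge.\<close>
lemma interpolated_increment:
  fixes d D u :: real
  assumes d: "0 \<le> d" "d \<le> D" "d \<le> u" "u * d \<le> 72"
  shows "d\<^sup>2 \<le> 9 * (D * sqrt D) * min (sqrt u) (1 / sqrt u)"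
proof (cases "u = 0")
  case True then show ?thesis using d by simp
next
  case False
  then have u: "0 < u" using d by simp
  have "sqrt d * sqrt u \<le> 9"
    using d u by (simp add: real_sqrt_mult[symmetric] mult.commute real_le_lsqrt)
  then have "sqrt d \<le> 9 * (1 / sqrt u)" using u by (simp add: pos_le_divide_eq)
  moreover have "sqrt d \<le> 9 * sqrt u"
  proof -
    have "sqrt d \<le> sqrt u" using d by simp
    then show ?thesis using real_sqrt_gt_zero[OF u] by linarith
  qed
  ultimately have s: "sqrt d \<le> 9 * min (sqrt u) (1 / sqrt u)" by (auto simp: min_def)
  have "d\<^sup>2 = (d * sqrt d) * sqrt d" using d by (simp add: power2_eq_square mult.assoc)
  also have "\<dots> \<le> (D * sqrt D) * (9 * min (sqrt u) (1 / sqrt u))"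
    using d s by (intro mult_mono) auto
  finally show ?thesis by (simp add: mult_ac)
qed

lemma square_le_weighted_squares:
  fixes S \<alpha> y m q :: real
  assumes S: "0 < S" and \<alpha>: "0 < \<alpha>" and y: "0 \<le> y" "y \<le> m + q"
  shows "y\<^sup>2 \<le> (1 + S / \<alpha>) * m\<^sup>2 + (1 + \<alpha> / S) * q\<^sup>2"
proof -
  have "y\<^sup>2 \<le> (m + q)\<^sup>2" using y by (intro power_mono) auto
  also have "\<dots> = m\<^sup>2 + q\<^sup>2 + 2 * (m * q)" by (simp add: power2_sum)
  also have "2 * (m * q) \<le> 2 * ((S / \<alpha>) / 2 * m\<^sup>2 + 1 / (2 * (S / \<alpha>)) * q\<^sup>2)"
    using S \<alpha> by (intro mult_left_mono product_le_weighted_squares) auto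
  also have "2 * ((S / \<alpha>) / 2 * m\<^sup>2 + 1 / (2 * (S / \<alpha>)) * q\<^sup>2) = S / \<alpha> * m\<^sup>2 + \<alpha> / S * q\<^sup>2"
    using S \<alpha> by (simp add: distrib_left)
  finally show ?thesis by (simp add: distrib_right)
qed

lemma Max_grid_attained:
  fixes F :: "nat \<Rightarrow> nat \<Rightarrow> real"
  obtains k i where "k \<le> N" "i \<le> 2 ^ L" "Max ((\<lambda>(k, i). F k i) ` ({..N} \<times> {..2 ^ L})) = F k i"
proof -
  let ?f = "\<lambda>(k, i). F k i" and ?P = "{..N} \<times> {..2 ^ L :: nat}"
  have "Max (?f ` ?P) \<in> ?f ` ?P" by (intro Max_in) auto
  then obtain p where p: "p \<in> ?P" "Max (?f ` ?P) = ?f p" by blast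
  obtain k i where ki: "p = (k, i)" by (cases p)
  show thesis
  proof (rule that)
    show "k \<le> N" "i \<le> 2 ^ L" using p(1) ki by auto
    show "Max (?f ` ?P) = F k i" using p(2) unfolding ki prod.case .
  qed
qed

context symmetric_averages
begin

text \<open>Level \<open>L\<close> divides each octave \<open>2 ^ k * \<tau> * {1..2}\<close> into \<open>2 ^ L\<close> steps of equal length. Both endpoints of the
  octave are included, so every point of level \<open>Suc L\<close> is a point of level \<open>L\<close> or the successor of one.\<close>
definition grid_time :: "real \<Rightarrow> nat \<Rightarrow> nat \<Rightarrow> nat \<Rightarrow> real" where
  "grid_time \<tau> L k i = 2 ^ k * \<tau> * (1 + real i / 2 ^ L)"

lemma grid_time_even: "grid_time \<tau> (Suc L) k (2 * i) = grid_time \<tau> L k i"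
  by (simp add: grid_time_def)

text \<open>With \<open>D = (1/2) ^ L\<close>, each of the \<open>1 / D\<close> increments in an octave has a square of size \<open>D * sqrt D\<close>, so the
  sum has size \<open>sqrt D\<close>. The base \<open>17/20\<close> is an upper bound of the fourth root of \<open>1/2\<close>.\<close>
lemma symbol_increment:
  assumes \<tau>: "0 < \<tau>"
  shows "(\<Sum>k\<le>N. \<Sum>i<2 ^ L. (symbol (grid_time \<tau> (Suc L) k (Suc (2 * i))) \<xi> - symbol (grid_time \<tau> L k i) \<xi>)\<^sup>2)
    \<le> (11 * (17/20) ^ L)\<^sup>2"
proof -
  obtain l where l: "0 \<le> l" "\<And>s. 0 < s \<Longrightarrow> s * l * \<bar>symbol s \<xi>\<bar> \<le> 36"
    "\<And>a b. 0 < a \<Longrightarrow> a \<le> b \<Longrightarrow> \<bar>symbol a \<xi> - symbol b \<xi>\<bar> \<le> 2 * (1 - a / b)"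
    "\<And>a b. 0 < a \<Longrightarrow> a \<le> b \<Longrightarrow> \<bar>symbol a \<xi> - symbol b \<xi>\<bar> \<le> (b - a) * l"
    using symbol_estimates[of \<xi>] by metis
  define D where "D = (1/2 :: real) ^ L"
  have D: "0 < D" "D \<le> 1" by (auto simp: D_def power_le_one)
  let ?b = "\<lambda>k i. grid_time \<tau> (Suc L) k (Suc (2 * i))" and ?a = "\<lambda>k i. grid_time \<tau> L k i"
  let ?u = "\<lambda>k. 2 ^ k * (\<tau> * l)"
  have one: "(symbol (?b k i) \<xi> - symbol (?a k i) \<xi>)\<^sup>2 \<le> 9 * (D * sqrt D) * min (sqrt (?u k)) (1 / sqrt (?u k))" for k i
  proof -
    define s where "s = 2 ^ k * \<tau>"
    have s: "0 < s" using \<tau> by (simp add: s_def)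
    have a: "s \<le> ?a k i" unfolding grid_time_def s_def[symmetric] using s by simp
    have ba: "?b k i - ?a k i = s * D / 2"
      by (simp add: grid_time_def s_def D_def power_one_over field_simps)
    have b: "?a k i \<le> ?b k i" "s \<le> ?b k i" using ba a mult_pos_pos[OF s D(1)] by linarith+
    let ?d = "\<bar>symbol (?b k i) \<xi> - symbol (?a k i) \<xi>\<bar>"
    have ab0: "0 < ?a k i" "0 < ?b k i" using a b s by linarith+
    have "?d\<^sup>2 \<le> 9 * (D * sqrt D) * min (sqrt (s * l)) (1 / sqrt (s * l))"
    proof (rule interpolated_increment)
      have "?d \<le> 2 * (1 - ?a k i / ?b k i)" using l(3)[OF ab0(1) b(1)] by (simp add: abs_minus_commute)
      also have "\<dots> = s * D / ?b k i" using ab0 ba by (simp add: field_simps)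
      also have "\<dots> \<le> s * D / s" using s D b by (intro divide_left_mono) auto
      finally show "?d \<le> D" using s by simp
      have "?d \<le> s * D / 2 * l" using l(4)[OF ab0(1) b(1)] ba by (simp add: abs_minus_commute)
      also have "\<dots> \<le> s * l" using s D l(1) by (intro mult_right_mono) (auto simp: mult_le_cancel_left1 field_simps)
      finally show "?d \<le> s * l" .
      have "s * l * \<bar>symbol c \<xi>\<bar> \<le> 36" if "s \<le> c" for c
      proof -
        have "s * l * \<bar>symbol c \<xi>\<bar> \<le> c * l * \<bar>symbol c \<xi>\<bar>" using that s l(1) by (intro mult_right_mono) auto
        also have "\<dots> \<le> 36" using l(2)[of c] s that by simp
        finally show ?thesis .
      qed
      from this[OF a] this[OF b(2)]
      have "s * l * (\<bar>symbol (?b k i) \<xi>\<bar> + \<bar>symbol (?a k i) \<xi>\<bar>) \<le> 72" by (simp add: distrib_left)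
      moreover have "s * l * ?d \<le> s * l * (\<bar>symbol (?b k i) \<xi>\<bar> + \<bar>symbol (?a k i) \<xi>\<bar>)"
        using s l(1) by (intro mult_left_mono abs_triangle_ineq4) auto
      ultimately show "s * l * ?d \<le> 72" by linarith
    qed simp
    then show ?thesis by (simp add: s_def mult.assoc)
  qed
  have "(\<Sum>k\<le>N. \<Sum>i<2 ^ L. (symbol (?b k i) \<xi> - symbol (?a k i) \<xi>)\<^sup>2)
    \<le> (\<Sum>k\<le>N. \<Sum>i<(2 :: nat) ^ L. 9 * (D * sqrt D) * min (sqrt (?u k)) (1 / sqrt (?u k)))"
    by (intro sum_mono one)
  also have "\<dots> = 2 ^ L * (9 * (D * sqrt D)) * (\<Sum>k\<le>N. min (sqrt (?u k)) (1 / sqrt (?u k)))"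
    by (simp add: sum_distrib_left mult.assoc)
  also have "\<dots> \<le> 2 ^ L * (9 * (D * sqrt D)) * 12"
    using D \<tau> l(1) by (intro mult_left_mono dyadic_sum_bound) auto
  also have "2 ^ L * (9 * (D * sqrt D)) * 12 = 108 * sqrt D" by (simp add: D_def power_one_over)
  also have "sqrt D = sqrt (1/2) ^ L" by (simp add: D_def real_sqrt_power)
  also have "108 * sqrt (1/2) ^ L \<le> 121 * ((17/20)\<^sup>2) ^ L"
  proof -
    have "sqrt (1/2) \<le> (17/20 :: real)\<^sup>2" by (rule real_le_lsqrt) (simp_all add: power2_eq_square)
    then have "sqrt (1/2) ^ L \<le> ((17/20 :: real)\<^sup>2) ^ L" by (intro power_mono) auto
    moreover have "0 \<le> ((17/20 :: real)\<^sup>2) ^ L" by simp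
    ultimately show ?thesis by linarith
  qed
  also have "\<dots> = (11 * (17/20) ^ L)\<^sup>2" by (simp add: power_mult_distrib power_mult[symmetric] mult.commute)
  finally show ?thesis .
qed

lemma grid_increment:
  assumes f: "bounded_integrable n f" and \<tau>: "0 < \<tau>"
  defines "\<Delta> \<equiv> \<lambda>L k i x. avg (grid_time \<tau> (Suc L) k (Suc (2 * i))) f x - avg (grid_time \<tau> L k i) f x"
  shows "(\<integral>x. (\<Sum>k\<le>N. \<Sum>i<2 ^ L. (\<Delta> L k i x)\<^sup>2) \<partial>Leb {..<n}) \<le> (11 * (17/20) ^ L)\<^sup>2 * L2sq n f"
proof -
  have \<Delta>b: "bounded_integrable n (\<Delta> L k i)" for k i
    unfolding \<Delta>_def by (intro bounded_integrable_diff bounded_integrable_avg f)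
  have i: "integrable (Leb {..<n}) (\<lambda>x. (\<Delta> L k i x)\<^sup>2)" for k i
    using bounded_integrable_square[OF \<Delta>b] by (simp add: bounded_integrable_def)
  let ?I = "{..N} \<times> {..<2 ^ L}"
  have "(\<Sum>p\<in>?I. L2sq n (\<Delta> L (fst p) (snd p))) \<le> (11 * (17/20) ^ L)\<^sup>2 * L2sq n f"
  proof (rule square_function_bound[OF _ f \<Delta>b])
    fix \<xi>
    have "(cmod (fourier n (\<Delta> L k i) \<xi>))\<^sup>2
      = (symbol (grid_time \<tau> (Suc L) k (Suc (2 * i))) \<xi> - symbol (grid_time \<tau> L k i) \<xi>)\<^sup>2 * (cmod (fourier n f \<xi>))\<^sup>2" for k i
    proof -
      have "fourier n (\<Delta> L k i) \<xi> = complex_of_real (symbol (grid_time \<tau> (Suc L) k (Suc (2 * i))) \<xi> - symbol (grid_time \<tau> L k i) \<xi>) * fourier n f \<xi>"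
        using f by (simp add: \<Delta>_def fourier_diff fourier_avg bounded_integrable_avg left_diff_distrib)
      then show ?thesis by (simp only: norm_mult norm_of_real power_mult_distrib power2_abs)
    qed
    then have "(\<Sum>p\<in>?I. (cmod (fourier n (\<Delta> L (fst p) (snd p)) \<xi>))\<^sup>2)
      = (\<Sum>k\<le>N. \<Sum>i<2 ^ L. (symbol (grid_time \<tau> (Suc L) k (Suc (2 * i))) \<xi> - symbol (grid_time \<tau> L k i) \<xi>)\<^sup>2) * (cmod (fourier n f \<xi>))\<^sup>2"
      by (simp only: sum.cartesian_product split_beta' sum_distrib_right)
    also have "\<dots> \<le> (11 * (17/20) ^ L)\<^sup>2 * (cmod (fourier n f \<xi>))\<^sup>2"
      by (intro mult_right_mono symbol_increment \<tau>) auto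
    finally show "(\<Sum>p\<in>?I. (cmod (fourier n (\<Delta> L (fst p) (snd p)) \<xi>))\<^sup>2) \<le> (11 * (17/20) ^ L)\<^sup>2 * (cmod (fourier n f \<xi>))\<^sup>2" .
  qed simp
  also have "(\<Sum>p\<in>?I. L2sq n (\<Delta> L (fst p) (snd p))) = (\<integral>x. (\<Sum>k\<le>N. \<Sum>i<2 ^ L. (\<Delta> L k i x)\<^sup>2) \<partial>Leb {..<n})"
    using i by (simp add: sum.cartesian_product split_beta' Bochner_Integration.integral_sum)
  finally show ?thesis .
qed

text \<open>Level 0 consists of powers of two. Passing to the next level adds to the maximal function at most the
  \<open>\<ell>\<^sup>2\<close> norm of the increments, whose \<open>L\<^sup>2\<close> norm is summable over the levels.\<close>
theorem grid_maximal:
  assumes f: "bounded_integrable n f" "\<And>x. 0 \<le> f x" and \<tau>: "0 < \<tau>"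
  shows "L2sq n (\<lambda>x. Max ((\<lambda>(k, i). avg (grid_time \<tau> L k i) f x) ` ({..N} \<times> {..2 ^ L})))
    \<le> (18 + 11 * (\<Sum>j<L. (17/20) ^ j))\<^sup>2 * L2sq n f"
proof (induction L)
  case 0
  let ?M = "\<lambda>x. Max ((\<lambda>(k, i). avg (grid_time \<tau> 0 k i) f x) ` ({..N} \<times> {..2 ^ 0}))"
  let ?h = "\<lambda>x. Max ((\<lambda>k. avg (2 ^ k * \<tau>) f x) ` {..Suc N})"
  have a0: "0 \<le> avg t f x" for t x by (rule avg_nonneg) (rule f)
  have hb: "bounded_integrable n ?h" by (intro bounded_integrable_Max bounded_integrable_avg f a0) auto
  have Mb: "bounded_integrable n ?M"
    using bounded_integrable_Max[of "{..N} \<times> {..2 ^ 0 :: nat}" "\<lambda>p. avg (grid_time \<tau> 0 (fst p) (snd p)) f"]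
    by (auto simp: split_beta' intro: bounded_integrable_avg f a0)
  have "L2sq n ?M \<le> L2sq n ?h"
  proof (rule integral_mono)
    fix x
    obtain k i where ki': "k \<le> N" "i \<le> 2 ^ 0" and ki3: "?M x = avg (grid_time \<tau> 0 k i) f x"
      by (rule Max_grid_attained)
    have ki: "k \<le> N" "i \<le> 1" using ki' by auto
    have "grid_time \<tau> 0 k i = 2 ^ (k + i) * \<tau>"
      using ki(2) by (cases "i = 0") (auto simp: grid_time_def le_Suc_eq)
    moreover have "avg (2 ^ (k + i) * \<tau>) f x \<le> ?h x"
      using ki by (intro Max_ge) auto
    ultimately show "(?M x)\<^sup>2 \<le> (?h x)\<^sup>2" unfolding ki3 using a0 by (intro power_mono) auto
  qed (use bounded_integrable_square[OF hb] bounded_integrable_square[OF Mb] in \<open>auto simp: bounded_integrable_def\<close>)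
  also have "\<dots> \<le> 292 * L2sq n f" by (rule lacunary_maximal[OF f \<tau>])
  also have "\<dots> \<le> 18\<^sup>2 * L2sq n f" by (intro mult_right_mono) auto
  finally show ?case by simp
next
  case (Suc L)
  let ?L = "Leb {..<n}"
  let ?M = "\<lambda>L x. Max ((\<lambda>(k, i). avg (grid_time \<tau> L k i) f x) ` ({..N} \<times> {..2 ^ L}))"
  let ?\<Delta> = "\<lambda>k i x. avg (grid_time \<tau> (Suc L) k (Suc (2 * i))) f x - avg (grid_time \<tau> L k i) f x"
  let ?d = "\<lambda>x. \<Sum>k\<le>N. \<Sum>i<2 ^ L. (?\<Delta> k i x)\<^sup>2"
  define \<alpha> where "\<alpha> = 18 + 11 * (\<Sum>j<L. (17/20) ^ j :: real)"
  define S where "S = 11 * (17/20 :: real) ^ L"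
  have S: "0 < S" by (simp add: S_def)
  have \<alpha>: "0 < \<alpha>" unfolding \<alpha>_def by (intro add_pos_nonneg mult_nonneg_nonneg sum_nonneg) auto
  have a0: "0 \<le> avg t f x" for t x by (rule avg_nonneg) (rule f)
  have Mb: "bounded_integrable n (?M L)" for L
    using bounded_integrable_Max[of "{..N} \<times> {..2 ^ L :: nat}" "\<lambda>p. avg (grid_time \<tau> L (fst p) (snd p)) f"]
    by (auto simp: split_beta' intro: bounded_integrable_avg f a0)
  have db: "bounded_integrable n ?d"
    by (intro bounded_integrable_sum bounded_integrable_square bounded_integrable_diff bounded_integrable_avg f)
  have M0: "0 \<le> ?M L x" for L x
  proof -
    obtain k i where "?M L x = avg (grid_time \<tau> L k i) f x" by (rule Max_grid_attained)
    then show ?thesis using a0 by (simp only:)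
  qed
  have d0: "0 \<le> ?d x" for x by (intro sum_nonneg) auto
  have step: "?M (Suc L) x \<le> ?M L x + sqrt (?d x)" for x
  proof -
    have M_ge: "avg (grid_time \<tau> L k i) f x \<le> ?M L x" if "k \<le> N" "i \<le> 2 ^ L" for k i
      using that by (intro Max_ge) auto
    obtain k i where ki: "k \<le> N" "i \<le> 2 ^ Suc L" "?M (Suc L) x = avg (grid_time \<tau> (Suc L) k i) f x"
      by (rule Max_grid_attained)
    show ?thesis
    proof (cases "even i")
      case True
      then obtain j where j: "i = 2 * j" by auto
      then have "avg (grid_time \<tau> (Suc L) k i) f x \<le> ?M L x"
        using ki by (auto simp: grid_time_even intro: M_ge)
      then show ?thesis using ki(3) real_sqrt_ge_zero[OF d0[of x]] by linarith
    next
      case False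
      then obtain j where j: "i = Suc (2 * j)" by (auto elim: oddE)
      then have jL: "j < 2 ^ L" using ki(2) by auto
      have "(?\<Delta> k j x)\<^sup>2 \<le> (\<Sum>i<2 ^ L. (?\<Delta> k i x)\<^sup>2)"
        using jL by (intro member_le_sum) auto
      also have "\<dots> \<le> ?d x" using ki(1) by (intro member_le_sum) (auto intro: sum_nonneg)
      finally have "(?\<Delta> k j x)\<^sup>2 \<le> ?d x" .
      from real_sqrt_le_mono[OF this] have "\<bar>?\<Delta> k j x\<bar> \<le> sqrt (?d x)" by (simp only: real_sqrt_abs)
      moreover have "avg (grid_time \<tau> L k j) f x \<le> ?M L x" using jL ki by (intro M_ge) auto
      ultimately show ?thesis unfolding ki(3) j by linarith
    qed
  qed
  have pt: "(?M (Suc L) x)\<^sup>2 \<le> (1 + S / \<alpha>) * (?M L x)\<^sup>2 + (1 + \<alpha> / S) * ?d x" for x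
    using square_le_weighted_squares[OF S \<alpha> M0 step] unfolding real_sqrt_pow2[OF d0] .
  have i: "integrable ?L (\<lambda>x. (?M L x)\<^sup>2)" for L
    using bounded_integrable_square[OF Mb] by (simp add: bounded_integrable_def)
  have id: "integrable ?L ?d" using db by (simp add: bounded_integrable_def)
  have "L2sq n (?M (Suc L)) \<le> (\<integral>x. (1 + S / \<alpha>) * (?M L x)\<^sup>2 + (1 + \<alpha> / S) * ?d x \<partial>?L)"
    by (rule integral_mono[OF i _ pt]) (intro Bochner_Integration.integrable_add integrable_mult_right i id)
  also have "\<dots> = (1 + S / \<alpha>) * L2sq n (?M L) + (1 + \<alpha> / S) * (\<integral>x. ?d x \<partial>?L)"
    unfolding integral_mult_right_zero[symmetric]
    by (intro Bochner_Integration.integral_add integrable_mult_right i id)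
  also have "\<dots> \<le> (1 + S / \<alpha>) * (\<alpha>\<^sup>2 * L2sq n f) + (1 + \<alpha> / S) * (S\<^sup>2 * L2sq n f)"
    using Suc.IH grid_increment[OF f(1) \<tau>, of L N] S \<alpha>
    by (intro add_mono mult_left_mono) (auto simp: \<alpha>_def S_def)
  also have "\<dots> = (\<alpha> + S)\<^sup>2 * L2sq n f"
    using S \<alpha> by (simp add: field_simps power2_eq_square)
  finally show ?case by (simp add: \<alpha>_def S_def algebra_simps)
qed

text \<open>The constant is \<open>18 + 11 / (1 - 17/20) = 18 + 220/3\<close>, rounded up.\<close>
theorem grid_maximal_92:
  assumes "bounded_integrable n f" "\<And>x. 0 \<le> f x" and "0 < \<tau>"
  shows "L2sq n (\<lambda>x. Max ((\<lambda>(k, i). avg (grid_time \<tau> L k i) f x) ` ({..N} \<times> {..2 ^ L}))) \<le> 92\<^sup>2 * L2sq n f"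
proof -
  define q where "q = (17/20 :: real) ^ L"
  have geometric: "(\<Sum>j<L. (17/20 :: real) ^ j) = 20/3 * (1 - q)"
    unfolding q_def by (subst sum_gp_strict) auto
  have "0 \<le> q" by (simp add: q_def)
  then have "18 + 11 * (\<Sum>j<L. (17/20 :: real) ^ j) \<le> 92" unfolding geometric by simp
  moreover have "0 \<le> (\<Sum>j<L. (17/20 :: real) ^ j)" by (intro sum_nonneg) auto
  ultimately have "(18 + 11 * (\<Sum>j<L. (17/20 :: real) ^ j))\<^sup>2 * L2sq n f \<le> 92\<^sup>2 * L2sq n f"
    by (intro mult_right_mono power_mono) auto
  then show ?thesis using grid_maximal[OF assms, of L N] by linarith
qed

end

section \<open>All scales\<close>

lemma grid_time_approximates:
  assumes t: "0 < t" and N: "1 / 2 ^ N \<le> t" "t < 2 ^ N"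
  obtains k i where "k \<le> 2 * N" "i \<le> 2 ^ N"
    "t \<le> 2 ^ k * (1 / 2 ^ N) * (1 + real i / 2 ^ N)" "2 ^ k * (1 / 2 ^ N) * (1 + real i / 2 ^ N) \<le> t * (1 + 1 / 2 ^ N)"
proof -
  define y where "y = t * 2 ^ N"
  have y1: "1 \<le> y" using N(1) by (simp add: y_def field_simps)
  obtain k where k: "2 ^ k \<le> nat \<lfloor>y\<rfloor>" "nat \<lfloor>y\<rfloor> < 2 ^ (k + 1)"
    using ex_power_ivl1[of 2 "nat \<lfloor>y\<rfloor>"] y1 by (auto simp: le_nat_floor)
  have ky: "2 ^ k \<le> y" "y < 2 ^ (k + 1)"
  proof -
    have "real (2 ^ k) \<le> real (nat \<lfloor>y\<rfloor>)" using k(1) by (simp only: of_nat_le_iff)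
    also have "\<dots> \<le> y" using y1 by (simp add: of_nat_floor)
    finally show "2 ^ k \<le> y" by simp
    have "nat \<lfloor>y\<rfloor> + 1 \<le> 2 ^ (k + 1)" using k(2) by simp
    then have "real (nat \<lfloor>y\<rfloor> + 1) \<le> real (2 ^ (k + 1))" by (simp only: of_nat_le_iff)
    moreover have "y < real (nat \<lfloor>y\<rfloor> + 1)" using y1 by simp linarith
    ultimately show "y < 2 ^ (k + 1)" by simp
  qed
  have kN: "k \<le> 2 * N"
  proof -
    have "y < 2 ^ N * 2 ^ N" using N(2) by (simp add: y_def)
    then have "(2 :: real) ^ k < 2 ^ (2 * N)" using ky(1) by (simp add: mult_2 power_add)
    then show ?thesis by simp
  qed
  define s where "s = y / 2 ^ k"
  have s: "1 \<le> s" "s < 2" using ky by (auto simp: s_def field_simps)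
  define i where "i = nat \<lceil>(s - 1) * 2 ^ N\<rceil>"
  have i: "(s - 1) * 2 ^ N \<le> real i" "real i \<le> (s - 1) * 2 ^ N + 1"
    using s by (auto simp: i_def)
  have "(s - 1) * 2 ^ N \<le> 1 * 2 ^ N" using s by (intro mult_right_mono) auto
  then have "\<lceil>(s - 1) * 2 ^ N\<rceil> \<le> 2 ^ N" by (simp add: ceiling_le_iff)
  then have iN: "i \<le> 2 ^ N" by (simp add: i_def nat_le_iff)
  have t_eq: "t = 2 ^ k * (1 / 2 ^ N) * s" by (simp add: s_def y_def)
  have "((s - 1) * 2 ^ N) / 2 ^ N \<le> real i / 2 ^ N" "real i / 2 ^ N \<le> ((s - 1) * 2 ^ N + 1) / 2 ^ N"
    by (rule divide_right_mono[OF i(1)], simp, rule divide_right_mono[OF i(2)], simp)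
  then have "s \<le> 1 + real i / 2 ^ N" "1 + real i / 2 ^ N \<le> s + 1 / 2 ^ N"
    by (simp_all add: add_divide_distrib)
  moreover have "s + 1 / 2 ^ N \<le> s * (1 + 1 / 2 ^ N)"
  proof -
    have "1 * (1 / 2 ^ N) \<le> s * (1 / 2 ^ N)" using s(1) by (intro mult_right_mono) auto
    then show ?thesis by (simp add: distrib_left)
  qed
  ultimately have "s \<le> 1 + real i / 2 ^ N" "1 + real i / 2 ^ N \<le> s * (1 + 1 / 2 ^ N)" by linarith+
  then have "2 ^ k * (1 / 2 ^ N) * s \<le> 2 ^ k * (1 / 2 ^ N) * (1 + real i / 2 ^ N)"
    "2 ^ k * (1 / 2 ^ N) * (1 + real i / 2 ^ N) \<le> 2 ^ k * (1 / 2 ^ N) * (s * (1 + 1 / 2 ^ N))"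
    by (intro mult_left_mono; simp)+
  then show thesis
    by (intro that[OF kN iN]) (simp_all only: t_eq mult.assoc)
qed

lemma SUP_square_le_ennreal:
  fixes y :: "'a \<Rightarrow> ennreal"
  assumes "\<And>i. i \<in> I \<Longrightarrow> (y i)\<^sup>2 \<le> B"
  shows "(SUP i\<in>I. y i)\<^sup>2 \<le> B"
proof (cases B)
  case (real b)
  have "y i \<le> ennreal (sqrt b)" if i: "i \<in> I" for i
  proof (cases "y i")
    case (real r)
    then have "ennreal (r\<^sup>2) \<le> ennreal b" using assms[OF i] \<open>B = ennreal b\<close> by (simp add: ennreal_power)
    then have "r\<^sup>2 \<le> b" using \<open>0 \<le> b\<close> by (simp add: ennreal_le_iff)
    then show ?thesis using real by (auto intro!: ennreal_leI real_le_rsqrt)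
  next
    case top
    then show ?thesis using assms[OF i] real by (simp add: top_unique power2_eq_square ennreal_top_mult)
  qed
  then have "(SUP i\<in>I. y i) \<le> ennreal (sqrt b)" by (intro SUP_least)
  then have "(SUP i\<in>I. y i)\<^sup>2 \<le> (ennreal (sqrt b))\<^sup>2" by (rule power_mono) simp
  also have "\<dots> = B" using real by (simp add: ennreal_power)
  finally show ?thesis .
qed simp

context log_concave_kernel
begin

text \<open>A point \<open>c * u\<close> with \<open>0 \<le> c \<le> 1\<close> is a convex combination of \<open>u\<close> and \<open>- u\<close>.\<close>
lemma kernel_decreasing_on_rays:
  assumes u: "u \<in> space (Leb {..<n})" and c: "0 \<le> c" "c \<le> 1"
  shows "K u \<le> K (\<lambda>i\<in>{..<n}. c * u i)"
proof -
  define a where "a = (1 - c) / 2"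
  have a: "a \<in> {0..1}" using c by (auto simp: a_def)
  let ?v = "\<lambda>i\<in>{..<n}. - u i"
  have v: "?v \<in> space (Leb {..<n})" by (simp add: space_PiM)
  have Kv: "K ?v = K u" using symmetric u by (simp add: symmetric_fun_def Rn_eq)
  have K0: "0 \<le> K u" using log_concave u by (simp add: log_concave_def Rn_eq)
  have "K u = K u powr (1 - a) * K ?v powr a"
    using K0 unfolding Kv by (cases "K u = 0") (auto simp flip: powr_add)
  also have "\<dots> \<le> K (\<lambda>i\<in>{..<n}. (1 - a) * u i + a * ?v i)"
    using log_concave u v a unfolding log_concave_def Rn_eq by blast
  also have "(\<lambda>i\<in>{..<n}. (1 - a) * u i + a * ?v i) = (\<lambda>i\<in>{..<n}. c * u i)"
    by (auto simp: a_def fun_eq_iff restrict_def field_simps)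
  finally show ?thesis .
qed

lemma dilate_le:
  assumes v: "v \<in> space (Leb {..<n})" and t: "0 < t" "t \<le> t'"
  shows "dilate n t K v \<le> (t' / t) ^ n * dilate n t' K v"
proof -
  let ?u = "\<lambda>i\<in>{..<n}. inverse t * v i"
  have "K ?u \<le> K (\<lambda>i\<in>{..<n}. (t / t') * ?u i)"
    using t by (intro kernel_decreasing_on_rays) (auto simp: space_PiM)
  also have "(\<lambda>i\<in>{..<n}. (t / t') * ?u i) = (\<lambda>i\<in>{..<n}. inverse t' * v i)"
    using t by (auto simp: fun_eq_iff restrict_def field_simps)
  finally have "K ?u \<le> K (\<lambda>i\<in>{..<n}. inverse t' * v i)" .
  then have "inverse (t ^ n) * K ?u \<le> inverse (t ^ n) * K (\<lambda>i\<in>{..<n}. inverse t' * v i)"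
    using t by (intro mult_left_mono) auto
  also have "\<dots> = (t' / t) ^ n * (inverse (t' ^ n) * K (\<lambda>i\<in>{..<n}. inverse t' * v i))"
    using t by (simp add: power_divide field_simps del: restrict_apply)
  finally have le: "inverse (t ^ n) * K ?u \<le> (t' / t) ^ n * (inverse (t' ^ n) * K (\<lambda>i\<in>{..<n}. inverse t' * v i))" .
  have p: "s powi (- int n) = inverse (s ^ n)" for s :: real by (simp add: power_int_minus)
  show ?thesis using le unfolding dilate_def p .
qed

lemma convolution_eq_average:
  assumes x: "x \<in> space (Leb {..<n})" and t: "0 < t"
    and [measurable]: "g \<in> borel_measurable (Leb {..<n})" and g: "\<And>y. 0 \<le> g y"
    and g': "AE y in Leb {..<n}. g' y = g y"
  shows "convolution n (dilate n t K) g' x = (\<integral>\<^sup>+z. ennreal (g (affine_map n (- t) x z)) \<partial>law)"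
proof -
  let ?L = "Leb {..<n}"
  let ?b = "\<lambda>y. affine_map n (- (1 / t)) (\<lambda>i. x i / t) y"
  have [measurable]: "Z \<in> sets ?L" using Z by auto
  have "(\<integral>\<^sup>+y. indicator Z y \<partial>?L) = ennreal (\<bar>- (1 / t)\<bar> ^ n) * (\<integral>\<^sup>+y. indicator Z (?b y) \<partial>?L)"
    using t by (intro nn_integral_affine_map) auto
  moreover have "(\<integral>\<^sup>+y. indicator Z y \<partial>?L) = 0" using Z by auto
  ultimately have "(\<integral>\<^sup>+y. indicator Z (?b y) \<partial>?L) = 0" using t by auto
  then have Zb: "AE y in ?L. ?b y \<notin> Z"
    by (subst (asm) nn_integral_0_iff_AE) (auto simp: indicator_def)
  have "convolution n (dilate n t K) g' x = (\<integral>\<^sup>+y. ennreal (inverse (t ^ n) * K (?b y) * g' y) \<partial>?L)"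
  proof -
    have "(\<lambda>i\<in>{..<n}. inverse t * (\<lambda>i\<in>{..<n}. x i - y i) i) = ?b y" for y
      using t by (auto simp: fun_eq_iff affine_map_def restrict_def field_simps)
    then show ?thesis
      by (simp add: convolution_def dilate_def lebesgue_Rn_def nn_integral_completion power_int_minus)
  qed
  also have "\<dots> = (\<integral>\<^sup>+y. ennreal (inverse (t ^ n) * K0 (?b y) * g y) \<partial>?L)"
  proof (rule nn_integral_cong_AE)
    show "AE y in ?L. ennreal (inverse (t ^ n) * K (?b y) * g' y) = ennreal (inverse (t ^ n) * K0 (?b y) * g y)"
      using Zb g' by eventually_elim (simp add: K0(1))
  qed
  also have "\<dots> = ennreal (\<bar>- t\<bar> ^ n) * (\<integral>\<^sup>+z. ennreal (inverse (t ^ n) * K0 (?b (affine_map n (- t) x z)) * g (affine_map n (- t) x z)) \<partial>?L)"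
    using t by (intro nn_integral_affine_map) auto
  also have "\<dots> = (\<integral>\<^sup>+z. ennreal (\<bar>- t\<bar> ^ n) * ennreal (inverse (t ^ n) * K0 (?b (affine_map n (- t) x z)) * g (affine_map n (- t) x z)) \<partial>?L)"
    by (rule nn_integral_cmult[symmetric]) measurable
  also have "\<dots> = (\<integral>\<^sup>+z. ennreal (K0 z) * ennreal (g (affine_map n (- t) x z)) \<partial>?L)"
  proof (rule nn_integral_cong)
    fix z assume z: "z \<in> space ?L"
    have "?b (affine_map n (- t) x z) = z"
      using z t by (auto simp: affine_map_def space_PiM PiE_def extensional_def fun_eq_iff field_simps)
    then show "ennreal (\<bar>- t\<bar> ^ n) * ennreal (inverse (t ^ n) * K0 (?b (affine_map n (- t) x z)) * g (affine_map n (- t) x z))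
      = ennreal (K0 z) * ennreal (g (affine_map n (- t) x z))"
      using t K0(2)[of z] g by (simp add: mult.assoc[symmetric] flip: ennreal_mult)
  qed
  also have "\<dots> = (\<integral>\<^sup>+z. ennreal (g (affine_map n (- t) x z)) \<partial>law)"
    unfolding law_def by (rule nn_integral_density[symmetric]) measurable
  finally show ?thesis .
qed

sublocale symmetric_averages law n by (rule symmetric_averages_law)

lemma convolution_bounded_integrable:
  assumes x: "x \<in> space (Leb {..<n})" and t: "0 < t"
    and g: "bounded_integrable n g" "\<And>y. 0 \<le> g y"
  shows "convolution n (dilate n t K) g x = ennreal (avg t g x)"
proof -
  have "convolution n (dilate n t K) g x = (\<integral>\<^sup>+z. ennreal (g (affine_map n (- t) x z)) \<partial>law)"
    using g by (intro convolution_eq_average x t bounded_integrable_measurable) auto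
  also have "\<dots> = ennreal (avg t g x)"
    unfolding avg_def using g by (intro nn_integral_eq_integral integrable_translate) auto
  finally show ?thesis .
qed

text \<open>Since the kernel decreases on rays, an average is controlled by the average at a slightly larger scale,
  with a factor close to 1. This factor depends on \<open>n\<close>, but it disappears in the limit of fine grids.\<close>
lemma avg_le_avg_later:
  assumes x: "x \<in> space (Leb {..<n})" and t: "0 < t" "t \<le> t'"
    and g: "bounded_integrable n g" "\<And>y. 0 \<le> g y"
  shows "avg t g x \<le> (t' / t) ^ n * avg t' g x"
proof -
  have [measurable]: "g \<in> borel_measurable (Leb {..<n})" using g(1) by (rule bounded_integrable_measurable)
  have t': "0 < t'" using t by simp
  let ?c = "(t' / t) ^ n"
  have c: "0 \<le> ?c" using t by simp
  have "ennreal (avg t g x) = convolution n (dilate n t K) g x"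
    by (rule convolution_bounded_integrable[OF x t(1) g, symmetric])
  also have "\<dots> \<le> convolution n (dilate n t' K) (\<lambda>y. ?c * g y) x"
    unfolding convolution_def
  proof (intro nn_integral_mono ennreal_leI)
    fix y
    let ?v = "\<lambda>i\<in>{..<n}. x i - y i"
    have "dilate n t K ?v * g y \<le> ?c * dilate n t' K ?v * g y"
      using t g by (intro mult_right_mono dilate_le) (auto simp: space_PiM)
    then show "dilate n t K ?v * g y \<le> dilate n t' K ?v * (?c * g y)" by (simp only: mult_ac)
  qed
  also have "\<dots> = ennreal (avg t' (\<lambda>y. ?c * g y) x)"
    using g c by (intro convolution_bounded_integrable x t' bounded_integrable_cmult) auto
  finally have "avg t g x \<le> avg t' (\<lambda>y. ?c * g y) x"
    using c g(2) by (subst (asm) ennreal_le_iff) (auto intro!: avg_nonneg)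
  then show ?thesis unfolding avg_def by simp
qed

text \<open>The maximal function is the lower limit of maximal functions \<open>u N\<close> over finer and finer grids, applied to
  truncations of the function. This gives its measurability, and Fatou's lemma gives the norm bound.\<close>
lemma maximal_function_bound:
  assumes gm [measurable]: "g \<in> borel_measurable (Leb {..<n})" and g: "\<And>y. 0 \<le> g y"
    and g': "AE y in Leb {..<n}. g' y = g y"
  defines "S \<equiv> \<lambda>x. SUP t\<in>{0<..}. convolution n (dilate n t K) g' x"
  obtains M where "M \<in> borel_measurable (Leb {..<n})" "\<And>x. x \<in> space (Leb {..<n}) \<Longrightarrow> S x = M x"
    "(\<integral>\<^sup>+x. (M x)\<^sup>2 \<partial>Leb {..<n}) \<le> ennreal (92\<^sup>2) * (\<integral>\<^sup>+x. ennreal ((g x)\<^sup>2) \<partial>Leb {..<n})"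
proof -
  let ?L = "Leb {..<n}"
  define Q :: "nat \<Rightarrow> (nat \<Rightarrow> real) set" where "Q m = ({..<n} \<rightarrow>\<^sub>E {- real m..real m})" for m
  have [measurable]: "Q m \<in> sets ?L" for m unfolding Q_def by (intro sets_PiM_I_finite) auto
  define h where "h m y = min (g y) (real m) * indicator (Q m) y" for m y
  have h0: "0 \<le> h m y" for m y using g by (simp add: h_def)
  have hg: "h m y \<le> g y" for m y using g[of y] by (auto simp: h_def indicator_def)
  have hm [measurable]: "h m \<in> borel_measurable ?L" for m unfolding h_def by measurable
  have hb: "bounded_integrable n (h m)" for m
  proof -
    have "box_bounded {..<n} (real m) (real m) (h m)"
      unfolding box_bounded_def using hm h0 by (force simp: h_def indicator_def Q_def PiE_iff)
    then have "integrable ?L (h m)" by (intro integrable_box_bounded) auto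
    moreover have "\<bar>h m y\<bar> \<le> real m" for y using g[of y] by (auto simp: h_def indicator_def)
    ultimately show ?thesis by (auto simp: bounded_integrable_def)
  qed
  have Q_mono: "Q m \<subseteq> Q m'" if "m \<le> m'" for m m'
    using that unfolding Q_def by (intro PiE_mono) auto
  have h_mono: "h m y \<le> h m' y" if "m \<le> m'" for m m' y
    using g[of y] Q_mono[OF that] that by (auto simp: h_def indicator_def)
  have h_lim: "(SUP m. ennreal (h m y)) = ennreal (g y)" if y: "y \<in> space ?L" for y
  proof (rule antisym)
    show "(SUP m. ennreal (h m y)) \<le> ennreal (g y)" by (intro SUP_least ennreal_leI hg)
    obtain m :: nat where m: "max (g y) (Max (insert 0 ((\<lambda>i. \<bar>y i\<bar>) ` {..<n}))) \<le> real m"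
      using real_arch_simple by blast
    have "\<bar>y i\<bar> \<le> real m" if "i < n" for i using m that by auto
    then have "y \<in> Q m" using y by (auto simp: Q_def space_PiM PiE_iff abs_le_iff) (smt (verit))+
    then have "h m y = g y" using m by (simp add: h_def)
    then show "ennreal (g y) \<le> (SUP m. ennreal (h m y))" by (metis SUP_upper UNIV_I)
  qed
  have S_eq: "S x = (SUP t\<in>{0<..}. SUP m. ennreal (avg t (h m) x))" if x: "x \<in> space ?L" for x
    unfolding S_def
  proof (intro SUP_cong refl)
    fix t :: real assume "t \<in> {0<..}"
    then have t: "0 < t" by simp
    have "convolution n (dilate n t K) g' x = (\<integral>\<^sup>+z. ennreal (g (affine_map n (- t) x z)) \<partial>law)"
      by (rule convolution_eq_average[OF x t gm g g'])
    also have "\<dots> = (\<integral>\<^sup>+z. (SUP m. ennreal (h m (affine_map n (- t) x z))) \<partial>law)"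
      by (simp add: h_lim)
    also have "\<dots> = (SUP m. \<integral>\<^sup>+z. ennreal (h m (affine_map n (- t) x z)) \<partial>law)"
      by (intro nn_integral_monotone_convergence_SUP) (auto simp: incseq_def le_fun_def intro!: ennreal_leI h_mono)
    also have "\<dots> = (SUP m. ennreal (avg t (h m) x))"
      unfolding avg_def using h0
      by (intro SUP_cong refl nn_integral_eq_integral integrable_translate hb) auto
    finally show "convolution n (dilate n t K) g' x = (SUP m. ennreal (avg t (h m) x))" .
  qed
  define u where "u N x = Max ((\<lambda>(k, i). avg (grid_time (1 / 2 ^ N) N k i) (h N) x) ` ({..2 * N} \<times> {..2 ^ N}))" for N :: nat and x
  have ub: "bounded_integrable n (u N)" for N
    unfolding u_def
    using bounded_integrable_Max[of "{..2 * N} \<times> {..2 ^ N :: nat}" "\<lambda>p. avg (grid_time (1 / 2 ^ N) N (fst p) (snd p)) (h N)"]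
    by (auto simp: split_beta' intro!: bounded_integrable_avg hb avg_nonneg h0)
  note [measurable] = bounded_integrable_measurable[OF ub]
  have u0: "0 \<le> u N x" for N x
  proof -
    obtain k i where "u N x = avg (grid_time (1 / 2 ^ N) N k i) (h N) x"
      unfolding u_def by (rule Max_grid_attained)
    then show ?thesis using avg_nonneg[of "h N"] h0 by (simp only:)
  qed
  have u_le: "ennreal (u N x) \<le> S x" if x: "x \<in> space ?L" for N x
  proof -
    obtain k i where *: "u N x = avg (grid_time (1 / 2 ^ N) N k i) (h N) x"
      unfolding u_def by (rule Max_grid_attained)
    have "0 < grid_time (1 / 2 ^ N) N k i" unfolding grid_time_def by (intro mult_pos_pos add_pos_nonneg) auto
    then show ?thesis unfolding * S_eq[OF x] by (intro SUP_upper2[of "grid_time (1 / 2 ^ N) N k i"] SUP_upper) auto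
  qed
  define c :: "nat \<Rightarrow> real" where "c N = inverse ((1 + 1 / 2 ^ N) ^ n)" for N
  have c0: "0 \<le> c N" for N by (simp add: c_def)
  have c_lim: "c \<longlonglongrightarrow> 1"
  proof -
    have "(\<lambda>N. 1 / 2 ^ N :: real) \<longlonglongrightarrow> 0" by real_asymp
    then have "(\<lambda>N. inverse ((1 + 1 / 2 ^ N) ^ n) :: real) \<longlonglongrightarrow> inverse ((1 + 0) ^ n)"
      by (intro tendsto_intros) auto
    then show ?thesis by (simp add: c_def[abs_def])
  qed
  \<comment> \<open>\<open>c N\<close> is the inverse of the factor that is lost when \<open>t\<close> is moved up to the next grid point.\<close>
  have key: "eventually (\<lambda>N. c N * avg t (h m) x \<le> u N x) sequentially" if x: "x \<in> space ?L" and t: "0 < t" for t m x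
  proof -
    have "(\<lambda>N. 1 / 2 ^ N :: real) \<longlonglongrightarrow> 0" by real_asymp
    then have e1: "eventually (\<lambda>N. 1 / 2 ^ N < t) sequentially" using t by (rule order_tendstoD)
    have "filterlim (\<lambda>N. 2 ^ N :: real) at_top sequentially" by real_asymp
    then have e2: "eventually (\<lambda>N. t < 2 ^ N) sequentially" by (simp add: filterlim_at_top_dense)
    show ?thesis
      using e1 e2 eventually_ge_at_top[of m]
    proof eventually_elim
      case (elim N)
      obtain k i where ki: "k \<le> 2 * N" "i \<le> 2 ^ N"
        "t \<le> 2 ^ k * (1 / 2 ^ N) * (1 + real i / 2 ^ N)" "2 ^ k * (1 / 2 ^ N) * (1 + real i / 2 ^ N) \<le> t * (1 + 1 / 2 ^ N)"
        using grid_time_approximates[OF t less_imp_le[OF elim(1)] elim(2)] .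
      let ?t = "grid_time (1 / 2 ^ N) N k i"
      have tt: "t \<le> ?t" "?t \<le> t * (1 + 1 / 2 ^ N)" using ki(3,4) by (simp_all only: grid_time_def)
      have "avg t (h m) x \<le> avg t (h N) x" by (intro avg_mono hb h_mono elim(3))
      also have "\<dots> \<le> (?t / t) ^ n * avg ?t (h N) x" by (intro avg_le_avg_later x t tt hb h0)
      also have "\<dots> \<le> (1 + 1 / 2 ^ N) ^ n * u N x"
      proof (intro mult_mono power_mono)
        show "?t / t \<le> 1 + 1 / 2 ^ N" using tt(2) t by (simp add: pos_divide_le_eq mult.commute)
        show "avg ?t (h N) x \<le> u N x" unfolding u_def using ki(1,2) by (intro Max_ge) auto
      qed (use tt(1) t avg_nonneg[of "h N"] h0 in auto)
      finally have "c N * avg t (h m) x \<le> c N * ((1 + 1 / 2 ^ N) ^ n * u N x)" using c0 by (intro mult_left_mono)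
      moreover have "c N * ((1 + 1 / 2 ^ N) ^ n) = 1"
      proof -
        have "(1 + 1 / 2 ^ N :: real) \<noteq> 0" by (simp add: add_nonneg_eq_0_iff)
        then show ?thesis by (simp add: c_def)
      qed
      ultimately show ?case by (simp only: mult.assoc[symmetric] mult_1)
    qed
  qed
  have lower: "ennreal (avg t (h m) x ^ p) \<le> liminf (\<lambda>N. ennreal (u N x ^ p))" if x: "x \<in> space ?L" and t: "0 < t" for t m x p
  proof -
    have a0: "0 \<le> avg t (h m) x" by (intro avg_nonneg h0)
    have "(\<lambda>N. ennreal ((c N * avg t (h m) x) ^ p)) \<longlonglongrightarrow> ennreal ((1 * avg t (h m) x) ^ p)"
      by (intro tendsto_ennrealI tendsto_intros c_lim)
    from lim_imp_Liminf[OF _ this] have "ennreal (avg t (h m) x ^ p) = liminf (\<lambda>N. ennreal ((c N * avg t (h m) x) ^ p))"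
      by simp
    also have "\<dots> \<le> liminf (\<lambda>N. ennreal (u N x ^ p))"
      using key[OF x t, of m]
      by (intro Liminf_mono, elim eventually_mono) (auto intro!: ennreal_leI power_mono mult_nonneg_nonneg c0 a0)
    finally show ?thesis .
  qed
  show thesis
  proof (rule that[of "\<lambda>x. liminf (\<lambda>N. ennreal (u N x))"])
    show "(\<lambda>x. liminf (\<lambda>N. ennreal (u N x))) \<in> borel_measurable ?L" by measurable
    show eq: "S x = liminf (\<lambda>N. ennreal (u N x))" if x: "x \<in> space ?L" for x
    proof (rule antisym)
      show "S x \<le> liminf (\<lambda>N. ennreal (u N x))"
        unfolding S_eq[OF x] using lower[OF x, of _ _ 1] by (intro SUP_least) auto
      show "liminf (\<lambda>N. ennreal (u N x)) \<le> S x"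
        using u_le[OF x] by (intro Liminf_le) auto
    qed
    have "(\<integral>\<^sup>+x. (liminf (\<lambda>N. ennreal (u N x)))\<^sup>2 \<partial>?L) \<le> (\<integral>\<^sup>+x. liminf (\<lambda>N. ennreal ((u N x)\<^sup>2)) \<partial>?L)"
    proof (rule nn_integral_mono)
      fix x assume x: "x \<in> space ?L"
      have "(S x)\<^sup>2 \<le> liminf (\<lambda>N. ennreal ((u N x)\<^sup>2))"
        unfolding S_eq[OF x]
      proof (intro SUP_square_le_ennreal)
        fix t :: real and m assume "t \<in> {0<..}"
        then have "ennreal ((avg t (h m) x)\<^sup>2) \<le> liminf (\<lambda>N. ennreal ((u N x)\<^sup>2))"
          by (intro lower x) simp
        then show "(ennreal (avg t (h m) x))\<^sup>2 \<le> liminf (\<lambda>N. ennreal ((u N x)\<^sup>2))"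
          using avg_nonneg[of "h m" t x] h0 by (simp add: ennreal_power)
      qed
      then show "(liminf (\<lambda>N. ennreal (u N x)))\<^sup>2 \<le> liminf (\<lambda>N. ennreal ((u N x)\<^sup>2))"
        by (simp only: eq[OF x])
    qed
    also have "\<dots> \<le> liminf (\<lambda>N. \<integral>\<^sup>+x. ennreal ((u N x)\<^sup>2) \<partial>?L)"
      by (rule nn_integral_liminf) measurable
    also have "\<dots> \<le> ennreal (92\<^sup>2) * (\<integral>\<^sup>+x. ennreal ((g x)\<^sup>2) \<partial>?L)"
    proof (intro Liminf_le always_eventually allI)
      fix N
      have sq: "integrable ?L (\<lambda>x. (f x)\<^sup>2)" if "bounded_integrable n f" for f
        using bounded_integrable_square[OF that] by (simp add: bounded_integrable_def)
      have nn: "(\<integral>\<^sup>+x. ennreal ((f x)\<^sup>2) \<partial>?L) = ennreal (L2sq n f)" if "bounded_integrable n f" for f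
        by (rule nn_integral_eq_integral[OF sq[OF that]]) simp
      have "L2sq n (u N) \<le> 92\<^sup>2 * L2sq n (h N)"
        unfolding u_def by (rule grid_maximal_92[OF hb h0]) simp
      then have "(\<integral>\<^sup>+x. ennreal ((u N x)\<^sup>2) \<partial>?L) \<le> ennreal (92\<^sup>2 * L2sq n (h N))"
        unfolding nn[OF ub] by (rule ennreal_leI)
      also have "\<dots> = ennreal (92\<^sup>2) * (\<integral>\<^sup>+x. ennreal ((h N x)\<^sup>2) \<partial>?L)"
        unfolding nn[OF hb] by (rule ennreal_mult) auto
      also have "\<dots> \<le> ennreal (92\<^sup>2) * (\<integral>\<^sup>+x. ennreal ((g x)\<^sup>2) \<partial>?L)"
        by (intro mult_left_mono nn_integral_mono ennreal_leI power_mono hg h0) auto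
      finally show "(\<integral>\<^sup>+x. ennreal ((u N x)\<^sup>2) \<partial>?L) \<le> ennreal (92\<^sup>2) * (\<integral>\<^sup>+x. ennreal ((g x)\<^sup>2) \<partial>?L)" .
    qed simp
    finally show "(\<integral>\<^sup>+x. (liminf (\<lambda>N. ennreal (u N x)))\<^sup>2 \<partial>?L) \<le> ennreal (92\<^sup>2) * (\<integral>\<^sup>+x. ennreal ((g x)\<^sup>2) \<partial>?L)" .
  qed
qed

end

lemma log_concave_kernel_exists:
  assumes sym: "symmetric_fun n K" and lc: "log_concave n K" and pd: "prob_density n K"
  obtains K0 Z where "log_concave_kernel n K K0 Z"
proof -
  let ?L = "Leb {..<n}"
  have K: "K \<in> borel_measurable (completion ?L)" "\<forall>x\<in>Rn n. 0 \<le> K x" "(\<integral>\<^sup>+x. ennreal (K x) \<partial>completion ?L) = 1"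
    using pd by (auto simp: prob_density_def lebesgue_Rn_def)
  obtain G where G [measurable]: "G \<in> borel_measurable ?L" "AE x in ?L. K x = G x"
    using completion_ex_borel_measurable_real[OF K(1)] by auto
  obtain Z where Z: "\<forall>x\<in>space ?L - Z. K x = G x" "Z \<in> null_sets ?L"
    by (rule AE_E3[OF G(2)]) blast
  define K0 where "K0 x = max 0 (G x)" for x
  have K0: "K0 x = K x" if "x \<in> space ?L" "x \<notin> Z" for x
  proof -
    have "0 \<le> K x" using K(2) that(1) by (simp add: Rn_def space_PiM)
    then show ?thesis using Z(1) that by (simp add: K0_def)
  qed
  have "(\<integral>\<^sup>+x. ennreal (K0 x) \<partial>?L) = (\<integral>\<^sup>+x. ennreal (K x) \<partial>?L)"
  proof (rule nn_integral_cong_AE)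
    show "AE x in ?L. ennreal (K0 x) = ennreal (K x)"
      using AE_not_in[OF Z(2)] AE_space by eventually_elim (simp add: K0)
  qed
  then have "(\<integral>\<^sup>+x. ennreal (K0 x) \<partial>?L) = 1" using K(3) by (simp add: nn_integral_completion)
  then have "log_concave_kernel n K K0 Z"
    using sym lc Z(2) K0 by unfold_locales (auto simp: K0_def[abs_def])
  then show thesis by (rule that)
qed

theorem theorem5p2:
  "\<exists>\<kappa>::real. 0 \<le> \<kappa> \<and> \<kappa> < 140 \<and>
     (\<forall>n::nat. n \<ge> 1 \<longrightarrow>
       (\<forall>K :: (nat \<Rightarrow> real) \<Rightarrow> real.
          symmetric_fun n K \<and> log_concave n K \<and> prob_density n K \<longrightarrow>
          (\<forall>f \<in> L2_space (lebesgue_Rn n).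
             maximal_op n K f \<in> borel_measurable (lebesgue_Rn n) \<and>
             L2_norm (lebesgue_Rn n) (maximal_op n K f)
               \<le> ennreal \<kappa> * L2_norm (lebesgue_Rn n) (\<lambda>x. ennreal (cmod (f x))))))"
proof (intro exI[of _ 92] conjI allI impI ballI)
  fix n :: nat and K :: "(nat \<Rightarrow> real) \<Rightarrow> real" and f
  assume K: "symmetric_fun n K \<and> log_concave n K \<and> prob_density n K"
    and f: "f \<in> L2_space (lebesgue_Rn n)"
  let ?L = "Leb {..<n}"
  obtain K0 Z where "log_concave_kernel n K K0 Z" using K log_concave_kernel_exists by blast
  then interpret log_concave_kernel n K K0 Z .
  have fm: "f \<in> borel_measurable (completion ?L)"
    and ff: "L2_norm (completion ?L) (\<lambda>x. ennreal (cmod (f x))) < \<infinity>"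
    using f by (auto simp: L2_space_def lebesgue_Rn_def)
  have "(\<lambda>x. cmod (f x)) \<in> borel_measurable (completion ?L)" using fm by simp
  then obtain G where G [measurable]: "G \<in> borel_measurable ?L" "AE x in ?L. cmod (f x) = G x"
    using completion_ex_borel_measurable_real by blast
  define g where "g x = max 0 (G x)" for x
  have gm: "g \<in> borel_measurable ?L" unfolding g_def by measurable
  have gAE: "AE x in ?L. cmod (f x) = g x"
    using G(2) by eventually_elim (metis g_def max.absorb2 norm_ge_zero)
  obtain M where M: "M \<in> borel_measurable ?L"
    "\<And>x. x \<in> space ?L \<Longrightarrow> (SUP t\<in>{0<..}. convolution n (dilate n t K) (\<lambda>y. cmod (f y)) x) = M x"
    "(\<integral>\<^sup>+x. (M x)\<^sup>2 \<partial>?L) \<le> ennreal (92\<^sup>2) * (\<integral>\<^sup>+x. ennreal ((g x)\<^sup>2) \<partial>?L)"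
    by (rule maximal_function_bound[OF gm _ gAE]) (auto simp: g_def)
  have eq: "maximal_op n K f x = M x" if "x \<in> space ?L" for x
    using M(2)[OF that] by (simp add: maximal_op_def)
  show "maximal_op n K f \<in> borel_measurable (lebesgue_Rn n)"
    using measurable_completion[OF M(1)] eq unfolding lebesgue_Rn_def
    by (subst measurable_cong[where g=M]) auto
  define I where "I = (\<integral>\<^sup>+x. (ennreal (cmod (f x)))\<^sup>2 \<partial>completion ?L)"
  define J where "J = (\<integral>\<^sup>+x. (maximal_op n K f x)\<^sup>2 \<partial>completion ?L)"
  have "J = (\<integral>\<^sup>+x. (M x)\<^sup>2 \<partial>?L)"
    unfolding J_def nn_integral_completion by (intro nn_integral_cong) (simp add: eq)
  also note M(3)
  also have "(\<integral>\<^sup>+x. ennreal ((g x)\<^sup>2) \<partial>?L) = I"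
    unfolding I_def nn_integral_completion
  proof (rule nn_integral_cong_AE)
    show "AE x in ?L. ennreal ((g x)\<^sup>2) = (ennreal (cmod (f x)))\<^sup>2"
      using gAE by eventually_elim (metis ennreal_power norm_ge_zero)
  qed
  finally have JI: "J \<le> ennreal (92\<^sup>2) * I" .
  have "I \<noteq> \<infinity>" using ff by (auto simp: L2_norm_def Let_def I_def)
  then obtain i where i: "I = ennreal i" "0 \<le> i" by (cases I) auto
  have "J \<le> ennreal (92\<^sup>2 * i)" using JI i by (simp add: ennreal_mult)
  then obtain j where j: "J = ennreal j" "0 \<le> j" "j \<le> 92\<^sup>2 * i"
    using i by (cases J) (auto simp: top_unique)
  have "sqrt j \<le> 92 * sqrt i"
    using real_sqrt_le_mono[OF j(3)] by (simp add: real_sqrt_mult)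
  then have "ennreal (sqrt j) \<le> ennreal 92 * ennreal (sqrt i)"
    using i by (subst ennreal_mult[symmetric]) (auto intro!: ennreal_leI)
  then show "L2_norm (lebesgue_Rn n) (maximal_op n K f)
     \<le> ennreal 92 * L2_norm (lebesgue_Rn n) (\<lambda>x. ennreal (cmod (f x)))"
    using i j by (simp add: L2_norm_def Let_def lebesgue_Rn_def flip: I_def J_def)
qed auto

end
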